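(* Let $x_t$ be the solution of the SDE $dx_t=\frac1\varepsilon f(x_t,t)\,dt+\frac{\sigma}{\sqrt\varepsilon}\,dW_t$ on $[-T,T]$, and let $x^{\det}_t$ be the solution of $\varepsilon\frac{dx^{\det}_t}{dt}=f(x^{\det}_t,t)$, both with the same deterministic initial condition $x_{-T}$ satisfying $x_{-T}-x^\star_+(-T)\asymp\varepsilon$. For $h>0$ let $$\mathcal B(h)=\{(x,t):|t|\le T,\ |x-x^{\det}_t|<h\sqrt{\zeta(t)}\}$$ and let $\tau_{\mathcal B(h)}$ be the first exit time of $x_t$ from $\mathcal B(h)$. There exists a constant $h_0>0$, depending only on $f$, such that: (a) if $-T\le t\le-(\sqrt{a_0}\vee\sqrt\varepsilon)$ and $h<h_0|t|^{3/2}$, then $$\mathbb P^{-T,x_{-T}}\{\tau_{\mathcal B(h)}<t\}\le C(t,\varepsilon)\exp\Bigl\{-\frac12\frac{h^2}{\sigma^2}\Bigl[1-\mathcal O(\varepsilon)-\mathcal O\Bigl(\frac h{|t|^{3/2}}\Bigr)\Bigr]\Bigr\};$$ (b) if $-(\sqrt{a_0}\vee\sqrt\varepsilon)\le t\le T$ and $h<h_0(a_0^{3/4}\vee\varepsilon^{3/4})$, then $$\mathbb P^{-T,x_{-T}}\{\tau_{\mathcal B(h)}<t\}\le C(t,\varepsilon)\exp\Bigl\{-\frac12\frac{h^2}{\sigma^2}\Bigl[1-\mathcal O(\varepsilon)-\mathcal O\Bigl(\frac h{a_0^{3/4}\vee\varepsilon^{3/4}}\Bigr)\Bigr]\Bigr\}.$$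 In both cases $C(t,\varepsilon)=\frac1{\varepsilon^2}|\bar\alpha(t,-T)|+2$.
   Context: Conventions. $\varepsilon>0$ is a small parameter, and all assertions are for sufficiently small $\varepsilon$. $a_0=a_0(\varepsilon)>0$ with $a_0\to0$ as $\varepsilon\to0$, and $\sigma=\sigma(\varepsilon)>0$. $\vee,\wedge$ denote maximum and minimum. For $\varphi\ge 0$, $\psi\asymp\varphi$ means $c_-\varphi\le\psi\le c_+\varphi$ with constants $c_\pm>0$ independent of $t,\varepsilon$ (hence of $a_0,\sigma$); $\psi\asymp-\varphi$ means $-\psi\asymp\varphi$. $\mathcal O(u)$ denotes a quantity bounded by $K|u|$ for small $u$, with $K$ independent of $\varepsilon,a_0,\sigma$. Asymmetric setting. $f:\mathbb R^2\to\mathbb R$ may depend on $\varepsilon$ through $a_0$ only, with all constants and derivative bounds below independent of $\varepsilon$. With $d>0$ a constant and $\mathcal M=[-d,d]\times\mathbb R$: $f\in\mathcal C^3(\mathcal M,\mathbb R)$; $f(x,t+1)=f(x,t)$ on $\mathcal M$; there are continuous functions $x^\star_-<x^\star_0<x^\star_+$ from $\mathbb R$ to $[-d,d]$ such that in $\mathcal M$, $f(x,t)=0$ iff $x\in\{x^\star_-(t),x^\star_0(t),x^\star_+(t)\}$; for every $\delta>0$ there is a constant $\rho>0$ such that $|x-x^\star_\pm(t)|\ge\delta$ and $|x-x^\star_0(t)|\ge\delta$ imply $|f(x,t)|\ge\rho$; for all $t$, $a^\star_\pm(t):=\partial_xf(x^\star_\pm(t),t)<0$ and $a^\star_0(t):=\partial_xf(x^\star_0(t),t)>0$.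 Near $t=0$: there is $x_c\in(-d,d)$ with $\partial_{xx}f(x_c,0)<0$, $\partial_xf(x_c,t)=\mathcal O(t^2)$ and $f(x_c,t)=a_0+a_1t^2+\mathcal O(t^3)$, where $a_1>0$ and $\partial_{xx}f(x_c,0)$ are fixed. Then $x^\star_+$ has a local minimum at a time $t^\star_+=\mathcal O(a_0)$ and $x^\star_0$ a local maximum at a time $t^\star_0=\mathcal O(a_0)$. $T>0$ is a sufficiently small constant such that: $x^\star_+(t)-x_c\asymp\sqrt{a_0}$, $a^\star_+(t)\asymp-\sqrt{a_0}$, $x^\star_0(t)-x_c\asymp-\sqrt{a_0}$, $a^\star_0(t)\asymp\sqrt{a_0}$ for $|t|\le\sqrt{a_0}$; $x^\star_+(t)-x_c\asymp|t|$, $a^\star_+(t)\asymp-|t|$, $x^\star_0(t)-x_c\asymp-|t|$, $a^\star_0(t)\asymp|t|$ for $\sqrt{a_0}\le|t|\le T$; $x^\star_-(t)-x_c\asymp-1$, $a^\star_-(t)\asymp-1$ for $|t|\le T$. Near some $t_c\in(T,1-T)$ and a point $x_c'$, analogous relations with opposite signs hold (so that $x^\star_-$ and $x^\star_0$ come close), and for $T<t<t_c-T$ and $t_c+T<t<1-T$ the differences $x^\star_+-x^\star_0$, $x^\star_0-x^\star_-$ and the derivatives $a^\star_\pm,a^\star_0$ are bounded away from zero. SDE. $W$ is a standard Wiener process; $f$ satisfies the usual (local) Lipschitz and bounded-growth conditions guaranteeing a pathwise unique strong solution with continuous paths. $\mathbb P^{t_0,x_0}$ is the law of the solution started in $x_0$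 at time $t_0$. The first exit time of $x_t$ from a space–time set is the first time $(x_t,t)$ is not in the set, and $\infty$ if there is no such time in the time interval considered. Notation. $\bar a(t)=\partial_xf(x^{\det}_t,t)$, $\bar\alpha(t,s)=\int_s^t\bar a(u)\,du$, and $$\zeta(t)=\frac1{2|\bar a(-T)|}e^{2\bar\alpha(t,-T)/\varepsilon}+\frac1\varepsilon\int_{-T}^te^{2\bar\alpha(t,s)/\varepsilon}\,ds .$$ *)

theory Defs
  imports "HOL-Probability.Probability"
begin

section \<open>Drift family\<close>

text \<open>
  \<open>\<psi> \<asymp> \<phi>\<close> uniformly over an index set. Indices are pairs \<open>(a, t)\<close>, so the constants depend neither
  on time nor on \<open>a = a\<^sub>0(\<epsilon>)\<close>. A relation \<open>\<psi> \<asymp> -\<phi>\<close> is written \<open>-\<psi> \<asymp> \<phi>\<close>.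
\<close>

definition comparable_on :: "'i set \<Rightarrow> ('i \<Rightarrow> real) \<Rightarrow> ('i \<Rightarrow> real) \<Rightarrow> bool" where
  "comparable_on S \<psi> \<phi> \<longleftrightarrow>
     (\<exists>cm>0. \<exists>cp>0. \<forall>i\<in>S. cm * \<phi> i \<le> \<psi> i \<and> \<psi> i \<le> cp * \<phi> i)"

text \<open>
  All partial derivatives up to order \<open>k\<close> exist on the open set \<open>U\<close>, are continuous, and are
  bounded by \<open>B\<close>.
\<close>

primrec bounded_C :: "nat \<Rightarrow> real \<Rightarrow> (real \<times> real) set \<Rightarrow> (real \<Rightarrow> real \<Rightarrow> real) \<Rightarrow> bool" where
  "bounded_C 0 B U g \<longleftrightarrow>
     continuous_on U (\<lambda>(x, t). g x t) \<and> (\<forall>(x, t)\<in>U. \<bar>g x t\<bar> \<le> B)"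
| "bounded_C (Suc k) B U g \<longleftrightarrow>
     continuous_on U (\<lambda>(x, t). g x t) \<and> (\<forall>(x, t)\<in>U. \<bar>g x t\<bar> \<le> B) \<and>
     (\<exists>gx gt.
        (\<forall>(x, t)\<in>U. ((\<lambda>y. g y t) has_real_derivative gx x t) (at x)) \<and>
        (\<forall>(x, t)\<in>U. ((\<lambda>s. g x s) has_real_derivative gt x t) (at t)) \<and>
        bounded_C k B U gx \<and> bounded_C k B U gt)"

definition dx :: "(real \<Rightarrow> real \<Rightarrow> real) \<Rightarrow> real \<Rightarrow> real \<Rightarrow> real" where
  "dx g x t = deriv (\<lambda>y. g y t) x"

text \<open>
  Avoided saddle-node bifurcation of the family \<open>(F a)\<close> with \<open>a \<in> A\<close>, at \<open>(xc, tc)\<close>. The sign is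
  \<open>s = 1\<close> when the upper stable branch approaches the unstable one, and \<open>s = -1\<close> in the mirror
  situation. The constants \<open>q\<close>, \<open>a1\<close> and those of the \<open>\<O>\<close>-terms do not depend on \<open>a\<close>.
\<close>

definition avoided_bifurcation ::
    "(real \<Rightarrow> real \<Rightarrow> real \<Rightarrow> real) \<Rightarrow> real set \<Rightarrow> real \<Rightarrow> real \<Rightarrow> real \<Rightarrow> bool" where
  "avoided_bifurcation F A s xc tc \<longleftrightarrow>
     (\<exists>q>0. \<forall>a\<in>A. s * dx (dx (F a)) xc tc = - q) \<and>
     (\<exists>K. \<exists>r>0. \<forall>a\<in>A. \<forall>t. \<bar>t - tc\<bar> \<le> r \<longrightarrow> \<bar>dx (F a) xc t\<bar> \<le> K * \<bar>t - tc\<bar>^2) \<and>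
     (\<exists>a1>0. \<exists>K. \<exists>r>0. \<forall>a\<in>A. \<forall>t. \<bar>t - tc\<bar> \<le> r \<longrightarrow>
        \<bar>s * F a xc t - (a + a1 * (t - tc)^2)\<bar> \<le> K * \<bar>t - tc\<bar>^3)"

text \<open>
  Location and linearisation of the equilibrium branches near such a point: \<open>y\<close> is the stable
  branch that comes close to the unstable branch \<open>z\<close>, and \<open>w\<close> is the other stable branch. Only the
  positions change sign with \<open>s\<close>; the linearisations are negative on the stable branches and
  positive on the unstable one in either case.
\<close>

definition branches_near ::
    "(real \<Rightarrow> real \<Rightarrow> real \<Rightarrow> real) \<Rightarrow> real set \<Rightarrow> real \<Rightarrow> real \<Rightarrow> real \<Rightarrow> real \<Rightarrow>
     (real \<Rightarrow> real \<Rightarrow> real) \<Rightarrow> (real \<Rightarrow> real \<Rightarrow> real) \<Rightarrow> (real \<Rightarrow> real \<Rightarrow> real) \<Rightarrow> bool" where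
  "branches_near F A T s xc tc y z w \<longleftrightarrow>
     (let inner = {(a, t). a \<in> A \<and> \<bar>t - tc\<bar> \<le> sqrt a};
          outer = {(a, t). a \<in> A \<and> sqrt a \<le> \<bar>t - tc\<bar> \<and> \<bar>t - tc\<bar> \<le> T};
          all = {(a, t). a \<in> A \<and> \<bar>t - tc\<bar> \<le> T}
      in comparable_on inner (\<lambda>(a, t). s * (y a t - xc)) (\<lambda>(a, t). sqrt a) \<and>
         comparable_on inner (\<lambda>(a, t). - dx (F a) (y a t) t) (\<lambda>(a, t). sqrt a) \<and>
         comparable_on inner (\<lambda>(a, t). - s * (z a t - xc)) (\<lambda>(a, t). sqrt a) \<and>
         comparable_on inner (\<lambda>(a, t). dx (F a) (z a t) t) (\<lambda>(a, t). sqrt a) \<and>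
         comparable_on outer (\<lambda>(a, t). s * (y a t - xc)) (\<lambda>(a, t). \<bar>t - tc\<bar>) \<and>
         comparable_on outer (\<lambda>(a, t). - dx (F a) (y a t) t) (\<lambda>(a, t). \<bar>t - tc\<bar>) \<and>
         comparable_on outer (\<lambda>(a, t). - s * (z a t - xc)) (\<lambda>(a, t). \<bar>t - tc\<bar>) \<and>
         comparable_on outer (\<lambda>(a, t). dx (F a) (z a t) t) (\<lambda>(a, t). \<bar>t - tc\<bar>) \<and>
         comparable_on all (\<lambda>(a, t). - s * (w a t - xc)) (\<lambda>(a, t). 1) \<and>
         comparable_on all (\<lambda>(a, t). - dx (F a) (w a t) t) (\<lambda>(a, t). 1))"

text \<open>
  The drift is a family \<open>F a\<close> with \<open>0 < a \<le> amax\<close>; at noise parameter \<open>\<epsilon>\<close> the drift is \<open>F (a\<^sub>0 \<epsilon>)\<close>.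
  Every constant below whose quantifier precedes \<open>a\<close> is thereby independent of \<open>\<epsilon>\<close>. The functions
  \<open>xm a\<close>, \<open>xz a\<close>, \<open>xp a\<close> are the equilibrium branches \<open>x\<^sup>\<star>\<^sub>-\<close>, \<open>x\<^sup>\<star>\<^sub>0\<close>, \<open>x\<^sup>\<star>\<^sub>+\<close>.

  Regularity on the closed strip \<open>\<bar>x\<bar> \<le> d\<close> is understood as regularity on some open strip
  containing it, so that two-sided derivatives make sense at \<open>\<bar>x\<bar> = d\<close>, where the equilibrium
  branches are allowed to lie. Outside that strip only the conditions for pathwise unique
  existence are imposed. Growth is restricted one-sidedly, because \<open>\<bar>F a x t\<bar> \<le> K (1 + \<bar>x\<bar>)\<close>
  would exclude a quartic double-well potential.
\<close>

locale asymmetric_double_well =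
  fixes F :: "real \<Rightarrow> real \<Rightarrow> real \<Rightarrow> real"
    and amax d T :: real
    and xm xz xp :: "real \<Rightarrow> real \<Rightarrow> real"
  assumes amax_pos: "0 < amax"
    and d_pos: "0 < d"
    and T_pos: "0 < T"
    and measurable_F: "\<forall>a\<in>{0<..amax}. (\<lambda>(x, t). F a x t) \<in> borel_measurable borel"
    and local_lipschitz: "\<forall>a\<in>{0<..amax}. \<forall>R. \<exists>L. \<forall>t\<in>{-R..R}. L-lipschitz_on {-R..R} (\<lambda>x. F a x t)"
    and growth: "\<forall>a\<in>{0<..amax}. \<forall>R. \<exists>K. \<forall>t\<in>{-R..R}. \<forall>x. x * F a x t \<le> K * (1 + x^2)"
    and smooth: "\<exists>\<eta>>0. \<exists>B. \<forall>a\<in>{0<..amax}. bounded_C 3 B ({-(d + \<eta>)<..<d + \<eta>} \<times> UNIV) (F a)"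
    and periodic: "\<forall>a\<in>{0<..amax}. \<forall>x\<in>{-d..d}. \<forall>t. F a x (t + 1) = F a x t"
    and branches_continuous: "\<forall>a\<in>{0<..amax}.
          continuous_on UNIV (xm a) \<and> continuous_on UNIV (xz a) \<and> continuous_on UNIV (xp a)"
    and branches_ordered: "\<forall>a\<in>{0<..amax}. \<forall>t.
          -d \<le> xm a t \<and> xm a t < xz a t \<and> xz a t < xp a t \<and> xp a t \<le> d"
    and zeros: "\<forall>a\<in>{0<..amax}. \<forall>x\<in>{-d..d}. \<forall>t. F a x t = 0 \<longleftrightarrow> x \<in> {xm a t, xz a t, xp a t}"
    and away_from_zeros: "\<forall>\<delta>>0. \<exists>\<rho>>0. \<forall>a\<in>{0<..amax}. \<forall>x\<in>{-d..d}. \<forall>t.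
          \<bar>x - xm a t\<bar> \<ge> \<delta> \<and> \<bar>x - xp a t\<bar> \<ge> \<delta> \<and> \<bar>x - xz a t\<bar> \<ge> \<delta> \<longrightarrow> \<bar>F a x t\<bar> \<ge> \<rho>"
    and linearisations: "\<forall>a\<in>{0<..amax}. \<forall>t.
          dx (F a) (xm a t) t < 0 \<and> dx (F a) (xp a t) t < 0 \<and> dx (F a) (xz a t) t > 0"
    and bifurcation_at_0: "\<exists>xc\<in>{-d<..<d}.
          avoided_bifurcation F {0<..amax} 1 xc 0 \<and>
          branches_near F {0<..amax} T 1 xc 0 xp xz xm"
    and bifurcation_at_tc: "\<exists>tc\<in>{T<..<1 - T}.
          (\<exists>xc'\<in>{-d<..<d}.
             avoided_bifurcation F {0<..amax} (-1) xc' tc \<and>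
             branches_near F {0<..amax} T (-1) xc' tc xm xz xp) \<and>
          (\<exists>\<delta>>0. \<forall>a\<in>{0<..amax}. \<forall>t\<in>{T<..<tc - T} \<union> {tc + T<..<1 - T}.
             xp a t - xz a t \<ge> \<delta> \<and> xz a t - xm a t \<ge> \<delta> \<and>
             \<bar>dx (F a) (xm a t) t\<bar> \<ge> \<delta> \<and> \<bar>dx (F a) (xz a t) t\<bar> \<ge> \<delta> \<and> \<bar>dx (F a) (xp a t) t\<bar> \<ge> \<delta>)"

section \<open>Stochastic differential equation\<close>

text \<open>Wiener process on \<open>[t0, t1]\<close>, started in \<open>0\<close> at time \<open>t0\<close>, with respect to a filtration.\<close>

definition wiener_process ::
    "'w measure \<Rightarrow> (real \<Rightarrow> 'w measure) \<Rightarrow> real \<Rightarrow> real \<Rightarrow> (real \<Rightarrow> 'w \<Rightarrow> real) \<Rightarrow> bool" where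
  "wiener_process M \<F> t0 t1 W \<longleftrightarrow>
     prob_space M \<and> filtration (space M) \<F> \<and> (\<forall>t. subalgebra M (\<F> t)) \<and>
     (\<forall>t\<in>{t0..t1}. W t \<in> borel_measurable (\<F> t)) \<and>
     (AE \<omega> in M. W t0 \<omega> = 0) \<and>
     (\<forall>\<omega>\<in>space M. continuous_on {t0..t1} (\<lambda>t. W t \<omega>)) \<and>
     (\<forall>s t. t0 \<le> s \<and> s < t \<and> t \<le> t1 \<longrightarrow>
        distributed M lborel (\<lambda>\<omega>. W t \<omega> - W s \<omega>) (normal_density 0 (sqrt (t - s))) \<and>
        prob_space.indep_set M (sets (\<F> s))
          (sets (vimage_algebra (space M) (\<lambda>\<omega>. W t \<omega> - W s \<omega>) borel)))"

text \<open>
  Adapted solution with continuous paths of \<open>dX\<^sub>t = b(X\<^sub>t, t) dt + g dW\<^sub>t\<close> on \<open>[t0, t1]\<close>,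
  \<open>X\<^sub>t\<^sub>0 = x0\<close>. As \<open>g\<close> is constant, the Ito integral of the noise term is \<open>g (W\<^sub>t - W\<^sub>t\<^sub>0)\<close>.
\<close>

definition sde_solution ::
    "'w measure \<Rightarrow> (real \<Rightarrow> 'w measure) \<Rightarrow> (real \<Rightarrow> 'w \<Rightarrow> real) \<Rightarrow> (real \<Rightarrow> real \<Rightarrow> real) \<Rightarrow> real \<Rightarrow>
     real \<Rightarrow> real \<Rightarrow> real \<Rightarrow> (real \<Rightarrow> 'w \<Rightarrow> real) \<Rightarrow> bool" where
  "sde_solution M \<F> W b g t0 t1 x0 X \<longleftrightarrow>
     wiener_process M \<F> t0 t1 W \<and>
     (\<forall>t\<in>{t0..t1}. X t \<in> borel_measurable (\<F> t)) \<and>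
     (\<forall>\<omega>\<in>space M. continuous_on {t0..t1} (\<lambda>t. X t \<omega>)) \<and>
     (AE \<omega> in M. (\<lambda>s. b (X s \<omega>) s) integrable_on {t0..t1} \<and>
        (\<forall>t\<in>{t0..t1}. X t \<omega> = x0 + integral {t0..t} (\<lambda>s. b (X s \<omega>) s) + g * (W t \<omega> - W t0 \<omega>)))"

definition ode_solution ::
    "(real \<Rightarrow> real \<Rightarrow> real) \<Rightarrow> real \<Rightarrow> real \<Rightarrow> real \<Rightarrow> (real \<Rightarrow> real) \<Rightarrow> bool" where
  "ode_solution b t0 t1 x0 x \<longleftrightarrow> x t0 = x0 \<and>
     (\<forall>t\<in>{t0..t1}. (x has_real_derivative b (x t) t) (at t within {t0..t1}))"

text \<open>First exit time of a path on \<open>[t0, t1]\<close> from a space-time set; \<open>Inf {} = \<infinity>\<close> in \<^typ>\<open>ereal\<close>.\<close>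

definition exit_time :: "(real \<times> real) set \<Rightarrow> real \<Rightarrow> real \<Rightarrow> (real \<Rightarrow> real) \<Rightarrow> ereal" where
  "exit_time D t0 t1 x = Inf (ereal ` {s \<in> {t0..t1}. (x s, s) \<notin> D})"

section \<open>Neighbourhood of the deterministic solution\<close>

text \<open>
  \<open>f\<close> is the drift, without the factor \<open>1/\<epsilon>\<close>, and \<open>x\<close> the deterministic solution.
  \<open>alpha_bar f x t s\<close> is the integral of \<open>a_bar f x\<close> from \<open>s\<close> to \<open>t\<close>, and is used for \<open>s \<le> t\<close> only.
\<close>

definition a_bar :: "(real \<Rightarrow> real \<Rightarrow> real) \<Rightarrow> (real \<Rightarrow> real) \<Rightarrow> real \<Rightarrow> real" where
  "a_bar f x t = dx f (x t) t"

definition alpha_bar :: "(real \<Rightarrow> real \<Rightarrow> real) \<Rightarrow> (real \<Rightarrow> real) \<Rightarrow> real \<Rightarrow> real \<Rightarrow> real" where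
  "alpha_bar f x t s = integral {s..t} (a_bar f x)"

definition zeta :: "(real \<Rightarrow> real \<Rightarrow> real) \<Rightarrow> (real \<Rightarrow> real) \<Rightarrow> real \<Rightarrow> real \<Rightarrow> real \<Rightarrow> real" where
  "zeta f x \<epsilon> T t =
     1 / (2 * \<bar>a_bar f x (-T)\<bar>) * exp (2 * alpha_bar f x t (-T) / \<epsilon>) +
     1 / \<epsilon> * integral {-T..t} (\<lambda>s. exp (2 * alpha_bar f x t s / \<epsilon>))"

definition tube :: "(real \<Rightarrow> real \<Rightarrow> real) \<Rightarrow> (real \<Rightarrow> real) \<Rightarrow> real \<Rightarrow> real \<Rightarrow> real \<Rightarrow> (real \<times> real) set" where
  "tube f x \<epsilon> T h = {(y, t). \<bar>t\<bar> \<le> T \<and> \<bar>y - x t\<bar> < h * sqrt (zeta f x \<epsilon> T t)}"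

definition prefactor :: "(real \<Rightarrow> real \<Rightarrow> real) \<Rightarrow> (real \<Rightarrow> real) \<Rightarrow> real \<Rightarrow> real \<Rightarrow> real \<Rightarrow> real" where
  "prefactor f x \<epsilon> T t = 1 / \<epsilon>^2 * \<bar>alpha_bar f x t (-T)\<bar> + 2"

end

theory Submission
  imports Defs
begin

text \<open>
  Write \<open>y = x - x\<^sup>d\<^sup>e\<^sup>t\<close>, let \<open>a\<close> be the linearisation of the drift along the deterministic solution and put
  \<open>g(s) = exp (- \<alpha>(s, -T) / \<epsilon>)\<close>. Variation of constants gives \<open>g y = N + \<integral> g b / \<epsilon>\<close>, where
  \<open>N = \<sigma> / sqrt \<epsilon> \<cdot> \<integral> g dW\<close> is Gaussian and \<open>\<bar>b\<bar> \<le> B y\<^sup>2\<close> is the Taylor remainder of the drift. The function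
  \<open>Z = g\<^sup>2 \<zeta>\<close> satisfies \<open>Z' = g\<^sup>2 / \<epsilon>\<close>: it increases, \<open>\<sigma>\<^sup>2 Z\<close> dominates the variance of \<open>N\<close>, and the tube
  becomes \<open>\<bar>g y\<bar> < h sqrt Z\<close>.

  The nonlinear term is harmless. Inside the tube \<open>\<bar>b\<bar> \<le> B h\<^sup>2 \<zeta>\<close>, and \<open>(sqrt Z)' = g / (2 \<epsilon> sqrt \<zeta>)\<close>, so
  \<open>\<integral> g \<zeta> / \<epsilon> \<le> 2 (sup \<zeta>)\<^bsup>3/2\<^esup> sqrt Z\<close>. Leaving the tube therefore forces
  \<open>\<bar>N\<bar> \<ge> h (1 - 2 B h (sup \<zeta>)\<^bsup>3/2\<^esup>) sqrt Z\<close> (\<open>exit_forces_large_wiener_integral\<close>). If \<open>a \<le> - \<kappa> \<phi>\<close>, then the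
  equation \<open>\<epsilon> \<zeta>' = 2 a \<zeta> + 1\<close> keeps \<open>\<zeta>\<close> below \<open>1 / (2 \<kappa> \<phi>)\<close>, whence the relative error \<open>h / \<phi>\<^bsup>3/2\<^esup>\<close>.

  The linear part is a union bound (\<open>wiener_integral_tube\<close>). The time interval is cut into
  \<open>n \<approx> \<bar>\<alpha>(t, -T)\<bar> / (2 \<epsilon>\<^sup>2)\<close> pieces of equal length. On each of them \<open>Z\<close> varies only by a factor
  \<open>1 + \<O>(\<epsilon>)\<close>, because \<open>(ln Z)' = 1 / (\<epsilon> \<zeta>)\<close> is at most \<open>2 B / \<epsilon>\<close> and \<open>\<bar>\<alpha>(t, -T)\<bar>\<close> is at least a constant times
  \<open>t + T\<close>; so the Gaussian maximal inequality costs \<open>2 exp (- h\<^sup>2 (1 - \<O>(\<epsilon>)) / (2 \<sigma>\<^sup>2))\<close> per piece, and the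
  \<open>n\<close> pieces account for the prefactor.

  The avoided bifurcation enters only through the stability estimate
  \<open>a(t) \<le> - \<kappa> max (\<bar>t\<bar>) (sqrt a\<^sub>0) (sqrt \<epsilon>)\<close>, proved by fencing in the deterministic solution
  (\<open>stability_along_solution\<close>, \<open>uniform_stability\<close>). In part (a) the factor \<open>\<phi>\<close> is \<open>\<bar>t\<bar>\<close>, in part (b) it is
  \<open>max (sqrt a\<^sub>0) (sqrt \<epsilon>)\<close>. When the bracket in the exponent is not positive the asserted bound is at
  least 1 and holds trivially, so that \<open>h\<^sub>0 = 1\<close> is possible once \<open>K\<close> is large.
\<close>

section \<open>A maximal inequality for sums of independent Gaussian variables\<close>

lemma (in prob_space) nn_integral_exp_normal:
  fixes \<xi> :: "'a \<Rightarrow> real"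
  assumes D: "distributed M lborel \<xi> (normal_density 0 s)" and s: "0 < s"
  shows "(\<integral>\<^sup>+\<omega>. ennreal (exp (c * \<xi> \<omega> - c\<^sup>2 * s\<^sup>2 / 2)) \<partial>M) = 1"
proof -
  have "(\<integral>\<^sup>+\<omega>. ennreal (exp (c * \<xi> \<omega> - c\<^sup>2 * s\<^sup>2 / 2)) \<partial>M)
      = (\<integral>\<^sup>+x. ennreal (normal_density 0 s x) * ennreal (exp (c * x - c\<^sup>2 * s\<^sup>2 / 2)) \<partial>lborel)"
    by (rule distributed_nn_integral[OF D, symmetric]) simp
  also have "\<dots> = (\<integral>\<^sup>+x. ennreal (normal_density (c * s\<^sup>2) s x) \<partial>lborel)"
  proof (rule nn_integral_cong)
    fix x :: real
    have "- (x - 0)\<^sup>2 / (2 * s\<^sup>2) + (c * x - c\<^sup>2 * s\<^sup>2 / 2) = - (x - c * s\<^sup>2)\<^sup>2 / (2 * s\<^sup>2)"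
      using s by (simp add: field_simps power2_eq_square)
    then show "ennreal (normal_density 0 s x) * ennreal (exp (c * x - c\<^sup>2 * s\<^sup>2 / 2))
        = ennreal (normal_density (c * s\<^sup>2) s x)"
      unfolding normal_density_def
      by (subst ennreal_mult[symmetric]) (auto simp flip: exp_add simp: mult.assoc)
  qed
  also have "\<dots> = 1"
    using prob_space.emeasure_space_1[OF prob_space_normal_density[OF s, of "c * s\<^sup>2"]]
    by (simp add: emeasure_density)
  finally show ?thesis .
qed

text \<open>
  One step of an exponential martingale: the factor \<open>X\<close> is known at the time described by \<open>G\<close>, and the increment \<open>\<xi>\<close>
  is independent of that past.
\<close>

lemma (in prob_space) nn_integral_indep_set_mult:
  fixes X :: "'a \<Rightarrow> ennreal" and \<xi> :: "'a \<Rightarrow> real"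
  assumes G: "subalgebra M G" and X: "X \<in> borel_measurable G"
    and \<xi>: "\<xi> \<in> borel_measurable M"
    and ind: "indep_set (sets G) (sets (vimage_algebra (space M) \<xi> borel))"
    and f: "f \<in> borel_measurable borel"
  shows "(\<integral>\<^sup>+\<omega>. X \<omega> * (f (\<xi> \<omega>) :: ennreal) \<partial>M) = (\<integral>\<^sup>+\<omega>. X \<omega> \<partial>M) * (\<integral>\<^sup>+\<omega>. f (\<xi> \<omega>) \<partial>M)"
proof -
  have spG: "space G = space M" using G by (simp add: subalgebra_def)
  have XM: "X \<in> borel_measurable M" using measurable_from_subalg[OF G X] .
  define Y where "Y = (\<lambda>\<omega>. f (\<xi> \<omega>))"
  have YM: "Y \<in> borel_measurable M" unfolding Y_def using \<xi> f by simp
  have subX: "sigma_sets (space M) {X -` A \<inter> space M |A. A \<in> sets borel} \<subseteq> sets G"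
    using measurable_sets[OF X] sets.sigma_sets_subset[of "{X -` A \<inter> space M |A. A \<in> sets borel}" G]
    unfolding spG by blast
  have "Y \<in> borel_measurable (vimage_algebra (space M) \<xi> borel)"
    unfolding Y_def by (intro measurable_compose[OF measurable_vimage_algebra1 f]) auto
  then have "{Y -` A \<inter> space M |A. A \<in> sets borel} \<subseteq> sets (vimage_algebra (space M) \<xi> borel)"
    using measurable_sets[of Y "vimage_algebra (space M) \<xi> borel"] by auto
  then have subY: "sigma_sets (space M) {Y -` A \<inter> space M |A. A \<in> sets borel}
      \<subseteq> sets (vimage_algebra (space M) \<xi> borel)"
    using sets.sigma_sets_subset[of _ "vimage_algebra (space M) \<xi> borel"] by simp
  have "indep_set (sigma_sets (space M) {X -` A \<inter> space M |A. A \<in> sets borel})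
         (sigma_sets (space M) {Y -` A \<inter> space M |A. A \<in> sets borel})"
    unfolding indep_set_def
    by (rule indep_sets_mono_sets[OF ind[unfolded indep_set_def]])
      (use subX subY in \<open>auto split: bool.split\<close>)
  then have "indep_var borel X borel Y"
    using XM YM by (simp add: indep_var_eq)
  then have "distr M borel X \<Otimes>\<^sub>M distr M borel Y = distr M (borel \<Otimes>\<^sub>M borel) (\<lambda>\<omega>. (X \<omega>, Y \<omega>))"
    by (simp add: indep_var_distribution_eq)
  note eq = this[symmetric]
  interpret D2: prob_space "distr M borel Y" using YM by (rule prob_space_distr)
  have "(\<integral>\<^sup>+\<omega>. X \<omega> * Y \<omega> \<partial>M)
      = (\<integral>\<^sup>+p. fst p * snd p \<partial>distr M (borel \<Otimes>\<^sub>M borel) (\<lambda>\<omega>. (X \<omega>, Y \<omega>)))"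
    using XM YM by (subst nn_integral_distr) auto
  also have "\<dots> = (\<integral>\<^sup>+x. \<integral>\<^sup>+y. x * y \<partial>distr M borel Y \<partial>distr M borel X)"
    unfolding eq by (subst D2.nn_integral_fst[symmetric]) auto
  also have "\<dots> = (\<integral>\<^sup>+\<omega>. X \<omega> \<partial>M) * (\<integral>\<^sup>+\<omega>. Y \<omega> \<partial>M)"
    using XM YM by (simp add: nn_integral_cmult nn_integral_multc nn_integral_distr)
  finally show ?thesis by (simp add: Y_def)
qed

text \<open>
  The Doob inequality for the exponential martingale \<open>exp (l S\<^sub>j - l\<^sup>2 V\<^sub>j / 2)\<close>, stopped when \<open>S\<close> first reaches
  \<open>\<delta>\<close>. The stopped process \<open>P\<close> has constant expectation 1 and is at least \<open>exp (l \<delta> - l\<^sup>2 V\<^sub>n / 2)\<close> once the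
  level has been reached, so the Markov inequality applies. The choice \<open>l = \<delta> / V\<^sub>n\<close> optimises the bound.
\<close>

lemma (in prob_space) gaussian_sum_maximal_exp:
  fixes G :: "nat \<Rightarrow> 'a measure" and \<xi> :: "nat \<Rightarrow> 'a \<Rightarrow> real" and c s :: "nat \<Rightarrow> real"
  assumes sub: "\<And>i. i \<le> n \<Longrightarrow> subalgebra M (G i)"
    and mono: "\<And>i j. i \<le> j \<Longrightarrow> j \<le> n \<Longrightarrow> sets (G i) \<subseteq> sets (G j)"
    and meas: "\<And>i. i < n \<Longrightarrow> \<xi> i \<in> borel_measurable (G (Suc i))"
    and s: "\<And>i. i < n \<Longrightarrow> 0 < s i"
    and normal: "\<And>i. i < n \<Longrightarrow> distributed M lborel (\<xi> i) (normal_density 0 (s i))"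
    and ind: "\<And>i. i < n \<Longrightarrow>
      indep_set (sets (G i)) (sets (vimage_algebra (space M) (\<xi> i) borel))"
    and l: "0 \<le> l"
  shows "{\<omega> \<in> space M. \<exists>j\<le>n. \<delta> \<le> (\<Sum>i<j. c i * \<xi> i \<omega>)} \<in> events"
    and "prob {\<omega> \<in> space M. \<exists>j\<le>n. \<delta> \<le> (\<Sum>i<j. c i * \<xi> i \<omega>)}
      \<le> exp (- l * \<delta> + l\<^sup>2 * (\<Sum>i<n. (c i)\<^sup>2 * (s i)\<^sup>2) / 2)"
proof -
  define S where "S j \<omega> = (\<Sum>i<j. c i * \<xi> i \<omega>)" for j \<omega>
  define V where "V j = (\<Sum>i<j. (c i)\<^sup>2 * (s i)\<^sup>2)" for j
  define A where "A j \<omega> \<longleftrightarrow> (\<forall>k\<le>j. S k \<omega> < \<delta>)" for j \<omega>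
  define e where "e j x = ennreal (exp ((l * c j) * x - (l * c j)\<^sup>2 * (s j)\<^sup>2 / 2))" for j x
  \<comment> \<open>the exponential martingale, frozen from the first passage on\<close>
  define P where "P = rec_nat (\<lambda>_. 1)
     (\<lambda>j p \<omega>. if A j \<omega> then p \<omega> * e j (\<xi> j \<omega>) else (p \<omega> :: ennreal))"
  have P0: "P 0 \<omega> = 1" for \<omega> by (simp add: P_def)
  have PS: "P (Suc j) \<omega> = (if A j \<omega> then P j \<omega> * e j (\<xi> j \<omega>) else P j \<omega>)" for j \<omega>
    by (simp add: P_def)
  have spG: "space (G i) = space M" if "i \<le> n" for i
    using sub[OF that] by (simp add: subalgebra_def)
  have lift: "f \<in> borel_measurable (G j)" if "f \<in> borel_measurable (G i)" "i \<le> j" "j \<le> n"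
    for f :: "'a \<Rightarrow> real" and i j
    using that mono[of i j] spG by (intro measurable_from_subalg[of "G j" "G i"]) (auto simp: subalgebra_def)
  have lift': "f \<in> borel_measurable (G j)" if "f \<in> borel_measurable (G i)" "i \<le> j" "j \<le> n"
    for f :: "'a \<Rightarrow> ennreal" and i j
    using that mono[of i j] spG by (intro measurable_from_subalg[of "G j" "G i"]) (auto simp: subalgebra_def)
  have Smeas: "S j \<in> borel_measurable (G k)" if "j \<le> k" "k \<le> n" for j k
    unfolding S_def using that
    by (intro borel_measurable_sum borel_measurable_times borel_measurable_const lift[OF meas]) auto
  have Ameas: "Measurable.pred (G j) (A j)" if "j \<le> n" for j
  proof -
    have [measurable]: "S k \<in> borel_measurable (G j)" if "k \<in> {..j}" for k
      using that \<open>j \<le> n\<close> by (intro Smeas) auto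
    have "Measurable.pred (G j) (\<lambda>\<omega>. \<forall>k\<in>{..j}. S k \<omega> < \<delta>)"
      by (intro pred_intros_finite) measurable
    then show ?thesis by (simp add: A_def[abs_def] Ball_def)
  qed
  have emeas[measurable]: "e j \<in> borel_measurable borel" for j
    unfolding e_def by measurable
  have Pmeas: "P j \<in> borel_measurable (G j)" if "j \<le> n" for j
    using that
  proof (induction j)
    case 0
    then show ?case unfolding P0[abs_def] by (simp add: P0)
  next
    case (Suc j)
    have [measurable]: "P j \<in> borel_measurable (G (Suc j))"
      using Suc by (auto intro: lift'[of "P j" j])
    have [measurable]: "\<xi> j \<in> borel_measurable (G (Suc j))" by (rule meas) (use Suc.prems in simp)
    have [measurable]: "Measurable.pred (G (Suc j)) (A j)"
    proof -
      have "{\<omega> \<in> space (G j). A j \<omega>} \<in> sets (G j)" using Ameas[of j] Suc.prems by (simp add: pred_def)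
      moreover have "sets (G j) \<subseteq> sets (G (Suc j))" by (rule mono) (use Suc.prems in simp_all)
      ultimately have "{\<omega> \<in> space (G j). A j \<omega>} \<in> sets (G (Suc j))" by blast
      moreover have "space (G (Suc j)) = space (G j)" using spG Suc.prems by simp
      ultimately show ?thesis by (simp only: pred_def)
    qed
    have "P (Suc j) = (\<lambda>\<omega>. if A j \<omega> then P j \<omega> * e j (\<xi> j \<omega>) else P j \<omega>)"
      by (simp add: PS fun_eq_iff)
    then show ?case by simp
  qed
  have int1: "(\<integral>\<^sup>+\<omega>. P j \<omega> \<partial>M) = 1" if "j \<le> n" for j
    using that
  proof (induction j)
    case 0
    then show ?case by (simp add: P0 emeasure_space_1)
  next
    case (Suc j)
    then have j: "j < n" by simp
    have [measurable]: "P j \<in> borel_measurable (G j)" "Measurable.pred (G j) (A j)"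
      using Pmeas Ameas j by auto
    have subj: "subalgebra M (G j)" using sub j by simp
    have \<xi>M: "\<xi> j \<in> borel_measurable M"
      using measurable_from_subalg[OF sub meas] j by auto
    define X Y where "X \<omega> = (if A j \<omega> then P j \<omega> else 0)"
      and "Y \<omega> = (if A j \<omega> then 0 else P j \<omega>)" for \<omega>
    have XG: "X \<in> borel_measurable (G j)" and YG: "Y \<in> borel_measurable (G j)"
      unfolding X_def Y_def by measurable
    note XM = measurable_from_subalg[OF subj XG] and YM = measurable_from_subalg[OF subj YG]
    have e1: "(\<integral>\<^sup>+\<omega>. e j (\<xi> j \<omega>) \<partial>M) = 1"
      unfolding e_def by (rule nn_integral_exp_normal[OF normal[OF j] s[OF j]])
    have "(\<integral>\<^sup>+\<omega>. P (Suc j) \<omega> \<partial>M) = (\<integral>\<^sup>+\<omega>. X \<omega> * e j (\<xi> j \<omega>) + Y \<omega> \<partial>M)"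
      by (intro nn_integral_cong) (auto simp: PS X_def Y_def)
    also have "\<dots> = (\<integral>\<^sup>+\<omega>. X \<omega> * e j (\<xi> j \<omega>) \<partial>M) + (\<integral>\<^sup>+\<omega>. Y \<omega> \<partial>M)"
      using XM YM \<xi>M by (intro nn_integral_add) auto
    also have "(\<integral>\<^sup>+\<omega>. X \<omega> * e j (\<xi> j \<omega>) \<partial>M) = (\<integral>\<^sup>+\<omega>. X \<omega> \<partial>M)"
      using nn_integral_indep_set_mult[OF subj XG \<xi>M ind[OF j] emeas] e1 by simp
    also have "\<dots> + (\<integral>\<^sup>+\<omega>. Y \<omega> \<partial>M) = (\<integral>\<^sup>+\<omega>. X \<omega> + Y \<omega> \<partial>M)"
      using XM YM by (intro nn_integral_add[symmetric]) auto
    also have "\<dots> = (\<integral>\<^sup>+\<omega>. P j \<omega> \<partial>M)"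
      by (intro nn_integral_cong) (auto simp: X_def Y_def)
    finally show ?case using Suc by simp
  qed
  have Pfree: "P j \<omega> = ennreal (exp (l * S j \<omega> - l\<^sup>2 * V j / 2))" if "\<forall>k<j. S k \<omega> < \<delta>" for j \<omega>
    using that
  proof (induction j)
    case (Suc j)
    then have "A j \<omega>" by (auto simp: A_def less_Suc_eq_le)
    moreover have "P j \<omega> = ennreal (exp (l * S j \<omega> - l\<^sup>2 * V j / 2))" using Suc by auto
    ultimately show ?case
      by (simp add: PS e_def S_def V_def ennreal_mult[symmetric] exp_add[symmetric])
        (simp add: field_simps power_mult_distrib)
  qed (simp add: P0 S_def V_def)
  have Vmono: "V j \<le> V (Suc j)" for j by (simp add: V_def)
  have Phit: "ennreal (exp (l * \<delta> - l\<^sup>2 * V j / 2)) \<le> P j \<omega>" if "\<exists>k\<le>j. \<delta> \<le> S k \<omega>" for j \<omega>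
    using that
  proof (induction j)
    case 0
    then show ?case using Pfree[of 0 \<omega>] mult_left_mono[OF _ l, of \<delta> "S 0 \<omega>"]
      by (auto intro!: ennreal_leI)
  next
    case (Suc j)
    show ?case
    proof (cases "\<exists>k\<le>j. \<delta> \<le> S k \<omega>")
      case True
      have "l\<^sup>2 * V j \<le> l\<^sup>2 * V (Suc j)" by (rule mult_left_mono[OF Vmono]) simp
      then have "ennreal (exp (l * \<delta> - l\<^sup>2 * V (Suc j) / 2)) \<le> ennreal (exp (l * \<delta> - l\<^sup>2 * V j / 2))"
        by (intro ennreal_leI) simp
      also have "\<dots> \<le> P j \<omega>" using Suc True by simp
      also have "\<dots> = P (Suc j) \<omega>" using True by (auto simp: PS A_def not_less[symmetric])
      finally show ?thesis .
    next
      case False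
      then have "\<delta> \<le> S (Suc j) \<omega>" using Suc.prems le_Suc_eq by auto
      moreover have "\<forall>k<Suc j. S k \<omega> < \<delta>" using False by (meson less_Suc_eq_le not_le)
      ultimately show ?thesis
        using Pfree[of "Suc j" \<omega>] mult_left_mono[OF _ l, of \<delta> "S (Suc j) \<omega>"]
        by (auto intro!: ennreal_leI)
    qed
  qed
  let ?E = "{\<omega> \<in> space M. \<exists>j\<le>n. \<delta> \<le> S j \<omega>}"
  have SM: "S k \<in> borel_measurable M" if "k \<le> n" for k
    using measurable_from_subalg[OF sub Smeas] that by blast
  have "Measurable.pred M (\<lambda>\<omega>. \<exists>j\<in>{..n}. \<delta> \<le> S j \<omega>)"
  proof (intro pred_intros_finite)
    fix j assume "j \<in> {..n}"
    then have [measurable]: "S j \<in> borel_measurable M" by (simp add: SM)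
    show "Measurable.pred M (\<lambda>\<omega>. \<delta> \<le> S j \<omega>)" by measurable
  qed simp
  then have evS: "?E \<in> events" by (simp only: pred_def Bex_def atMost_iff)
  then show "{\<omega> \<in> space M. \<exists>j\<le>n. \<delta> \<le> (\<Sum>i<j. c i * \<xi> i \<omega>)} \<in> events"
    by (simp only: S_def)
  define q where "q = exp (l * \<delta> - l\<^sup>2 * V n / 2)"
  have q: "0 < q" by (simp add: q_def)
  have "ennreal q * emeasure M ?E = (\<integral>\<^sup>+\<omega>. ennreal q * indicator ?E \<omega> \<partial>M)"
    by (rule nn_integral_cmult_indicator[OF evS, symmetric])
  also have "\<dots> \<le> (\<integral>\<^sup>+\<omega>. P n \<omega> \<partial>M)"
    by (intro nn_integral_mono) (auto simp: q_def indicator_def intro!: Phit)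
  finally have "ennreal (q * prob ?E) \<le> ennreal 1"
    using int1[of n] q by (simp add: emeasure_eq_measure ennreal_mult)
  then have "q * prob ?E \<le> 1" by (subst (asm) ennreal_le_iff) auto
  then have "prob ?E \<le> inverse q" using q by (simp add: field_simps)
  also have "inverse q = exp (- l * \<delta> + l\<^sup>2 * V n / 2)"
    unfolding q_def by (simp flip: exp_minus)
  finally show "prob {\<omega> \<in> space M. \<exists>j\<le>n. \<delta> \<le> (\<Sum>i<j. c i * \<xi> i \<omega>)}
      \<le> exp (- l * \<delta> + l\<^sup>2 * (\<Sum>i<n. (c i)\<^sup>2 * (s i)\<^sup>2) / 2)"
    by (simp add: S_def V_def)
qed

section \<open>Wiener integrals of smooth functions\<close>

text \<open>
  For a continuously differentiable \<open>g\<close> integration by parts turns \<open>\<integral> g dw\<close> into an expression that makes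
  sense for every single continuous path \<open>w\<close>; \<open>g'\<close> is meant to be the derivative of \<open>g\<close>.
\<close>

definition wiener_integral :: "real \<Rightarrow> (real \<Rightarrow> real) \<Rightarrow> (real \<Rightarrow> real) \<Rightarrow> (real \<Rightarrow> real) \<Rightarrow> real \<Rightarrow> real" where
  "wiener_integral t0 g g' w s = g s * (w s - w t0) - integral {t0..s} (\<lambda>v. g' v * (w v - w t0))"

lemma has_integral_derivative_subinterval:
  fixes g :: "real \<Rightarrow> real"
  assumes g: "\<And>v. v \<in> {t0..u} \<Longrightarrow> (g has_real_derivative g' v) (at v within {t0..u})"
    and ab: "t0 \<le> a" "a \<le> b" "b \<le> u"
  shows "(g' has_integral (g b - g a)) {a..b}"
proof (rule fundamental_theorem_of_calculus[OF ab(2)])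
  fix v assume v: "v \<in> {a..b}"
  have "(g has_real_derivative g' v) (at v within {a..b})"
    by (rule DERIV_subset[OF g]) (use v ab in auto)
  then show "(g has_vector_derivative g' v) (at v within {a..b})"
    by (simp add: has_real_derivative_iff_has_vector_derivative)
qed

text \<open>
  Over one step the integral differs from its left Riemann term by \<open>\<integral> g' (w b - w v) dv\<close>, which the
  oscillation \<open>e\<close> of the path controls. The bound is additive in the increments of \<open>g\<close>, so that the errors of many
  steps telescope.
\<close>

lemma wiener_integral_step:
  assumes g: "\<And>v. v \<in> {t0..u} \<Longrightarrow> (g has_real_derivative g' v) (at v within {t0..u})"
    and g': "continuous_on {t0..u} g'" "\<And>v. v \<in> {t0..u} \<Longrightarrow> 0 \<le> g' v"
    and w: "continuous_on {t0..u} w"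
    and ab: "t0 \<le> a" "a \<le> b" "b \<le> u"
    and e: "\<And>v. v \<in> {a..b} \<Longrightarrow> \<bar>w b - w v\<bar> \<le> e"
  shows "\<bar>wiener_integral t0 g g' w b - wiener_integral t0 g g' w a - g a * (w b - w a)\<bar> \<le> e * (g b - g a)"
proof -
  have c: "continuous_on {t0..b} (\<lambda>v. g' v * (w v - w t0))"
    by (intro continuous_intros continuous_on_subset[OF g'(1)] continuous_on_subset[OF w]) (use ab in auto)
  have split: "integral {t0..b} (\<lambda>v. g' v * (w v - w t0))
      = integral {t0..a} (\<lambda>v. g' v * (w v - w t0)) + integral {a..b} (\<lambda>v. g' v * (w v - w t0))"
    by (rule Henstock_Kurzweil_Integration.integral_combine[symmetric, OF ab(1,2)])
      (rule integrable_continuous_interval[OF c])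
  have gi: "(g' has_integral (g b - g a)) {a..b}"
    by (rule has_integral_derivative_subinterval[OF g ab])
  have cw: "continuous_on {a..b} (\<lambda>v. g' v * (w v - w t0))"
    using continuous_on_subset[OF c] ab by auto
  have "((\<lambda>v. g' v * (w b - w t0) - g' v * (w v - w t0)) has_integral
      ((g b - g a) * (w b - w t0) - integral {a..b} (\<lambda>v. g' v * (w v - w t0)))) {a..b}"
    by (intro has_integral_diff has_integral_mult_left gi integrable_integral integrable_continuous_interval cw)
  then have I: "((\<lambda>v. g' v * (w b - w v)) has_integral
      ((g b - g a) * (w b - w t0) - integral {a..b} (\<lambda>v. g' v * (w v - w t0)))) {a..b}"
    by (simp add: algebra_simps)
  have J: "((\<lambda>v. g' v * e) has_integral (g b - g a) * e) {a..b}"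
    by (intro has_integral_mult_left gi)
  have "norm (integral {a..b} (\<lambda>v. g' v * (w b - w v))) \<le> integral {a..b} (\<lambda>v. g' v * e)"
    using ab e g'(2) by (intro integral_norm_bound_integral has_integral_integrable[OF I] has_integral_integrable[OF J])
      (auto simp: abs_mult intro!: mult_left_mono)
  then have "\<bar>(g b - g a) * (w b - w t0) - integral {a..b} (\<lambda>v. g' v * (w v - w t0))\<bar> \<le> (g b - g a) * e"
    by (simp only: integral_unique[OF I] integral_unique[OF J] real_norm_def)
  then show ?thesis unfolding wiener_integral_def split by (simp add: algebra_simps)
qed

lemma continuous_on_wiener_integral:
  assumes g: "\<And>v. v \<in> {t0..u} \<Longrightarrow> (g has_real_derivative g' v) (at v within {t0..u})"
    and g': "continuous_on {t0..u} g'" and w: "continuous_on {t0..u} w"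
  shows "continuous_on {t0..u} (wiener_integral t0 g g' w)"
  unfolding wiener_integral_def[abs_def]
  by (intro continuous_intros DERIV_continuous_on[OF g] w indefinite_integral_continuous_1
      integrable_continuous_interval g') auto

text \<open>
  The approximation is uniform in the upper limit \<open>s\<close>; this is what carries a maximal inequality over
  from Riemann sums to the integral.
\<close>

lemma wiener_integral_riemann_sums:
  assumes g: "\<And>v. v \<in> {t0..u} \<Longrightarrow> (g has_real_derivative g' v) (at v within {t0..u})"
    and g': "continuous_on {t0..u} g'" "\<And>v. v \<in> {t0..u} \<Longrightarrow> 0 \<le> g' v"
    and w: "continuous_on {t0..u} w"
    and u: "t0 < u" and e: "0 < e"
  defines "p \<equiv> \<lambda>n i. t0 + real i * ((u - t0) / real n)"
  shows "\<exists>m. \<forall>n\<ge>m. \<forall>s\<in>{t0..u}. \<exists>j\<le>n.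
    \<bar>wiener_integral t0 g g' w s - (\<Sum>i<j. g (p n i) * (w (p n (Suc i)) - w (p n i)))\<bar> \<le> e"
proof -
  let ?S = "\<lambda>n j. \<Sum>i<j. g (p n i) * (w (p n (Suc i)) - w (p n i))"
  define I where "I = wiener_integral t0 g g' w"
  define G where "G = g u - g t0"
  have gi: "(g' has_integral (g b - g a)) {a..b}" if "t0 \<le> a" "a \<le> b" "b \<le> u" for a b
    by (rule has_integral_derivative_subinterval[OF g that])
  have gmono: "g a \<le> g b" if "t0 \<le> a" "a \<le> b" "b \<le> u" for a b
    using has_integral_nonneg[OF gi[OF that]] that g'(2) by auto
  have G: "0 \<le> G" using gmono[of t0 u] u by (simp add: G_def)
  define e' where "e' = e / (2 * (G + 1))"
  have e'0: "0 < e'" using e G by (simp add: e'_def)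
  have "e' * G \<le> e' * (G + 1)" using e'0 by (intro mult_left_mono) auto
  also have "\<dots> = e / 2" using G unfolding e'_def by (simp add: divide_simps)
  finally have e': "0 < e'" "e' * G \<le> e / 2" using e'0 by auto
  have "uniformly_continuous_on {t0..u} I" unfolding I_def
    by (intro compact_uniformly_continuous continuous_on_wiener_integral g g' w) auto
  from uniformly_continuous_onE[OF this half_gt_zero[OF e]]
  obtain d1 where d1: "0 < d1" "\<And>s s'. s \<in> {t0..u} \<Longrightarrow> s' \<in> {t0..u} \<Longrightarrow> dist s' s < d1 \<Longrightarrow> dist (I s') (I s) < e / 2"
    by metis
  have "uniformly_continuous_on {t0..u} w" by (intro compact_uniformly_continuous w) auto
  from uniformly_continuous_onE[OF this e'(1)]
  obtain d2 where d2: "0 < d2" "\<And>s s'. s \<in> {t0..u} \<Longrightarrow> s' \<in> {t0..u} \<Longrightarrow> dist s' s < d2 \<Longrightarrow> dist (w s') (w s) < e'"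
    by metis
  obtain m where m: "(u - t0) / min d1 d2 < real m" using reals_Archimedean2 by blast
  have "\<exists>j\<le>n. \<bar>I s - ?S n j\<bar> \<le> e"
    if n: "m \<le> n" and s: "s \<in> {t0..u}" for n s
  proof -
    define D where "D = (u - t0) / real n"
    have "0 < (u - t0) / min d1 d2" using u d1 d2 by simp
    then have n0: "0 < real n" and n1: "(u - t0) / min d1 d2 < real n" using m n by linarith+
    have "u - t0 < real n * min d1 d2" using n1 d1(1) d2(1) by (simp add: pos_divide_less_eq)
    then have "D < min d1 d2" unfolding D_def using n0 by (subst pos_divide_less_eq) (simp_all only: mult.commute)
    moreover have "0 < D" using n0 u by (simp add: D_def)
    ultimately have D: "0 < D" "D < d1" "D < d2" by auto
    have nD: "real n * D = u - t0" using n0 by (simp add: D_def)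
    have p: "p n i = t0 + real i * D" for i by (simp add: p_def D_def)
    have pin: "p n i \<in> {t0..u}" if "i \<le> n" for i
    proof -
      have "real i * D \<le> real n * D" using that D(1) by (intro mult_right_mono) auto
      then show ?thesis using D(1) nD by (simp add: p)
    qed
    have S: "\<bar>I (p n j) - ?S n j\<bar> \<le> e' * (g (p n j) - g t0)"
      if "j \<le> n" for j
      using that
    proof (induction j)
      case 0
      then show ?case by (simp add: I_def wiener_integral_def p)
    next
      case (Suc j)
      have "\<bar>I (p n (Suc j)) - I (p n j) - g (p n j) * (w (p n (Suc j)) - w (p n j))\<bar>
          \<le> e' * (g (p n (Suc j)) - g (p n j))"
        unfolding I_def
      proof (rule wiener_integral_step[OF g g' w])
        show "t0 \<le> p n j" "p n (Suc j) \<le> u" using pin[of j] pin[of "Suc j"] Suc.prems by auto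
        show "p n j \<le> p n (Suc j)" using D(1) by (simp add: p field_simps)
        fix v assume v: "v \<in> {p n j..p n (Suc j)}"
        have "dist (w (p n (Suc j))) (w v) < e'"
        proof (rule d2(2))
          show "v \<in> {t0..u}" "p n (Suc j) \<in> {t0..u}"
            using v pin[of j] pin[of "Suc j"] Suc.prems by auto
          show "dist (p n (Suc j)) v < d2" using v D(3) by (auto simp: p dist_real_def algebra_simps)
        qed
        then show "\<bar>w (p n (Suc j)) - w v\<bar> \<le> e'" by (simp add: dist_real_def)
      qed auto
      moreover have "\<bar>I (p n j) - ?S n j\<bar> \<le> e' * (g (p n j) - g t0)"
        using Suc by simp
      ultimately show ?case by (simp add: algebra_simps abs_le_iff)
    qed
    define j where "j = nat \<lfloor>(s - t0) / D\<rfloor>"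
    have "0 \<le> (s - t0) / D" using s D by simp
    then have j1: "real j \<le> (s - t0) / D" and j2: "(s - t0) / D < real j + 1"
      unfolding j_def by linarith+
    have j3: "p n j \<le> s" "s < p n j + D" using j1 j2 D by (auto simp: p field_simps)
    have "real j * D \<le> real n * D" using j3 s nD by (auto simp: p)
    then have jn: "j \<le> n" using D by simp
    have "dist (I s) (I (p n j)) < e / 2"
      using d1(2)[OF pin[OF jn] s] j3 D by (auto simp: dist_real_def)
    moreover have "e' * (g (p n j) - g t0) \<le> e' * G"
      unfolding G_def using gmono[of "p n j" u] pin[OF jn] e'(1) by (intro mult_left_mono) auto
    ultimately have "\<bar>I s - ?S n j\<bar> \<le> e"
      using S[OF jn] e'(2) unfolding dist_real_def by linarith
    then show ?thesis using jn by blast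
  qed
  then show ?thesis unfolding I_def by blast
qed


text \<open>
  Applied to \<open>g\<^sup>2\<close>: the variances of the Riemann sums never exceed the variance of the integral, hence no
  limit of variances has to be taken.
\<close>

lemma left_riemann_sum_le_integral:
  fixes g :: "real \<Rightarrow> real"
  assumes c: "continuous_on {t0..u} g"
    and mono: "\<And>a b. t0 \<le> a \<Longrightarrow> a \<le> b \<Longrightarrow> b \<le> u \<Longrightarrow> g a \<le> g b"
    and p: "p 0 = t0" "\<And>i. i < n \<Longrightarrow> p i \<le> p (Suc i)" "p n \<le> u"
  shows "(\<Sum>i<n. g (p i) * (p (Suc i) - p i)) \<le> integral {t0..p n} g"
proof -
  have up: "p i \<le> p j" if "i \<le> j" "j \<le> n" for i j
    using that(1,2)
  proof (induction j rule: dec_induct)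
    case (step m)
    then show ?case using p(2)[of m] by simp
  qed simp
  have "(\<Sum>i<j. g (p i) * (p (Suc i) - p i)) \<le> integral {t0..p j} g" if "j \<le> n" for j
    using that
  proof (induction j)
    case 0
    then show ?case using p by simp
  next
    case (Suc j)
    have t: "t0 \<le> p j" "p j \<le> p (Suc j)" "p (Suc j) \<le> u"
      using up[of 0 j] up[of j "Suc j"] up[of "Suc j" n] p Suc.prems by auto
    have int: "g integrable_on {t0..p (Suc j)}" "g integrable_on {p j..p (Suc j)}"
      using t by (auto intro!: integrable_continuous_interval continuous_on_subset[OF c])
    have "g (p j) * (p (Suc j) - p j) = integral {p j..p (Suc j)} (\<lambda>_. g (p j))"
      using t by simp
    also have "\<dots> \<le> integral {p j..p (Suc j)} g"
      using t by (intro integral_le int integrable_const_ivl mono) auto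
    finally have "g (p j) * (p (Suc j) - p j) \<le> integral {p j..p (Suc j)} g" .
    moreover have "integral {t0..p j} g + integral {p j..p (Suc j)} g = integral {t0..p (Suc j)} g"
      by (rule Henstock_Kurzweil_Integration.integral_combine[OF t(1,2) int(1)])
    moreover have "(\<Sum>i<j. g (p i) * (p (Suc i) - p i)) \<le> integral {t0..p j} g"
      using Suc by simp
    ultimately show ?case by simp
  qed
  from this[of n] show ?thesis by simp
qed

text \<open>
  A large value of the integral at some time forces large values of all sufficiently fine Riemann sums.
  The event thus lies in the limit inferior of events to which the discrete maximal inequality applies with
  \<open>l = \<delta>' / V\<close>. The gap between \<open>\<delta>'\<close> and \<open>\<delta>\<close> absorbs the approximation error. A measurable superset is
  produced because the event itself is an uncountable union.
\<close>

lemma wiener_integral_maximal: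
  assumes W: "wiener_process M \<F> t0 t1 W"
    and u: "t0 < u" "u \<le> t1"
    and g: "\<And>v. v \<in> {t0..u} \<Longrightarrow> (g has_real_derivative g' v) (at v within {t0..u})"
    and g': "continuous_on {t0..u} g'" "\<And>v. v \<in> {t0..u} \<Longrightarrow> 0 \<le> g' v"
    and g0: "0 < g t0"
    and \<delta>: "0 < \<delta>'" "\<delta>' < \<delta>"
  shows "\<exists>B\<in>sets M. {\<omega>\<in>space M. \<exists>s\<in>{t0..u}. \<delta> \<le> \<bar>wiener_integral t0 g g' (\<lambda>v. W v \<omega>) s\<bar>} \<subseteq> B \<and>
      measure M B \<le> 2 * exp (- \<delta>'\<^sup>2 / (2 * integral {t0..u} (\<lambda>v. (g v)\<^sup>2)))"
proof -
  interpret prob_space M using W by (simp add: wiener_process_def)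
  have filt: "filtration (space M) \<F>" and sub: "\<And>t. subalgebra M (\<F> t)"
    and Wmeas: "\<And>t. t \<in> {t0..t1} \<Longrightarrow> W t \<in> borel_measurable (\<F> t)"
    and Wcont: "\<And>\<omega>. \<omega> \<in> space M \<Longrightarrow> continuous_on {t0..t1} (\<lambda>t. W t \<omega>)"
    and Wdist: "\<And>s t. t0 \<le> s \<Longrightarrow> s < t \<Longrightarrow> t \<le> t1 \<Longrightarrow>
        distributed M lborel (\<lambda>\<omega>. W t \<omega> - W s \<omega>) (normal_density 0 (sqrt (t - s)))"
    and Wind: "\<And>s t. t0 \<le> s \<Longrightarrow> s < t \<Longrightarrow> t \<le> t1 \<Longrightarrow> indep_set (sets (\<F> s))
          (sets (vimage_algebra (space M) (\<lambda>\<omega>. W t \<omega> - W s \<omega>) borel))"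
    using W unfolding wiener_process_def by auto
  have Fmono: "sets (\<F> s) \<subseteq> sets (\<F> t)" if "s \<le> t" for s t
    using filt that unfolding filtration_def by blast
  have spF: "space (\<F> t) = space M" for t using sub[of t] by (simp add: subalgebra_def)
  have cg: "continuous_on {t0..u} g" by (rule DERIV_continuous_on[OF g])
  have gmono: "g a \<le> g b" if "t0 \<le> a" "a \<le> b" "b \<le> u" for a b
    using has_integral_nonneg[OF has_integral_derivative_subinterval[OF g that]] that g'(2) by auto
  have gpos: "0 < g v" if "v \<in> {t0..u}" for v using gmono[of t0 v] that g0 by simp
  define V where "V = integral {t0..u} (\<lambda>v. (g v)\<^sup>2)"
  have cg2: "continuous_on {t0..u} (\<lambda>v. (g v)\<^sup>2)" by (intro continuous_intros cg)
  have sqmono: "(g a)\<^sup>2 \<le> (g b)\<^sup>2" if "t0 \<le> a" "a \<le> b" "b \<le> u" for a b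
    using gmono[OF that] gpos[of a] that by (intro power_mono) auto
  have "(g t0)\<^sup>2 * (u - t0) = integral {t0..u} (\<lambda>_. (g t0)\<^sup>2)" using u by simp
  also have "\<dots> \<le> V" unfolding V_def
    by (intro integral_le integrable_const_ivl integrable_continuous_interval cg2 sqmono) auto
  finally have "(g t0)\<^sup>2 * (u - t0) \<le> V" .
  moreover have "0 < (g t0)\<^sup>2 * (u - t0)" using g0 u by simp
  ultimately have V: "0 < V" by linarith
  define p where "p n i = t0 + real i * ((u - t0) / real n)" for n i
  define S where "S n j \<omega> = (\<Sum>i<j. g (p n i) * (W (p n (Suc i)) \<omega> - W (p n i) \<omega>))" for n j \<omega>
  define E where "E n = {\<omega>\<in>space M. \<exists>j\<le>n. \<delta>' \<le> S n j \<omega>} \<union> {\<omega>\<in>space M. \<exists>j\<le>n. \<delta>' \<le> - S n j \<omega>}" for n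
  let ?q = "exp (- \<delta>'\<^sup>2 / (2 * V))"
  have E: "E n \<in> events \<and> prob (E n) \<le> 2 * ?q" if n: "0 < n" for n
  proof -
    let ?C = "\<lambda>sg. {\<omega>\<in>space M. \<exists>j\<le>n. \<delta>' \<le> sg * S n j \<omega>}"
    let ?U = "{\<omega>\<in>space M. \<exists>j\<le>n. \<delta>' \<le> S n j \<omega>}"
    let ?L = "{\<omega>\<in>space M. \<exists>j\<le>n. \<delta>' \<le> - S n j \<omega>}"
    have plt: "p n i < p n (Suc i)" for i
      using u n by (simp add: p_def field_simps)
    have p0: "p n 0 = t0" and pn: "p n n = u" using n by (auto simp: p_def)
    have pmono: "p n i \<le> p n j" if "i \<le> j" for i j
      by (rule lift_Suc_mono_le[of "p n", OF less_imp_le[OF plt] that])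
    have pin: "t0 \<le> p n i" "i \<le> n \<Longrightarrow> p n i \<le> u" for i
      using pmono[of 0 i] pmono[of i n] p0 pn by auto
    have meas: "(\<lambda>\<omega>. W (p n (Suc i)) \<omega> - W (p n i) \<omega>) \<in> borel_measurable (\<F> (p n (Suc i)))"
      if "i < n" for i
    proof -
      have a: "W (p n (Suc i)) \<in> borel_measurable (\<F> (p n (Suc i)))"
        using pin[of "Suc i"] that u by (intro Wmeas) auto
      have "W (p n i) \<in> borel_measurable (\<F> (p n i))"
        using pin[of i] that u by (intro Wmeas) auto
      then have b: "W (p n i) \<in> borel_measurable (\<F> (p n (Suc i)))"
        using Fmono[OF pmono[of i "Suc i"]] spF
        by (intro measurable_from_subalg[of "\<F> (p n (Suc i))" "\<F> (p n i)"]) (auto simp: subalgebra_def)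
      show ?thesis using a b by (rule borel_measurable_diff)
    qed
    have VE: "(\<Sum>i<n. (sg * g (p n i))\<^sup>2 * (sqrt (p n (Suc i) - p n i))\<^sup>2) \<le> V" if sg: "sg\<^sup>2 = 1" for sg
    proof -
      have "(\<Sum>i<n. (sg * g (p n i))\<^sup>2 * (sqrt (p n (Suc i) - p n i))\<^sup>2)
          = (\<Sum>i<n. (g (p n i))\<^sup>2 * (p n (Suc i) - p n i))"
        using plt by (intro sum.cong refl) (simp add: power_mult_distrib sg less_imp_le)
      also have "\<dots> \<le> integral {t0..p n n} (\<lambda>v. (g v)\<^sup>2)"
        by (rule left_riemann_sum_le_integral[where p="p n", OF cg2 sqmono p0]) (use plt pn in \<open>auto intro: less_imp_le\<close>)
      finally show ?thesis by (simp add: V_def pn)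
    qed
    have one: "?C sg \<in> events \<and>
        prob (?C sg) \<le> ?q" if sg: "sg\<^sup>2 = 1" for sg
    proof -
      let ?\<xi> = "\<lambda>i \<omega>. W (p n (Suc i)) \<omega> - W (p n i) \<omega>"
      let ?s = "\<lambda>i. sqrt (p n (Suc i) - p n i)"
      have eq: "sg * S n j \<omega> = (\<Sum>i<j. (sg * g (p n i)) * ?\<xi> i \<omega>)" for j \<omega>
        by (simp add: S_def sum_distrib_left mult.assoc)
      have l: "0 \<le> \<delta>' / V" using \<delta> V by simp
      have spos: "0 < ?s i" for i using plt[of i] by simp
      have dist: "distributed M lborel (?\<xi> i) (normal_density 0 (?s i))" if "i < n" for i
        using pin(1)[of i] pin(2)[of "Suc i"] that u plt by (intro Wdist) auto
      have ind: "indep_set (sets (\<F> (p n i))) (sets (vimage_algebra (space M) (?\<xi> i) borel))" if "i < n" for i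
        using pin(1)[of i] pin(2)[of "Suc i"] that u plt by (intro Wind) auto
      note max = gaussian_sum_maximal_exp[where G="\<lambda>i. \<F> (p n i)" and \<xi>="?\<xi>" and s="?s"
          and c="\<lambda>i. sg * g (p n i)" and l="\<delta>' / V" and n=n and \<delta>=\<delta>',
          OF sub Fmono[OF pmono] meas spos dist ind l]
      have "(\<delta>' / V)\<^sup>2 * (\<Sum>i<n. (sg * g (p n i))\<^sup>2 * (?s i)\<^sup>2) \<le> (\<delta>' / V)\<^sup>2 * V"
        by (intro mult_left_mono VE sg) auto
      also have "\<dots> = \<delta>'\<^sup>2 / V" using V by (simp add: power2_eq_square)
      finally have "- (\<delta>' / V) * \<delta>' + (\<delta>' / V)\<^sup>2 * (\<Sum>i<n. (sg * g (p n i))\<^sup>2 * (?s i)\<^sup>2) / 2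
          \<le> - (\<delta>'\<^sup>2 / V) + \<delta>'\<^sup>2 / V / 2" by (simp add: power2_eq_square)
      also have "\<dots> = - \<delta>'\<^sup>2 / (2 * V)" using V by (simp add: field_simps)
      finally have "exp (- (\<delta>' / V) * \<delta>' + (\<delta>' / V)\<^sup>2 * (\<Sum>i<n. (sg * g (p n i))\<^sup>2 * (?s i)\<^sup>2) / 2)
          \<le> ?q" by simp
      with max show ?thesis unfolding eq by (meson order_trans)
    qed
    from one[of 1] one[of "-1"] have ev: "?U \<in> events"
        "?L \<in> events"
      and pr: "prob ?U \<le> ?q"
        "prob ?L \<le> ?q"
      by (simp_all only: power_one power2_minus mult_1 mult_minus1 simp_thms)
    show ?thesis
    proof
      show "E n \<in> events" unfolding E_def using ev by (rule sets.Un)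
      have "prob (E n) \<le> prob ?U + prob ?L"
        unfolding E_def using ev by (rule measure_Un_le)
      then show "prob (E n) \<le> 2 * ?q" using pr by linarith
    qed
  qed
  define B where "B m = (\<Inter>n\<in>{Suc m..}. E n)" for m
  have Bev: "B m \<in> events" for m
    unfolding B_def using E by (intro sets.countable_INT') auto
  have Bpr: "prob (B m) \<le> 2 * ?q" for m
  proof -
    have "prob (B m) \<le> prob (E (Suc m))"
      using E[of "Suc m"] by (intro finite_measure_mono) (auto simp: B_def)
    then show ?thesis using E[of "Suc m"] by linarith
  qed
  have "(\<lambda>m. prob (B m)) \<longlonglongrightarrow> prob (\<Union>m. B m)"
    using Bev by (intro finite_Lim_measure_incseq) (auto simp: incseq_def B_def)
  then have lim: "prob (\<Union>m. B m) \<le> 2 * ?q"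
    by (rule LIMSEQ_le_const2) (use Bpr in auto)
  have "\<omega> \<in> (\<Union>m. B m)" if \<omega>: "\<omega> \<in> space M" and s: "s \<in> {t0..u}"
    and big: "\<delta> \<le> \<bar>wiener_integral t0 g g' (\<lambda>v. W v \<omega>) s\<bar>" for \<omega> s
  proof -
    have w: "continuous_on {t0..u} (\<lambda>v. W v \<omega>)"
      by (rule continuous_on_subset[OF Wcont[OF \<omega>]]) (use u in auto)
    have "0 < \<delta> - \<delta>'" using \<delta> by simp
    from wiener_integral_riemann_sums[OF g g' w u(1) this]
    have "\<exists>m. \<forall>n\<ge>m. \<forall>s\<in>{t0..u}. \<exists>j\<le>n.
        \<bar>wiener_integral t0 g g' (\<lambda>v. W v \<omega>) s - S n j \<omega>\<bar> \<le> \<delta> - \<delta>'"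
      by (simp only: S_def p_def)
    then obtain m where "\<forall>n\<ge>m. \<forall>s\<in>{t0..u}. \<exists>j\<le>n.
        \<bar>wiener_integral t0 g g' (\<lambda>v. W v \<omega>) s - S n j \<omega>\<bar> \<le> \<delta> - \<delta>'" ..
    then have m: "\<exists>j\<le>n. \<bar>wiener_integral t0 g g' (\<lambda>v. W v \<omega>) s - S n j \<omega>\<bar> \<le> \<delta> - \<delta>'"
      if "m \<le> n" for n using that s by blast
    have "\<omega> \<in> E n" if "m \<le> n" for n
    proof -
      from m[OF that] obtain j where j: "j \<le> n" "\<bar>wiener_integral t0 g g' (\<lambda>v. W v \<omega>) s - S n j \<omega>\<bar> \<le> \<delta> - \<delta>'"
        by blast
      then have "\<delta>' \<le> S n j \<omega> \<or> \<delta>' \<le> - S n j \<omega>" using big by linarith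
      then show ?thesis using j(1) \<omega> unfolding E_def by blast
    qed
    then have "\<omega> \<in> B m" unfolding B_def by (meson INT_I Suc_leD atLeast_iff)
    then show ?thesis by blast
  qed
  then have "{\<omega>\<in>space M. \<exists>s\<in>{t0..u}. \<delta> \<le> \<bar>wiener_integral t0 g g' (\<lambda>v. W v \<omega>) s\<bar>} \<subseteq> (\<Union>m. B m)"
    by blast
  moreover have "(\<Union>m. B m) \<in> events" using Bev by blast
  ultimately show ?thesis using lim unfolding V_def by blast
qed

section \<open>Tubes of variable width around a Wiener integral\<close>

text \<open>
  On the piece \<open>[p k, p (k + 1)]\<close> the boundary is at least \<open>H sqrt (Z (p k))\<close>, while the variance is at most
  \<open>\<sigma>\<^sup>2 Z (p (k + 1))\<close>; the hypothesis \<open>slow\<close> compares the two.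
\<close>

lemma wiener_integral_tube:
  fixes t :: real
  assumes W: "wiener_process M \<F> t0 t1 W"
    and t: "t0 < t" "t \<le> t1"
    and g: "\<And>v. v \<in> {t0..t} \<Longrightarrow> (g has_real_derivative g' v) (at v within {t0..t})"
    and g': "continuous_on {t0..t} g'" "\<And>v. v \<in> {t0..t} \<Longrightarrow> 0 \<le> g' v"
    and g0: "0 < g t0"
    and pos: "0 < \<epsilon>" "0 < \<sigma>" "0 < H" "0 < \<theta>" "\<theta> < 1" "0 < n"
    and Z: "\<And>v. v \<in> {t0..t} \<Longrightarrow> Z v = Z0 + integral {t0..v} (\<lambda>v. (g v)\<^sup>2) / \<epsilon>" "0 < Z0"
    and slow: "\<And>u v. t0 \<le> u \<Longrightarrow> u \<le> v \<Longrightarrow> v \<le> t \<Longrightarrow> v - u \<le> (t - t0) / real n \<Longrightarrow> Z v \<le> exp \<gamma> * Z u"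
  shows "\<exists>B\<in>sets M. {\<omega>\<in>space M. \<exists>s\<in>{t0..t}.
          H * sqrt (Z s) \<le> \<bar>\<sigma> / sqrt \<epsilon> * wiener_integral t0 g g' (\<lambda>v. W v \<omega>) s\<bar>} \<subseteq> B \<and>
      measure M B \<le> 2 * real n * exp (- (\<theta>\<^sup>2 * H\<^sup>2 * exp (- \<gamma>) / (2 * \<sigma>\<^sup>2)))"
proof -
  interpret prob_space M using W by (simp add: wiener_process_def)
  define J where "J s \<omega> = wiener_integral t0 g g' (\<lambda>v. W v \<omega>) s" for s \<omega>
  define D where "D = (t - t0) / real n"
  define p where "p k = t0 + real k * D" for k
  define b where "b = exp (- (\<theta>\<^sup>2 * H\<^sup>2 * exp (- \<gamma>) / (2 * \<sigma>\<^sup>2)))"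
  have D: "0 < D" "real n * D = t - t0" using t pos by (auto simp: D_def)
  have pin: "t0 \<le> p k" "k \<le> n \<Longrightarrow> p k \<le> t" for k
  proof -
    show "t0 \<le> p k" using D by (simp add: p_def)
    assume "k \<le> n"
    then have "real k * D \<le> real n * D" using D(1) by (intro mult_right_mono) auto
    then show "p k \<le> t" using D by (simp add: p_def)
  qed
  have pS: "p (Suc k) = p k + D" for k by (simp add: p_def algebra_simps)
  have int: "(\<lambda>v. (g v)\<^sup>2) integrable_on {t0..v}" if "v \<le> t" for v
    by (intro integrable_continuous_interval continuous_intros
        continuous_on_subset[OF DERIV_continuous_on[OF g]]) (use that in auto)
  have Zpos: "0 < Z v" if "v \<in> {t0..t}" for v
    using Z that integral_nonneg[OF int, of v] pos(1) by (simp add: add_pos_nonneg)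
  have Zmono: "Z u \<le> Z v" if "t0 \<le> u" "u \<le> v" "v \<le> t" for u v
  proof -
    have "integral {t0..u} (\<lambda>v. (g v)\<^sup>2) \<le> integral {t0..v} (\<lambda>v. (g v)\<^sup>2)"
      by (rule integral_subset_le) (use that int in auto)
    then show ?thesis using Z(1)[of u] Z(1)[of v] that pos(1) by (simp add: divide_right_mono)
  qed
  have piece: "\<exists>B\<in>sets M. {\<omega>\<in>space M. \<exists>s\<in>{p k..p (Suc k)}. H * sqrt (Z s) \<le> \<bar>\<sigma> / sqrt \<epsilon> * J s \<omega>\<bar>} \<subseteq> B
      \<and> measure M B \<le> 2 * b" if k: "k < n" for k
  proof -
    define u where "u = p (Suc k)"
    have u: "t0 < u" "u \<le> t" using pin(1)[of k] pin(2)[of "Suc k"] k D(1) pS by (auto simp: u_def)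
    have pk: "p k \<in> {t0..t}" using pin[of k] k by auto
    define \<delta> where "\<delta> = H * sqrt (Z (p k)) * (sqrt \<epsilon> / \<sigma>)"
    have \<delta>: "0 < \<delta>" using pos Zpos[OF pk] by (simp add: \<delta>_def)
    have "(g has_real_derivative g' v) (at v within {t0..u})" if "v \<in> {t0..u}" for v
      by (rule DERIV_subset[OF g]) (use that u in auto)
    moreover have "continuous_on {t0..u} g'" by (rule continuous_on_subset[OF g'(1)]) (use u in auto)
    moreover have "0 \<le> g' v" if "v \<in> {t0..u}" for v using g'(2) that u by simp
    moreover have "0 < \<theta> * \<delta>" "\<theta> * \<delta> < \<delta>" using \<delta> pos by auto
    ultimately obtain B where B: "B \<in> sets M"
        "{\<omega>\<in>space M. \<exists>s\<in>{t0..u}. \<delta> \<le> \<bar>J s \<omega>\<bar>} \<subseteq> B"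
        "measure M B \<le> 2 * exp (- (\<theta> * \<delta>)\<^sup>2 / (2 * integral {t0..u} (\<lambda>v. (g v)\<^sup>2)))"
      using wiener_integral_maximal[OF W u(1) order_trans[OF u(2) t(2)], of g g' "\<theta> * \<delta>" \<delta>] g0
      unfolding J_def by blast
    have "{\<omega>\<in>space M. \<exists>s\<in>{p k..p (Suc k)}. H * sqrt (Z s) \<le> \<bar>\<sigma> / sqrt \<epsilon> * J s \<omega>\<bar>} \<subseteq> B"
    proof (rule subset_trans[OF _ B(2)], safe)
      fix \<omega> s assume s: "s \<in> {p k..p (Suc k)}" and le: "H * sqrt (Z s) \<le> \<bar>\<sigma> / sqrt \<epsilon> * J s \<omega>\<bar>"
      have "H * sqrt (Z (p k)) \<le> H * sqrt (Z s)"
        using Zmono[of "p k" s] s u pk pos(3) by (auto simp: u_def)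
      also have "\<dots> \<le> \<sigma> / sqrt \<epsilon> * \<bar>J s \<omega>\<bar>" using le pos by (simp add: abs_mult)
      finally have "\<delta> \<le> (\<sigma> / sqrt \<epsilon> * \<bar>J s \<omega>\<bar>) * (sqrt \<epsilon> / \<sigma>)"
        unfolding \<delta>_def using pos by (intro mult_right_mono) auto
      also have "\<dots> = \<bar>J s \<omega>\<bar>" using pos by simp
      finally show "\<exists>s\<in>{t0..u}. \<delta> \<le> \<bar>J s \<omega>\<bar>"
        using s pin(1)[of k] by (auto simp: u_def intro!: bexI[of _ s])
    qed
    moreover have "measure M B \<le> 2 * b"
    proof -
      let ?V = "integral {t0..u} (\<lambda>v. (g v)\<^sup>2)"
      have "Z u \<le> exp \<gamma> * Z (p k)"
        using pin(1)[of k] u D pS by (intro slow) (auto simp: u_def D_def)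
      moreover have "?V = \<epsilon> * (Z u - Z0)" using Z(1)[of u] u pos(1) by simp
      ultimately have V: "?V \<le> \<epsilon> * (exp \<gamma> * Z (p k))" using Z(2) pos(1) by simp
      have "0 < integral {t0..u} (\<lambda>v. (g v)\<^sup>2)"
      proof -
        have "g t0 \<le> g v" if "v \<in> {t0..u}" for v
          using has_integral_nonneg[OF has_integral_derivative_subinterval[OF g, of t0 v]] that g'(2) u by auto
        then have "integral {t0..u} (\<lambda>_. (g t0)\<^sup>2) \<le> integral {t0..u} (\<lambda>v. (g v)\<^sup>2)"
          using g0 u by (intro integral_le int integrable_const_ivl power_mono) auto
        moreover have "0 < (g t0)\<^sup>2 * (u - t0)" using g0 u by simp
        ultimately show ?thesis using u by (simp add: mult.commute)
      qed
      then have "(\<theta> * \<delta>)\<^sup>2 / (2 * (\<epsilon> * (exp \<gamma> * Z (p k)))) \<le> (\<theta> * \<delta>)\<^sup>2 / (2 * ?V)"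
        using V pos(1) Zpos[OF pk] by (intro divide_left_mono) auto
      moreover have "(\<theta> * \<delta>)\<^sup>2 / (2 * (\<epsilon> * (exp \<gamma> * Z (p k)))) = \<theta>\<^sup>2 * H\<^sup>2 * exp (- \<gamma>) / (2 * \<sigma>\<^sup>2)"
        using pos Zpos[OF pk] by (simp add: \<delta>_def power_mult_distrib power_divide exp_minus field_simps)
      ultimately have "exp (- (\<theta> * \<delta>)\<^sup>2 / (2 * ?V)) \<le> b"
        unfolding b_def by simp
      then show ?thesis using B(3) by linarith
    qed
    ultimately show ?thesis using B(1) by blast
  qed
  define Q where "Q k = {\<omega>\<in>space M. \<exists>s\<in>{p k..p (Suc k)}. H * sqrt (Z s) \<le> \<bar>\<sigma> / sqrt \<epsilon> * J s \<omega>\<bar>}" for k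
  have "\<forall>k. \<exists>B. k < n \<longrightarrow> B \<in> sets M \<and> Q k \<subseteq> B \<and> measure M B \<le> 2 * b"
    using piece unfolding Q_def by blast
  from choice[OF this] obtain B where
    Ball: "\<forall>k. k < n \<longrightarrow> B k \<in> sets M \<and> Q k \<subseteq> B k \<and> measure M (B k) \<le> 2 * b" ..
  then have B: "\<And>k. k < n \<Longrightarrow> B k \<in> sets M"
      "\<And>k. k < n \<Longrightarrow> {\<omega>\<in>space M. \<exists>s\<in>{p k..p (Suc k)}. H * sqrt (Z s) \<le> \<bar>\<sigma> / sqrt \<epsilon> * J s \<omega>\<bar>} \<subseteq> B k"
      "\<And>k. k < n \<Longrightarrow> measure M (B k) \<le> 2 * b" unfolding Q_def by blast+
  have "measure M (\<Union>k\<in>{..<n}. B k) \<le> (\<Sum>k\<in>{..<n}. measure M (B k))"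
    using B(1) by (intro measure_UNION_le) auto
  also have "\<dots> \<le> (\<Sum>k\<in>{..<n}. 2 * b)" using B(3) by (intro sum_mono) auto
  also have "\<dots> = 2 * real n * b" by simp
  finally have "measure M (\<Union>k\<in>{..<n}. B k) \<le> 2 * real n * b" .
  moreover have "(\<Union>k\<in>{..<n}. B k) \<in> sets M" using B(1) by (intro sets.finite_UN) auto
  moreover have "{\<omega>\<in>space M. \<exists>s\<in>{t0..t}. H * sqrt (Z s) \<le> \<bar>\<sigma> / sqrt \<epsilon> * J s \<omega>\<bar>} \<subseteq> (\<Union>k\<in>{..<n}. B k)"
  proof safe
    fix \<omega> s assume \<omega>: "\<omega> \<in> space M" and s: "s \<in> {t0..t}"
      and le: "H * sqrt (Z s) \<le> \<bar>\<sigma> / sqrt \<epsilon> * J s \<omega>\<bar>"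
    have "\<exists>k<n. s \<in> {p k..p (Suc k)}"
    proof (cases "s = t")
      case True
      then show ?thesis using pos(6) D pS[of "n - 1"] by (intro exI[of _ "n - 1"]) (auto simp: p_def)
    next
      case False
      define k where "k = nat \<lfloor>(s - t0) / D\<rfloor>"
      have "0 \<le> (s - t0) / D" using s D by simp
      then have k1: "real k \<le> (s - t0) / D" and k2: "(s - t0) / D < real k + 1"
        unfolding k_def by linarith+
      have k3: "p k \<le> s" "s < p (Suc k)" using k1 k2 D by (auto simp: p_def field_simps)
      have "real k * D < real n * D" using k3(1) s False D by (auto simp: p_def)
      then have "k < n" using D(1) by (simp only: mult_less_cancel_right_pos of_nat_less_iff)
      then show ?thesis using k3 by auto
    qed
    then obtain k where k: "k < n" "s \<in> {p k..p (Suc k)}" by blast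
    show "\<omega> \<in> (\<Union>k\<in>{..<n}. B k)" using B(2)[OF k(1)] k \<omega> le by blast
  qed
  ultimately show ?thesis unfolding J_def b_def by blast
qed

section \<open>Linearisation around a stable solution\<close>

text \<open>
  The process \<open>y - c w\<close> is differentiable although \<open>y\<close> is not, so \<open>g (y - c w)\<close> can be
  differentiated along the path.
\<close>

lemma variation_of_constants:
  assumes g: "\<And>v. v \<in> {t0..\<tau>} \<Longrightarrow> (g has_real_derivative - (a v / \<epsilon>) * g v) (at v within {t0..\<tau>})"
    and a: "continuous_on {t0..\<tau>} a"
    and y: "continuous_on {t0..\<tau>} y" and b: "continuous_on {t0..\<tau>} b" and w: "continuous_on {t0..\<tau>} w"
    and eq: "\<And>s. s \<in> {t0..\<tau>} \<Longrightarrow>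
        y s = integral {t0..s} (\<lambda>v. (a v * y v + b v) / \<epsilon>) + c * (w s - w t0)"
    and \<tau>: "t0 \<le> \<tau>" and eps: "\<epsilon> \<noteq> 0"
  shows "g \<tau> * y \<tau> = c * wiener_integral t0 g (\<lambda>v. - (a v / \<epsilon>) * g v) w \<tau>
      + integral {t0..\<tau>} (\<lambda>v. g v * b v / \<epsilon>)"
proof -
  let ?g' = "\<lambda>v. - (a v / \<epsilon>) * g v"
  have cg: "continuous_on {t0..\<tau>} g" by (rule DERIV_continuous_on[OF g])
  have cd: "continuous_on {t0..\<tau>} (\<lambda>v. (a v * y v + b v) / \<epsilon>)"
    by (intro continuous_intros a y b) (use eps in auto)
  define r where "r s = y s - c * (w s - w t0)" for s
  have r: "(r has_real_derivative (a s * y s + b s) / \<epsilon>) (at s within {t0..\<tau>})" if "s \<in> {t0..\<tau>}" for s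
  proof -
    have "((\<lambda>s. integral {t0..s} (\<lambda>v. (a v * y v + b v) / \<epsilon>)) has_real_derivative (a s * y s + b s) / \<epsilon>)
        (at s within {t0..\<tau>})"
      by (rule integral_has_real_derivative[OF cd that])
    then show ?thesis
      by (rule has_field_derivative_transform_within[OF _ zero_less_one that]) (simp add: r_def eq)
  qed
  have "((\<lambda>s. g s * r s) has_real_derivative ?g' s * r s + (a s * y s + b s) / \<epsilon> * g s) (at s within {t0..\<tau>})"
    if "s \<in> {t0..\<tau>}" for s
    by (rule DERIV_mult[OF g[OF that] r[OF that]])
  moreover have "?g' s * r s + (a s * y s + b s) / \<epsilon> * g s = g s * b s / \<epsilon> - c * (?g' s * (w s - w t0))" for s
    by (simp add: r_def add_divide_distrib diff_divide_distrib algebra_simps)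
  ultimately have "((\<lambda>s. g s * b s / \<epsilon> - c * (?g' s * (w s - w t0))) has_integral (g \<tau> * r \<tau> - g t0 * r t0)) {t0..\<tau>}"
    using \<tau> by (intro has_integral_derivative_subinterval[of t0 \<tau> "\<lambda>s. g s * r s"]) auto
  then have "g \<tau> * r \<tau> - g t0 * r t0 = integral {t0..\<tau>} (\<lambda>s. g s * b s / \<epsilon> - c * (?g' s * (w s - w t0)))"
    by (simp add: integral_unique)
  also have "\<dots> = integral {t0..\<tau>} (\<lambda>s. g s * b s / \<epsilon>) - integral {t0..\<tau>} (\<lambda>s. c * (?g' s * (w s - w t0)))"
    by (intro Henstock_Kurzweil_Integration.integral_diff integrable_continuous_interval
        continuous_intros a b cg w) (use eps in auto)
  also have "integral {t0..\<tau>} (\<lambda>s. c * (?g' s * (w s - w t0))) = c * integral {t0..\<tau>} (\<lambda>s. ?g' s * (w s - w t0))"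
    by (rule integral_mult_right)
  finally have "g \<tau> * r \<tau> - g t0 * r t0
      = integral {t0..\<tau>} (\<lambda>s. g s * b s / \<epsilon>) - c * integral {t0..\<tau>} (\<lambda>s. ?g' s * (w s - w t0))" .
  moreover have "r t0 = 0" using eq[of t0] \<tau> by (simp add: r_def)
  ultimately show ?thesis by (simp add: r_def wiener_integral_def algebra_simps)
qed

lemma nondecreasing_on_interval:
  fixes \<phi> :: "real \<Rightarrow> real"
  assumes "\<And>v. v \<in> {t0..u} \<Longrightarrow> (\<phi> has_real_derivative \<phi>' v) (at v within {t0..u})"
    and "\<And>v. v \<in> {t0..u} \<Longrightarrow> 0 \<le> \<phi>' v" and "t0 \<le> x" "x \<le> y" "y \<le> u"
  shows "\<phi> x \<le> \<phi> y"
  using has_integral_nonneg[OF has_integral_derivative_subinterval[OF assms(1,3,4,5)]] assms by auto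

context
  fixes t0 t \<epsilon> :: real and g a Z :: "real \<Rightarrow> real"
  assumes eps: "0 < \<epsilon>"
    and g: "\<And>v. v \<in> {t0..t} \<Longrightarrow> (g has_real_derivative - (a v / \<epsilon>) * g v) (at v within {t0..t})"
    and gpos: "\<And>v. v \<in> {t0..t} \<Longrightarrow> 0 < g v"
    and Z: "\<And>v. v \<in> {t0..t} \<Longrightarrow> (Z has_real_derivative (g v)\<^sup>2 / \<epsilon>) (at v within {t0..t})"
    and Zpos: "\<And>v. v \<in> {t0..t} \<Longrightarrow> 0 < Z v"
begin

text \<open>
  For \<open>\<zeta> = Z / g\<^sup>2\<close> the claim is \<open>\<zeta> \<le> 1 / (2 c)\<close>, the fixed point of \<open>\<epsilon> \<zeta>' = 1 - 2 c \<zeta>\<close>.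
\<close>

lemma rescaled_variance_le:
  assumes a: "\<And>v. v \<in> {t0..t} \<Longrightarrow> a v \<le> - c" and c: "0 < c"
    and init: "Z t0 \<le> (g t0)\<^sup>2 / (2 * c)" and s: "s \<in> {t0..t}"
  shows "Z s \<le> (g s)\<^sup>2 / (2 * c)"
proof -
  have "(g t0)\<^sup>2 / (2 * c) - Z t0 \<le> (g s)\<^sup>2 / (2 * c) - Z s"
  proof (rule nondecreasing_on_interval[where \<phi>="\<lambda>s. (g s)\<^sup>2 / (2 * c) - Z s" and ?t0.0=t0 and u=t])
    fix v assume v: "v \<in> {t0..t}"
    show "((\<lambda>s. (g s)\<^sup>2 / (2 * c) - Z s) has_real_derivative (g v)\<^sup>2 / \<epsilon> * ((- a v) / c - 1)) (at v within {t0..t})"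
      by (rule DERIV_cong[OF DERIV_diff[OF DERIV_cdivide[OF DERIV_power[OF g[OF v], of 2]] Z[OF v]]])
        (use c eps in \<open>simp add: field_simps power2_eq_square\<close>)
    show "0 \<le> (g v)\<^sup>2 / \<epsilon> * ((- a v) / c - 1)"
      using a[OF v] c eps by (intro mult_nonneg_nonneg) (auto simp: field_simps)
  qed (use s in auto)
  then show ?thesis using init by linarith
qed

lemma rescaled_variance_ge:
  assumes a: "\<And>v. v \<in> {t0..t} \<Longrightarrow> \<bar>a v\<bar> \<le> A" and A: "0 < A"
    and init: "(g t0)\<^sup>2 / (2 * A) \<le> Z t0" and s: "s \<in> {t0..t}"
  shows "(g s)\<^sup>2 / (2 * A) \<le> Z s"
proof -
  have "Z t0 - (g t0)\<^sup>2 / (2 * A) \<le> Z s - (g s)\<^sup>2 / (2 * A)"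
  proof (rule nondecreasing_on_interval[where \<phi>="\<lambda>s. Z s - (g s)\<^sup>2 / (2 * A)" and ?t0.0=t0 and u=t])
    fix v assume v: "v \<in> {t0..t}"
    show "((\<lambda>s. Z s - (g s)\<^sup>2 / (2 * A)) has_real_derivative (g v)\<^sup>2 / \<epsilon> * (1 - (- a v) / A)) (at v within {t0..t})"
      by (rule DERIV_cong[OF DERIV_diff[OF Z[OF v] DERIV_cdivide[OF DERIV_power[OF g[OF v], of 2]]]])
        (use A eps in \<open>simp add: field_simps power2_eq_square\<close>)
    show "0 \<le> (g v)\<^sup>2 / \<epsilon> * (1 - (- a v) / A)"
      using a[OF v] A eps by (intro mult_nonneg_nonneg) (auto simp: field_simps)
  qed (use s in auto)
  then show ?thesis using init by linarith
qed

text \<open>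
  The logarithmic derivative of \<open>Z\<close> is \<open>g\<^sup>2 / (\<epsilon> Z) \<le> 2 A / \<epsilon>\<close>.
\<close>

lemma rescaled_variance_slow:
  assumes lower: "\<And>v. v \<in> {t0..t} \<Longrightarrow> (g v)\<^sup>2 / (2 * A) \<le> Z v" and A: "0 < A"
    and uv: "t0 \<le> u" "u \<le> v" "v \<le> t"
  shows "Z v \<le> exp (2 * A * (v - u) / \<epsilon>) * Z u"
proof -
  have "- (exp (- (2 * A / \<epsilon>) * u) * Z u) \<le> - (exp (- (2 * A / \<epsilon>) * v) * Z v)"
  proof (rule nondecreasing_on_interval[where \<phi>="\<lambda>s. - (exp (- (2 * A / \<epsilon>) * s) * Z s)" and ?t0.0=t0 and u=t])
    fix s assume s: "s \<in> {t0..t}"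
    show "((\<lambda>s. - (exp (- (2 * A / \<epsilon>) * s) * Z s)) has_real_derivative
        exp (- (2 * A / \<epsilon>) * s) * (2 * A * Z s - (g s)\<^sup>2) / \<epsilon>) (at s within {t0..t})"
      by (rule derivative_eq_intros Z[OF s] refl)+
        (use eps in \<open>simp add: field_simps\<close>)
    show "0 \<le> exp (- (2 * A / \<epsilon>) * s) * (2 * A * Z s - (g s)\<^sup>2) / \<epsilon>"
      using lower[OF s] A eps by (auto simp: field_simps)
  qed (use uv in auto)
  then have "exp (2 * A / \<epsilon> * v) * (exp (- (2 * A / \<epsilon>) * v) * Z v) \<le> exp (2 * A / \<epsilon> * v) * (exp (- (2 * A / \<epsilon>) * u) * Z u)"
    by (intro mult_left_mono) auto
  moreover have "exp (2 * A / \<epsilon> * v) * (exp (- (2 * A / \<epsilon>) * v) * Z v) = Z v"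
    by (simp add: exp_minus)
  moreover have "exp (2 * A / \<epsilon> * v) * (exp (- (2 * A / \<epsilon>) * u) * Z u) = exp (2 * A / \<epsilon> * v + - (2 * A / \<epsilon>) * u) * Z u"
    by (simp only: exp_add mult.assoc)
  moreover have "2 * A / \<epsilon> * v + - (2 * A / \<epsilon>) * u = 2 * A * (v - u) / \<epsilon>"
    by (simp add: diff_divide_distrib algebra_simps)
  ultimately show ?thesis by (simp only:)
qed

text \<open>
  In terms of \<open>\<zeta> = Z / g\<^sup>2\<close> this bounds \<open>\<integral> g \<zeta> / \<epsilon>\<close>. The right-hand side comes from a supersolution:
  \<open>2 m\<^bsup>3/2\<^esup> sqrt Z\<close> has derivative \<open>m\<^bsup>3/2\<^esup> g / (\<epsilon> sqrt \<zeta>)\<close>, and this dominates \<open>g \<zeta> / \<epsilon>\<close> exactly when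
  \<open>\<zeta> \<le> m\<close>.
\<close>

lemma variance_convolution_le:
  assumes m: "\<And>v. v \<in> {t0..t} \<Longrightarrow> Z v \<le> m * (g v)\<^sup>2" and s: "s \<in> {t0..t}"
  shows "(\<lambda>v. Z v / (g v * \<epsilon>)) integrable_on {t0..s}"
    and "integral {t0..s} (\<lambda>v. Z v / (g v * \<epsilon>)) \<le> 2 * (m * sqrt m) * sqrt (Z s)"
proof -
  have sub: "{t0..s} \<subseteq> {t0..t}" using s by auto
  have cg: "continuous_on {t0..s} g" by (rule continuous_on_subset[OF DERIV_continuous_on[OF g] sub])
  have cZ: "continuous_on {t0..s} Z" by (rule continuous_on_subset[OF DERIV_continuous_on[OF Z] sub])
  show i1: "(\<lambda>v. Z v / (g v * \<epsilon>)) integrable_on {t0..s}"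
    using eps gpos sub by (intro integrable_continuous_interval continuous_intros cg cZ) force
  have i2: "((\<lambda>v. m * sqrt m * ((g v)\<^sup>2 / (\<epsilon> * sqrt (Z v)))) has_integral
      (2 * (m * sqrt m) * sqrt (Z s) - 2 * (m * sqrt m) * sqrt (Z t0))) {t0..s}"
  proof (rule has_integral_derivative_subinterval[where ?t0.0=t0 and u=t])
    fix v assume v: "v \<in> {t0..t}"
    show "((\<lambda>s. 2 * (m * sqrt m) * sqrt (Z s)) has_real_derivative m * sqrt m * ((g v)\<^sup>2 / (\<epsilon> * sqrt (Z v)))) (at v within {t0..t})"
      by (rule DERIV_cong[OF DERIV_cmult[OF DERIV_chain2[OF DERIV_real_sqrt[OF Zpos[OF v]] Z[OF v]]]])
        (use eps Zpos[OF v] in \<open>simp add: field_simps\<close>)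
  qed (use s in auto)
  have "integral {t0..s} (\<lambda>v. Z v / (g v * \<epsilon>)) \<le> integral {t0..s} (\<lambda>v. m * sqrt m * ((g v)\<^sup>2 / (\<epsilon> * sqrt (Z v))))"
  proof (rule integral_le[OF i1 has_integral_integrable[OF i2]])
    fix v assume "v \<in> {t0..s}"
    then have v: "v \<in> {t0..t}" using sub by auto
    note gv = gpos[OF v] and Zv = Zpos[OF v] and mv = m[OF v]
    have "0 < m * (g v)\<^sup>2" using mv Zv by linarith
    then have mpos: "0 < m" by (rule zero_less_mult_pos2) (use gv in simp)
    have "sqrt (Z v) \<le> sqrt (m * (g v)\<^sup>2)" using mv by simp
    then have "sqrt (Z v) \<le> sqrt m * g v" using gv by (simp add: real_sqrt_mult)
    then have "Z v * sqrt (Z v) \<le> (m * (g v)\<^sup>2) * (sqrt m * g v)"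
      using mv Zv mpos by (intro mult_mono) auto
    then show "Z v / (g v * \<epsilon>) \<le> m * sqrt m * ((g v)\<^sup>2 / (\<epsilon> * sqrt (Z v)))"
      using gv Zv eps by (simp add: field_simps)
  qed
  also have "\<dots> = 2 * (m * sqrt m) * sqrt (Z s) - 2 * (m * sqrt m) * sqrt (Z t0)"
    by (rule integral_unique[OF i2])
  also have "\<dots> \<le> 2 * (m * sqrt m) * sqrt (Z s)"
  proof -
    have "t0 \<in> {t0..t}" using s by auto
    note t0 = m[OF this] gpos[OF this] Zpos[OF this]
    have "0 < m * (g t0)\<^sup>2" using t0 by linarith
    then have "0 < m" by (rule zero_less_mult_pos2) (use t0 in simp)
    then have "0 \<le> 2 * (m * sqrt m) * sqrt (Z t0)" using t0(3) by simp
    then show ?thesis by linarith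
  qed
  finally show "integral {t0..s} (\<lambda>v. Z v / (g v * \<epsilon>)) \<le> 2 * (m * sqrt m) * sqrt (Z s)" .
qed

text \<open>
  Up to the exit time the nonlinear term contributes at most \<open>\<beta> h\<^sup>2 \<integral> g \<zeta> / \<epsilon>\<close>. At the exit time it is
  therefore a small multiple of the boundary \<open>h sqrt Z\<close>, and the noise must supply the rest.
\<close>

lemma exit_forces_large_wiener_integral:
  assumes \<tau>: "\<tau> \<in> {t0..t}"
    and a: "continuous_on {t0..\<tau>} a"
    and y: "continuous_on {t0..\<tau>} y" and b: "continuous_on {t0..\<tau>} b" and w: "continuous_on {t0..\<tau>} w"
    and eq: "\<And>s. s \<in> {t0..\<tau>} \<Longrightarrow>
        y s = integral {t0..s} (\<lambda>v. (a v * y v + b v) / \<epsilon>) + c * (w s - w t0)"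
    and quad: "\<And>v. v \<in> {t0..\<tau>} \<Longrightarrow> \<bar>b v\<bar> \<le> \<beta> * (y v)\<^sup>2" and \<beta>: "0 \<le> \<beta>"
    and m: "\<And>v. v \<in> {t0..t} \<Longrightarrow> Z v \<le> m * (g v)\<^sup>2"
    and tube: "\<And>v. v \<in> {t0..\<tau>} \<Longrightarrow> g v * \<bar>y v\<bar> \<le> h * sqrt (Z v)"
    and out: "h * sqrt (Z \<tau>) \<le> g \<tau> * \<bar>y \<tau>\<bar>"
  shows "h * (1 - 2 * \<beta> * h * (m * sqrt m)) * sqrt (Z \<tau>)
      \<le> \<bar>c * wiener_integral t0 g (\<lambda>v. - (a v / \<epsilon>) * g v) w \<tau>\<bar>"
proof -
  let ?N = "c * wiener_integral t0 g (\<lambda>v. - (a v / \<epsilon>) * g v) w \<tau>"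
  let ?I = "integral {t0..\<tau>} (\<lambda>v. g v * b v / \<epsilon>)"
  have sub: "{t0..\<tau>} \<subseteq> {t0..t}" using \<tau> by auto
  have cg: "continuous_on {t0..\<tau>} g" by (rule continuous_on_subset[OF DERIV_continuous_on[OF g] sub])
  have gd: "(g has_real_derivative - (a v / \<epsilon>) * g v) (at v within {t0..\<tau>})" if "v \<in> {t0..\<tau>}" for v
    by (rule DERIV_subset[OF g[OF subsetD[OF sub that]] sub])
  have "t0 \<le> \<tau>" "\<epsilon> \<noteq> 0" using \<tau> eps by auto
  then have vc: "g \<tau> * y \<tau> = ?N
      + ?I"
    by (intro variation_of_constants gd a y b w eq)
  note conv = variance_convolution_le[OF m \<tau>]
  have "norm (?I) \<le> integral {t0..\<tau>} (\<lambda>v. \<beta> * h\<^sup>2 * (Z v / (g v * \<epsilon>)))"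
  proof (rule integral_norm_bound_integral)
    show "(\<lambda>v. g v * b v / \<epsilon>) integrable_on {t0..\<tau>}"
      using eps by (intro integrable_continuous_interval continuous_intros cg b) auto
    show "(\<lambda>v. \<beta> * h\<^sup>2 * (Z v / (g v * \<epsilon>))) integrable_on {t0..\<tau>}"
      using integrable_cmul[OF conv(1), of "\<beta> * h\<^sup>2"] by simp
    fix v assume v: "v \<in> {t0..\<tau>}"
    then have gv: "0 < g v" and Zv: "0 < Z v" using gpos Zpos sub by auto
    have "(g v * \<bar>y v\<bar>)\<^sup>2 \<le> (h * sqrt (Z v))\<^sup>2" using tube[OF v] gv by (intro power_mono) auto
    then have "(g v)\<^sup>2 * (y v)\<^sup>2 \<le> h\<^sup>2 * Z v" using Zv by (simp add: power_mult_distrib)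
    then have "\<beta> * ((g v)\<^sup>2 * (y v)\<^sup>2) \<le> \<beta> * (h\<^sup>2 * Z v)" using \<beta> by (intro mult_left_mono)
    moreover have "(g v)\<^sup>2 * \<bar>b v\<bar> \<le> (g v)\<^sup>2 * (\<beta> * (y v)\<^sup>2)" by (intro mult_left_mono quad[OF v]) auto
    ultimately have "(g v)\<^sup>2 * \<bar>b v\<bar> \<le> \<beta> * h\<^sup>2 * Z v" by (simp add: algebra_simps)
    then show "norm (g v * b v / \<epsilon>) \<le> \<beta> * h\<^sup>2 * (Z v / (g v * \<epsilon>))"
      using gv eps by (simp add: abs_mult field_simps power2_eq_square)
  qed
  also have "\<dots> = \<beta> * h\<^sup>2 * integral {t0..\<tau>} (\<lambda>v. Z v / (g v * \<epsilon>))" by (rule integral_mult_right)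
  also have "\<dots> \<le> \<beta> * h\<^sup>2 * (2 * (m * sqrt m) * sqrt (Z \<tau>))"
    using \<beta> by (intro mult_left_mono conv(2)) auto
  finally have "\<bar>?I\<bar> \<le> \<beta> * h\<^sup>2 * (2 * (m * sqrt m) * sqrt (Z \<tau>))" by simp
  moreover have "h * sqrt (Z \<tau>) \<le> \<bar>g \<tau> * y \<tau>\<bar>"
    using out gpos[OF \<tau>] by (simp add: abs_mult)
  then have "h * sqrt (Z \<tau>) \<le> \<bar>?N\<bar>
      + \<bar>?I\<bar>"
    using abs_triangle_ineq[of "?N"
      "?I"] unfolding vc[symmetric] by linarith
  ultimately have "h * sqrt (Z \<tau>) \<le> \<bar>?N\<bar>
      + \<beta> * h\<^sup>2 * (2 * (m * sqrt m) * sqrt (Z \<tau>))"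
    by linarith
  then show ?thesis by (simp add: algebra_simps power2_eq_square)
qed

end

section \<open>Fences for scalar differential equations\<close>

lemma first_zero:
  fixes u :: "real \<Rightarrow> real"
  assumes c: "continuous_on {t0..t} u" and init: "0 < u t0" and t: "t0 \<le> t" "u t \<le> 0"
  shows "\<exists>z. t0 < z \<and> z \<le> t \<and> u z = 0 \<and> (\<forall>s. t0 \<le> s \<longrightarrow> s < z \<longrightarrow> 0 < u s)"
proof -
  let ?S = "{s \<in> {t0..t}. u s \<in> {..0}}"
  have "closed ?S"
    using continuous_closed_preimage[OF c closed_atLeastAtMost closed_atMost[of "0::real"]]
    by (simp add: vimage_def Int_def)
  moreover have "bounded ?S" by (rule bounded_subset[of "{t0..t}"]) auto
  ultimately have "compact ?S" by (simp add: compact_eq_bounded_closed)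
  moreover have "?S \<noteq> {}" using t by auto
  ultimately obtain z where z: "z \<in> ?S" "\<And>s. s \<in> ?S \<Longrightarrow> z \<le> s"
    using compact_attains_inf[of ?S] by metis
  have z0: "t0 < z" using z(1) init by (cases "z = t0") auto
  have before: "0 < u s" if "t0 \<le> s" "s < z" for s
    using z(2)[of s] that z(1) by force
  have "\<exists>s\<ge>t0. s \<le> z \<and> u s = 0"
    by (rule IVT2') (use z(1) z0 init in \<open>auto intro: continuous_on_subset[OF c]\<close>)
  then obtain s where s: "t0 \<le> s" "s \<le> z" "u s = 0" by blast
  then have "s = z" using before[of s] by force
  then show ?thesis using s z0 z(1) before by auto
qed

lemma positive_by_first_zero:
  fixes u :: "real \<Rightarrow> real"
  assumes c: "continuous_on {t0..t1} u" and init: "0 < u t0"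
    and touch: "\<And>t. t0 < t \<Longrightarrow> t \<le> t1 \<Longrightarrow> u t = 0 \<Longrightarrow> \<exists>e>0. \<forall>s\<in>{t0..<t}. t - s < e \<longrightarrow> u s \<le> 0"
    and t: "t \<in> {t0..t1}"
  shows "0 < u t"
proof (rule ccontr)
  assume "\<not> 0 < u t"
  then obtain z where z: "t0 < z" "z \<le> t" "u z = 0" "\<And>s. t0 \<le> s \<Longrightarrow> s < z \<Longrightarrow> 0 < u s"
    using first_zero[of t0 t u] continuous_on_subset[OF c, of "{t0..t}"] init t by force
  obtain e where e: "0 < e" "\<And>s. s \<in> {t0..<z} \<Longrightarrow> z - s < e \<Longrightarrow> u s \<le> 0"
    using touch[OF z(1) _ z(3)] z(2) t by auto
  define s where "s = max t0 (z - e / 2)"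
  have "s \<in> {t0..<z}" "z - s < e" using e(1) z(1) by (auto simp: s_def)
  then show False using e(2)[of s] z(4)[of s] by force
qed

text \<open>
  The fence \<open>p + \<delta>\<close> may follow an equilibrium branch \<open>p\<close>, of which local Lipschitz continuity comes directly from
  its stability. At a first contact \<open>x - \<delta> + L t\<close> has negative derivative, so \<open>x\<close> was above the fence shortly
  before.
\<close>

lemma upper_fence:
  fixes x p \<delta> :: "real \<Rightarrow> real"
  assumes p: "continuous_on {t0..t1} p"
    and lip: "\<And>t. t \<in> {t0..t1} \<Longrightarrow> \<exists>e>0. \<forall>s\<in>{t0..t1}. \<bar>s - t\<bar> < e \<longrightarrow> \<bar>p s - p t\<bar> \<le> L * \<bar>s - t\<bar>"
    and x: "\<And>t. t \<in> {t0..t1} \<Longrightarrow> (x has_real_derivative x' t) (at t within {t0..t1})"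
    and \<delta>: "\<And>t. t \<in> {t0..t1} \<Longrightarrow> (\<delta> has_real_derivative \<delta>' t) (at t within {t0..t1})"
    and init: "x t0 < p t0 + \<delta> t0"
    and touch: "\<And>t. t \<in> {t0..t1} \<Longrightarrow> x t = p t + \<delta> t \<Longrightarrow> x' t + L < \<delta>' t"
    and t: "t \<in> {t0..t1}"
  shows "x t < p t + \<delta> t"
proof -
  have "0 < p t + \<delta> t - x t"
  proof (rule positive_by_first_zero[where u="\<lambda>t. p t + \<delta> t - x t"])
    show "continuous_on {t0..t1} (\<lambda>t. p t + \<delta> t - x t)"
      by (intro continuous_intros p DERIV_continuous_on[OF x] DERIV_continuous_on[OF \<delta>])
    show "0 < p t0 + \<delta> t0 - x t0" using init by simp
    fix s assume s: "t0 < s" "s \<le> t1" "p s + \<delta> s - x s = 0"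
    then have sin: "s \<in> {t0..t1}" by simp
    have "((\<lambda>v. x v - \<delta> v + L * v) has_real_derivative x' s - \<delta>' s + L) (at s within {t0..t1})"
      by (rule derivative_eq_intros x[OF sin] \<delta>[OF sin] refl)+ simp
    moreover have "x' s - \<delta>' s + L < 0" using touch[OF sin] s(3) by simp
    ultimately obtain e1 where e1: "0 < e1"
      "\<And>h. 0 < h \<Longrightarrow> s - h \<in> {t0..t1} \<Longrightarrow> h < e1 \<Longrightarrow> x s - \<delta> s + L * s < x (s - h) - \<delta> (s - h) + L * (s - h)"
      using has_real_derivative_neg_dec_left by blast
    obtain e2 where e2: "0 < e2" "\<And>v. v \<in> {t0..t1} \<Longrightarrow> \<bar>v - s\<bar> < e2 \<Longrightarrow> \<bar>p v - p s\<bar> \<le> L * \<bar>v - s\<bar>"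
      using lip[OF sin] by blast
    show "\<exists>e>0. \<forall>v\<in>{t0..<s}. s - v < e \<longrightarrow> p v + \<delta> v - x v \<le> 0"
    proof (intro exI[of _ "min e1 e2"] conjI ballI impI)
      fix v assume v: "v \<in> {t0..<s}" "s - v < min e1 e2"
      have "x s - \<delta> s + L * s < x v - \<delta> v + L * v"
        using e1(2)[of "s - v"] v s by auto
      moreover have "\<bar>p v - p s\<bar> \<le> L * (s - v)" using e2(2)[of v] v s by auto
      ultimately show "p v + \<delta> v - x v \<le> 0" using s(3) by (simp add: algebra_simps)
    qed (use e1 e2 in auto)
  qed (use t in auto)
  then show ?thesis by simp
qed

lemma lower_fence:
  fixes x p \<delta> :: "real \<Rightarrow> real"
  assumes p: "continuous_on {t0..t1} p"
    and lip: "\<And>t. t \<in> {t0..t1} \<Longrightarrow> \<exists>e>0. \<forall>s\<in>{t0..t1}. \<bar>s - t\<bar> < e \<longrightarrow> \<bar>p s - p t\<bar> \<le> L * \<bar>s - t\<bar>"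
    and x: "\<And>t. t \<in> {t0..t1} \<Longrightarrow> (x has_real_derivative x' t) (at t within {t0..t1})"
    and \<delta>: "\<And>t. t \<in> {t0..t1} \<Longrightarrow> (\<delta> has_real_derivative \<delta>' t) (at t within {t0..t1})"
    and init: "p t0 - \<delta> t0 < x t0"
    and touch: "\<And>t. t \<in> {t0..t1} \<Longrightarrow> x t = p t - \<delta> t \<Longrightarrow> - x' t + L < \<delta>' t"
    and t: "t \<in> {t0..t1}"
  shows "p t - \<delta> t < x t"
proof -
  have "- x t < - p t + \<delta> t"
  proof (rule upper_fence[where ?t0.0=t0 and ?t1.0=t1 and p="\<lambda>t. - p t" and x="\<lambda>t. - x t"
        and x'="\<lambda>t. - x' t" and \<delta>=\<delta> and \<delta>'=\<delta>' and L=L])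
    fix s assume s: "s \<in> {t0..t1}"
    show "\<exists>e>0. \<forall>v\<in>{t0..t1}. \<bar>v - s\<bar> < e \<longrightarrow> \<bar>- p v - - p s\<bar> \<le> L * \<bar>v - s\<bar>"
      using lip[OF s] by (simp add: abs_minus_commute)
    show "((\<lambda>t. - x t) has_real_derivative - x' s) (at s within {t0..t1})"
      by (rule DERIV_minus[OF x[OF s]])
    show "- x s = - p s + \<delta> s \<Longrightarrow> - x' s + L < \<delta>' s" using touch[OF s] by simp
  qed (use p \<delta> init t in \<open>auto intro: continuous_on_minus\<close>)
  then show ?thesis by simp
qed

section \<open>Drifts with bounded derivatives\<close>

text \<open>
  The constant \<open>B\<close> bounds all derivatives that occur. Everything is required on an open strip, so that
  perturbations of points with \<open>\<bar>x\<bar> \<le> d < d'\<close> are allowed.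
\<close>

locale smooth_strip =
  fixes f :: "real \<Rightarrow> real \<Rightarrow> real" and d' B :: real
  assumes B: "0 < B"
    and deriv_x: "\<bar>x\<bar> < d' \<Longrightarrow> ((\<lambda>y. f y t) has_real_derivative dx f x t) (at x)"
    and deriv_xx: "\<bar>x\<bar> < d' \<Longrightarrow> ((\<lambda>y. dx f y t) has_real_derivative dx (dx f) x t) (at x)"
    and dx_bound: "\<bar>x\<bar> < d' \<Longrightarrow> \<bar>dx f x t\<bar> \<le> B"
    and dxx_bound: "\<bar>x\<bar> < d' \<Longrightarrow> \<bar>dx (dx f) x t\<bar> \<le> B"
    and lipschitz_t: "\<bar>x\<bar> < d' \<Longrightarrow> \<bar>f x t - f x s\<bar> \<le> B * \<bar>t - s\<bar>"
    and lipschitz_dxx: "\<bar>x\<bar> < d' \<Longrightarrow> \<bar>y\<bar> < d' \<Longrightarrow>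
      \<bar>dx (dx f) x t - dx (dx f) y s\<bar> \<le> B * (\<bar>x - y\<bar> + \<bar>t - s\<bar>)"
    and cont: "continuous_on ({-d'<..<d'} \<times> UNIV) (\<lambda>(x, t). f x t)"
    and cont_dx: "continuous_on ({-d'<..<d'} \<times> UNIV) (\<lambda>(x, t). dx f x t)"
begin

lemma mean_value_x:
  assumes "x < y" "\<bar>x\<bar> < d'" "\<bar>y\<bar> < d'"
  shows "\<exists>z. x < z \<and> z < y \<and> f y t - f x t = (y - x) * dx f z t"
proof -
  have "\<exists>z. x < z \<and> z < y \<and> f y t - f x t = (y - x) * dx f z t"
    by (rule MVT2[OF assms(1)]) (use assms in \<open>auto intro!: deriv_x\<close>)
  then show ?thesis by blast
qed

lemma mean_value_xx:
  assumes "x < y" "\<bar>x\<bar> < d'" "\<bar>y\<bar> < d'"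
  shows "\<exists>z. x < z \<and> z < y \<and> dx f y t - dx f x t = (y - x) * dx (dx f) z t"
proof -
  have "\<exists>z. x < z \<and> z < y \<and> dx f y t - dx f x t = (y - x) * dx (dx f) z t"
    by (rule MVT2[OF assms(1)]) (use assms in \<open>auto intro!: deriv_xx\<close>)
  then show ?thesis by blast
qed

lemma lipschitz_dx:
  assumes "\<bar>x\<bar> < d'" "\<bar>y\<bar> < d'"
  shows "\<bar>dx f x t - dx f y t\<bar> \<le> B * \<bar>x - y\<bar>"
proof -
  have *: "\<bar>dx f x t - dx f y t\<bar> \<le> B * \<bar>x - y\<bar>" if xy: "x < y" "\<bar>x\<bar> < d'" "\<bar>y\<bar> < d'" for x y
  proof -
    obtain z where z: "x < z" "z < y" "dx f y t - dx f x t = (y - x) * dx (dx f) z t"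
      using mean_value_xx[OF xy] by blast
    have "\<bar>(y - x) * dx (dx f) z t\<bar> \<le> (y - x) * B"
      using dxx_bound[of z t] z xy by (auto simp: abs_mult intro!: mult_left_mono)
    then show ?thesis using z xy by (simp add: abs_minus_commute mult.commute)
  qed
  show ?thesis using *[of x y] *[of y x] assms
    by (cases x y rule: linorder_cases) (auto simp: abs_minus_commute)
qed

lemma taylor_remainder:
  assumes "\<bar>x\<bar> < d'" "\<bar>y\<bar> < d'"
  shows "\<bar>f y t - f x t - dx f x t * (y - x)\<bar> \<le> B * (y - x)\<^sup>2"
proof -
  have "\<exists>z. \<bar>z\<bar> < d' \<and> \<bar>z - x\<bar> \<le> \<bar>y - x\<bar> \<and> f y t - f x t = (y - x) * dx f z t"
  proof (cases x y rule: linorder_cases)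
    case less
    from mean_value_x[OF this assms, of t] obtain z where "x < z" "z < y" "f y t - f x t = (y - x) * dx f z t" by blast
    then show ?thesis using assms by (intro exI[of _ z]) auto
  next
    case greater
    from mean_value_x[OF this assms(2,1), of t] obtain z where "y < z" "z < x" "f x t - f y t = (x - y) * dx f z t" by blast
    then show ?thesis using assms by (intro exI[of _ z]) (auto simp: algebra_simps)
  qed (use assms in auto)
  then obtain z where z: "\<bar>z\<bar> < d'" "\<bar>z - x\<bar> \<le> \<bar>y - x\<bar>" "f y t - f x t = (y - x) * dx f z t" by blast
  have "f y t - f x t - dx f x t * (y - x) = (y - x) * (dx f z t - dx f x t)"
    using z(3) by (simp add: algebra_simps)
  also have "\<bar>\<dots>\<bar> \<le> \<bar>y - x\<bar> * (B * \<bar>y - x\<bar>)"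
    unfolding abs_mult using lipschitz_dx[OF z(1) assms(1), of t] mult_left_mono[OF z(2) less_imp_le[OF B]]
    by (intro mult_left_mono) linarith+
  also have "\<dots> = B * (y - x)\<^sup>2" by (simp add: power2_eq_square)
  finally show ?thesis .
qed

text \<open>
  The quantitative part of the implicit function theorem: \<open>f (p t) s\<close> is both \<open>\<O>(\<bar>t - s\<bar>)\<close> and comparable to
  \<open>p t - p s\<close>, once continuity of \<open>p\<close> has made the latter small.
\<close>

lemma branch_locally_lipschitz:
  assumes p: "continuous_on {t0..t1} p" and zero: "\<And>t. t \<in> {t0..t1} \<Longrightarrow> f (p t) t = 0"
    and pd: "\<And>t. t \<in> {t0..t1} \<Longrightarrow> \<bar>p t\<bar> < d'"
    and stable: "\<And>t. t \<in> {t0..t1} \<Longrightarrow> dx f (p t) t \<le> - c" and c: "0 < c"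
    and t: "t \<in> {t0..t1}"
  shows "\<exists>e>0. \<forall>s\<in>{t0..t1}. \<bar>s - t\<bar> < e \<longrightarrow> \<bar>p s - p t\<bar> \<le> 2 * B / c * \<bar>s - t\<bar>"
proof -
  have "0 < c / (2 * B)" using c B by simp
  then obtain e where e: "0 < e" "\<And>s. s \<in> {t0..t1} \<Longrightarrow> dist s t < e \<Longrightarrow> dist (p s) (p t) < c / (2 * B)"
    using p t unfolding continuous_on_iff by blast
  have "\<bar>p s - p t\<bar> \<le> 2 * B / c * \<bar>s - t\<bar>" if s: "s \<in> {t0..t1}" "\<bar>s - t\<bar> < e" for s
  proof -
    have close: "\<bar>p s - p t\<bar> < c / (2 * B)" using e(2)[of s] s by (simp add: dist_real_def)
    have slope: "dx f z s \<le> - c / 2" if "\<bar>z - p s\<bar> \<le> \<bar>p s - p t\<bar>" "\<bar>z\<bar> < d'" for z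
    proof -
      have "B * \<bar>z - p s\<bar> \<le> B * (c / (2 * B))" using that(1) close B by (intro mult_left_mono) auto
      then have "B * \<bar>z - p s\<bar> \<le> c / 2" using B by simp
      then show ?thesis using lipschitz_dx[OF that(2) pd[OF s(1)], of s] stable[OF s(1)] by linarith
    qed
    have "\<exists>z. \<bar>z\<bar> < d' \<and> \<bar>z - p s\<bar> \<le> \<bar>p s - p t\<bar> \<and> f (p t) s - f (p s) s = (p t - p s) * dx f z s"
    proof (cases "p s" "p t" rule: linorder_cases)
      case less
      from mean_value_x[OF this pd[OF s(1)] pd[OF t], of s] obtain z
        where "p s < z" "z < p t" "f (p t) s - f (p s) s = (p t - p s) * dx f z s" by blast
      then show ?thesis using pd[OF s(1)] pd[OF t] by (intro exI[of _ z]) auto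
    next
      case greater
      from mean_value_x[OF this pd[OF t] pd[OF s(1)], of s] obtain z
        where "p t < z" "z < p s" "f (p s) s - f (p t) s = (p s - p t) * dx f z s" by blast
      then show ?thesis using pd[OF s(1)] pd[OF t] by (intro exI[of _ z]) (auto simp: algebra_simps)
    qed (use pd[OF s(1)] in auto)
    then obtain z where z: "\<bar>z\<bar> < d'" "\<bar>z - p s\<bar> \<le> \<bar>p s - p t\<bar>"
      "f (p t) s - f (p s) s = (p t - p s) * dx f z s" by blast
    have "\<bar>p s - p t\<bar> * (c / 2) \<le> \<bar>p t - p s\<bar> * \<bar>dx f z s\<bar>"
      using slope[OF z(2,1)] c by (subst abs_minus_commute, intro mult_left_mono) auto
    also have "\<dots> = \<bar>f (p t) s - f (p t) t\<bar>"
      using z(3) zero[OF s(1)] zero[OF t] by (simp flip: abs_mult)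
    also have "\<dots> \<le> B * \<bar>s - t\<bar>" by (rule lipschitz_t[OF pd[OF t]])
    finally show ?thesis using c by (simp add: field_simps)
  qed
  then show ?thesis using e(1) by blast
qed

end

text \<open>
  The partial derivatives witnessing \<open>bounded_C\<close> agree with \<open>dx f\<close> and \<open>dx (dx f)\<close> inside the strip by
  uniqueness of derivatives.
\<close>

lemma bounded_C_3_smooth_strip:
  assumes f: "bounded_C 3 B ({-d'<..<d'} \<times> UNIV) f" and B: "0 < B"
  shows "smooth_strip f d' B"
proof -
  let ?U = "{-d'<..<d'} \<times> (UNIV :: real set)"
  have U: "(x, t) \<in> ?U \<longleftrightarrow> \<bar>x\<bar> < d'" for x t by (auto simp: abs_less_iff)
  have dx_eq: "g' x t = dx g x t" if "\<forall>(x, t)\<in>?U. ((\<lambda>y. g y t) has_real_derivative g' x t) (at x)" "\<bar>x\<bar> < d'"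
    for g g' :: "real \<Rightarrow> real \<Rightarrow> real" and x t
    using that U unfolding dx_def by (force intro: DERIV_imp_deriv[symmetric])
  have cong_deriv: "((\<lambda>y. h y t) has_real_derivative D) (at x)"
    if "((\<lambda>y. g y t) has_real_derivative D) (at x)" "\<And>y. \<bar>y\<bar> < d' \<Longrightarrow> g y t = h y t" "\<bar>x\<bar> < d'"
    for g h :: "real \<Rightarrow> real \<Rightarrow> real" and x t D
    by (rule has_field_derivative_transform_within_open[OF that(1), of "{-d'<..<d'}"])
      (use that in \<open>auto simp: abs_less_iff\<close>)
  have n: "(3::nat) = Suc 2" "(2::nat) = Suc 1" "(1::nat) = Suc 0" by simp_all
  have cf: "continuous_on ?U (\<lambda>(x, t). f x t)" using f unfolding n(1) bounded_C.simps by blast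
  from f obtain g1 gt where f1: "\<forall>(x, t)\<in>?U. ((\<lambda>y. f y t) has_real_derivative g1 x t) (at x)"
    and ft: "\<forall>(x, t)\<in>?U. ((\<lambda>s. f x s) has_real_derivative gt x t) (at t)"
    and b1: "bounded_C 2 B ?U g1" and bt: "bounded_C 2 B ?U gt"
    unfolding n(1) bounded_C.simps by blast
  have c1: "continuous_on ?U (\<lambda>(x, t). g1 x t)" and B1: "\<forall>(x, t)\<in>?U. \<bar>g1 x t\<bar> \<le> B"
    using b1 unfolding n(2) bounded_C.simps by blast+
  from b1 obtain g2 where f2: "\<forall>(x, t)\<in>?U. ((\<lambda>y. g1 y t) has_real_derivative g2 x t) (at x)"
    and b2: "bounded_C 1 B ?U g2"
    unfolding n(2) bounded_C.simps by blast
  have B2: "\<forall>(x, t)\<in>?U. \<bar>g2 x t\<bar> \<le> B"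
    using b2 unfolding n(3) bounded_C.simps by blast
  from b2 obtain g3 g2t where f3: "\<forall>(x, t)\<in>?U. ((\<lambda>y. g2 y t) has_real_derivative g3 x t) (at x)"
    and f2t: "\<forall>(x, t)\<in>?U. ((\<lambda>s. g2 x s) has_real_derivative g2t x t) (at t)"
    and B3: "\<forall>(x, t)\<in>?U. \<bar>g3 x t\<bar> \<le> B" and B2t: "\<forall>(x, t)\<in>?U. \<bar>g2t x t\<bar> \<le> B"
    unfolding n(3) bounded_C.simps by blast
  have Bt: "\<forall>(x, t)\<in>?U. \<bar>gt x t\<bar> \<le> B" using bt unfolding n(2) bounded_C.simps by blast
  have e1: "g1 x t = dx f x t" if "\<bar>x\<bar> < d'" for x t by (rule dx_eq[OF f1 that])
  have f1': "((\<lambda>y. dx f y t) has_real_derivative g2 x t) (at x)" if "\<bar>x\<bar> < d'" for x t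
    by (rule cong_deriv[of g1]) (use f2 U that e1 in auto)
  then have e2: "g2 x t = dx (dx f) x t" if "\<bar>x\<bar> < d'" for x t
    using that unfolding dx_def[of "dx f"] by (force intro: DERIV_imp_deriv[symmetric])
  have lip: "\<bar>h y - h x\<bar> \<le> B * \<bar>y - x\<bar>"
    if h: "\<And>z. z \<in> S \<Longrightarrow> (h has_real_derivative h' z) (at z)" "\<And>z. z \<in> S \<Longrightarrow> \<bar>h' z\<bar> \<le> B"
      and S: "convex S" "x \<in> S" "y \<in> S" for h h' :: "real \<Rightarrow> real" and x y S
    using field_differentiable_bound[OF S(1), of h h' B y x] h S
    by (auto intro: has_field_derivative_at_within)
  show ?thesis
  proof
    fix x t s :: real assume x: "\<bar>x\<bar> < d'"
    show "((\<lambda>y. f y t) has_real_derivative dx f x t) (at x)" using f1 U x e1 by force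
    show "((\<lambda>y. dx f y t) has_real_derivative dx (dx f) x t) (at x)" using f1'[OF x, of t] e2[OF x] by simp
    show "\<bar>dx f x t\<bar> \<le> B" using B1 U x e1 by force
    show "\<bar>dx (dx f) x t\<bar> \<le> B" using B2 U x e2 by force
    show "\<bar>f x t - f x s\<bar> \<le> B * \<bar>t - s\<bar>"
      by (rule lip[of UNIV "\<lambda>t. f x t" "\<lambda>t. gt x t"]) (use ft Bt U x in auto)
    fix y assume y: "\<bar>y\<bar> < d'"
    have "\<bar>g2 x t - g2 y t\<bar> \<le> B * \<bar>x - y\<bar>"
      by (rule lip[of "{-d'<..<d'}" "\<lambda>x. g2 x t" "\<lambda>x. g3 x t"]) (use f3 B3 U x y in \<open>auto simp: abs_less_iff\<close>)
    moreover have "\<bar>g2 y t - g2 y s\<bar> \<le> B * \<bar>t - s\<bar>"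
      by (rule lip[of UNIV "\<lambda>t. g2 y t" "\<lambda>t. g2t y t"]) (use f2t B2t U y in auto)
    ultimately show "\<bar>dx (dx f) x t - dx (dx f) y s\<bar> \<le> B * (\<bar>x - y\<bar> + \<bar>t - s\<bar>)"
      unfolding e2[OF x, symmetric] e2[OF y, symmetric] by (simp add: distrib_left)
  next
    show "continuous_on ?U (\<lambda>(x, t). dx f x t)"
      using c1 by (rule continuous_on_eq) (auto simp: U e1 simp del: mem_Times_iff)
  qed (use B cf in auto)
qed

section \<open>Passage through an avoided saddle-node bifurcation\<close>

text \<open>
  The fold is at \<open>(xc, 0)\<close>, \<open>p\<close> is the stable branch, \<open>r0\<close> the radius of validity of the expansions, and
  \<open>c1\<close>, \<open>C1\<close> control the growth of the branch and of its stability away from the fold. The remaining constants are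
  chosen in the order \<open>r1\<close>, \<open>c\<close>, \<open>r\<close>, \<open>\<delta>\<close>, and independently of \<open>a\<close> and \<open>\<epsilon>\<close>.

  \<^item> \<open>r1\<close> is the spatial size of the window in which \<open>f\<close> is strictly concave in \<open>x\<close>.
  \<^item> \<open>c\<close> is the slope of the lower fences \<open>xc + c (2 sqrt \<epsilon> - t)\<close> and \<open>xc + c t\<close>.
  \<^item> \<open>r\<close> is half the length of the time window; it is small enough for the upper fence \<open>xc + r1\<close> to be impenetrable.
  \<^item> \<open>\<delta>\<close> is the distance at which the solution follows the branch for \<open>\<bar>t\<bar> \<ge> r\<close>.

  The last two conditions on \<open>\<epsilon>\<close> say that relaxation beats the motion of the branch, whose Lipschitz constant is
  \<open>4 B / (c1 r)\<close> for \<open>\<bar>t\<bar> \<ge> r / 2\<close>.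
\<close>

locale fold_passage = smooth_strip f d' B
  for f :: "real \<Rightarrow> real \<Rightarrow> real" and d' B :: real +
  fixes xc d q K \<alpha> r0 c1 C1 T a \<epsilon> r1 r c \<delta> :: real and p x :: "real \<Rightarrow> real"
  assumes d: "d < d'"
    and q: "0 < q" "dx (dx f) xc 0 = - q"
    and K: "0 \<le> K" and \<alpha>: "0 < \<alpha>" and a: "0 < a" and T: "0 < T"
    and dx_xc: "\<bar>t\<bar> \<le> r0 \<Longrightarrow> \<bar>dx f xc t\<bar> \<le> K * t\<^sup>2"
    and f_xc: "\<bar>t\<bar> \<le> r0 \<Longrightarrow> \<bar>f xc t - (a + \<alpha> * t\<^sup>2)\<bar> \<le> K * \<bar>t\<bar>^3"
    and p_cont: "continuous_on UNIV p" and p_zero: "f (p t) t = 0" and p_d: "\<bar>p t\<bar> \<le> d"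
    and branch: "sqrt a \<le> \<bar>t\<bar> \<Longrightarrow> \<bar>t\<bar> \<le> T \<Longrightarrow>
        c1 * \<bar>t\<bar> \<le> p t - xc \<and> p t - xc \<le> C1 * \<bar>t\<bar> \<and> dx f (p t) t \<le> - c1 * \<bar>t\<bar>"
    and c1: "0 < c1"
    and r1: "0 < r1" "4 * B * r1 \<le> q" "\<bar>xc\<bar> + r1 \<le> d" "4 * K * r1 \<le> \<alpha>"
    and r: "0 < r" "r \<le> r0" "r \<le> r1" "r \<le> T" "2 * C1 * r \<le> r1" "64 * \<alpha> * r\<^sup>2 \<le> q * r1\<^sup>2" "4 * K * r \<le> q * c"
    and c: "0 < c" "3 * c \<le> 1" "8 * B * c \<le> 1" "4 * c \<le> \<alpha>" "8 * c \<le> c1"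
    and \<delta>: "0 < \<delta>" "4 * \<delta> \<le> c1 * r" "2 * B * \<delta> \<le> c1 * r" "2 * \<delta> \<le> d' - d"
    and a_small: "4 * a \<le> r\<^sup>2" "32 * a \<le> q * r1\<^sup>2"
    and \<epsilon>: "0 < \<epsilon>" "4 * \<epsilon> \<le> r\<^sup>2" "\<epsilon> * (4 * B / (c1 * r) + 2 * r1 / r) < q * c * r / 8 * \<delta>"
      "\<epsilon> * (4 * B / (c1 * r)) < c1 * r / 2 * \<delta>"
    and x_init: "\<bar>x (- T) - p (- T)\<bar> < \<delta>"
    and x_ode: "t \<in> {-T..T} \<Longrightarrow> (x has_real_derivative f (x t) t / \<epsilon>) (at t within {-T..T})"
begin

lemma x_deriv: "{t0..t1} \<subseteq> {-T..T} \<Longrightarrow> t \<in> {t0..t1} \<Longrightarrow>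
    (x has_real_derivative f (x t) t / \<epsilon>) (at t within {t0..t1})"
  by (rule DERIV_subset[OF x_ode]) auto

lemma sqrt_small: "sqrt a \<le> r / 2" "sqrt \<epsilon> \<le> r / 2" "0 < sqrt a" "0 < sqrt \<epsilon>"
proof -
  show "sqrt a \<le> r / 2" using a_small(1) r(1) by (intro real_le_lsqrt) (auto simp: power_divide)
  show "sqrt \<epsilon> \<le> r / 2" using \<epsilon>(2) r(1) by (intro real_le_lsqrt) (auto simp: power_divide)
qed (use a \<epsilon> in auto)

lemma branch_bounds: assumes "r / 2 \<le> \<bar>t\<bar>" "\<bar>t\<bar> \<le> T"
  shows "c1 * \<bar>t\<bar> \<le> p t - xc" "p t - xc \<le> C1 * \<bar>t\<bar>" "dx f (p t) t \<le> - c1 * \<bar>t\<bar>"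
  using branch[of t] assms sqrt_small by auto

lemma branch_lipschitz:
  assumes I: "\<And>t. t \<in> {t0..t1} \<Longrightarrow> r / 2 \<le> \<bar>t\<bar> \<and> \<bar>t\<bar> \<le> T" and t: "t \<in> {t0..t1}"
  shows "\<exists>e>0. \<forall>s\<in>{t0..t1}. \<bar>s - t\<bar> < e \<longrightarrow> \<bar>p s - p t\<bar> \<le> 4 * B / (c1 * r) * \<bar>s - t\<bar>"
proof -
  have "\<exists>e>0. \<forall>s\<in>{t0..t1}. \<bar>s - t\<bar> < e \<longrightarrow> \<bar>p s - p t\<bar> \<le> 2 * B / (c1 * (r / 2)) * \<bar>s - t\<bar>"
  proof (rule branch_locally_lipschitz[OF _ p_zero _ _ _ t])
    show "continuous_on {t0..t1} p" by (rule continuous_on_subset[OF p_cont]) auto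
    show "0 < c1 * (r / 2)" using c1 r by simp
    fix s assume s: "s \<in> {t0..t1}"
    show "\<bar>p s\<bar> < d'" using p_d[of s] d by simp
    have "c1 * (r / 2) \<le> c1 * \<bar>s\<bar>" using I[OF s] c1 by (intro mult_left_mono) auto
    then show "dx f (p s) s \<le> - (c1 * (r / 2))" using branch_bounds(3)[of s] I[OF s] by simp
  qed
  then show ?thesis by (simp add: mult.commute mult.left_commute)
qed

text \<open>
  The distance to the branch obeys \<open>\<epsilon> \<bar>x - p\<bar>' \<le> - k \<bar>x - p\<bar> + \<O>(\<epsilon>)\<close>, so it stays below any \<open>D\<close> that does not
  decrease too fast.
\<close>

lemma contraction_to_branch:
  assumes sub: "{t0..t1} \<subseteq> {-T..T}" and I: "\<And>s. s \<in> {t0..t1} \<Longrightarrow> r / 2 \<le> \<bar>s\<bar>"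
    and D: "\<And>s. s \<in> {t0..t1} \<Longrightarrow> (D has_real_derivative D' s) (at s within {t0..t1})" "\<And>s. s \<in> {t0..t1} \<Longrightarrow> 0 < D s"
    and strip: "\<And>s. s \<in> {t0..t1} \<Longrightarrow> \<bar>x s - p s\<bar> = D s \<Longrightarrow> \<bar>x s\<bar> < d'"
    and slope: "\<And>s z. s \<in> {t0..t1} \<Longrightarrow> \<bar>x s - p s\<bar> = D s \<Longrightarrow> min (x s) (p s) < z \<Longrightarrow>
      z < max (x s) (p s) \<Longrightarrow> dx f z s \<le> - k"
    and fast: "\<And>s. s \<in> {t0..t1} \<Longrightarrow> 4 * B / (c1 * r) - D' s < k * D s / \<epsilon>"
    and init: "\<bar>x t0 - p t0\<bar> < D t0" and t: "t \<in> {t0..t1}"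
  shows "\<bar>x t - p t\<bar> < D t"
proof -
  have I': "r / 2 \<le> \<bar>s\<bar> \<and> \<bar>s\<bar> \<le> T" if "s \<in> {t0..t1}" for s using I[OF that] sub that by auto
  have pc: "continuous_on {t0..t1} p" by (rule continuous_on_subset[OF p_cont]) auto
  have ps: "\<bar>p s\<bar> < d'" for s using p_d[of s] d by simp
  have "x t < p t + D t"
  proof (rule upper_fence[OF pc branch_lipschitz[OF I'] x_deriv[OF sub] D(1)])
    fix s assume s: "s \<in> {t0..t1}" "x s = p s + D s"
    have Ds: "0 < D s" "\<bar>x s - p s\<bar> = D s" using D(2)[OF s(1)] s(2) by auto
    then obtain z where z: "p s < z" "z < x s" "f (x s) s - f (p s) s = (x s - p s) * dx f z s"
      using mean_value_x[of "p s" "x s" s] ps strip[OF s(1)] s(2) by auto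
    have "dx f z s \<le> - k" using z by (intro slope[OF s(1) Ds(2)]) auto
    then have "D s * dx f z s \<le> D s * - k" using Ds(1) by (intro mult_left_mono) auto
    then have "f (x s) s \<le> - (k * D s)" using z(3) s(2) p_zero[of s] by (simp add: mult.commute)
    then have "f (x s) s / \<epsilon> \<le> - (k * D s) / \<epsilon>" using \<epsilon>(1) by (intro divide_right_mono) auto
    then show "f (x s) s / \<epsilon> + 4 * B / (c1 * r) < D' s" using fast[OF s(1)] by simp
  qed (use init t in auto)
  moreover have "p t - D t < x t"
  proof (rule lower_fence[OF pc branch_lipschitz[OF I'] x_deriv[OF sub] D(1)])
    fix s assume s: "s \<in> {t0..t1}" "x s = p s - D s"
    have Ds: "0 < D s" "\<bar>x s - p s\<bar> = D s" using D(2)[OF s(1)] s(2) by auto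
    then obtain z where z: "x s < z" "z < p s" "f (p s) s - f (x s) s = (p s - x s) * dx f z s"
      using mean_value_x[of "x s" "p s" s] ps strip[OF s(1)] s(2) by auto
    have "dx f z s \<le> - k" using z by (intro slope[OF s(1) Ds(2)]) auto
    then have "D s * dx f z s \<le> D s * - k" using Ds(1) by (intro mult_left_mono) auto
    then have "k * D s \<le> f (x s) s" using z(3) s(2) p_zero[of s] by (simp add: mult.commute)
    then have "k * D s / \<epsilon> \<le> f (x s) s / \<epsilon>" using \<epsilon>(1) by (intro divide_right_mono) auto
    then show "- (f (x s) s / \<epsilon>) + 4 * B / (c1 * r) < D' s" using fast[OF s(1)] by simp
  qed (use init t in auto)
  ultimately show ?thesis by (simp add: abs_less_iff)
qed

lemma stable_near_branch:
  assumes t: "r \<le> \<bar>t\<bar>" "\<bar>t\<bar> \<le> T" and z: "\<bar>z - p t\<bar> \<le> \<delta>"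
  shows "\<bar>z\<bar> < d'" "dx f z t \<le> - (c1 * r / 2)"
proof -
  show zd: "\<bar>z\<bar> < d'" using z p_d[of t] \<delta> d by simp
  have "B * \<bar>z - p t\<bar> \<le> B * \<delta>" using z B by (intro mult_left_mono) auto
  then have "\<bar>dx f z t - dx f (p t) t\<bar> \<le> c1 * r / 2"
    using lipschitz_dx[OF zd, of "p t" t] p_d[of t] d \<delta>(3) by simp
  moreover have "c1 * r \<le> c1 * \<bar>t\<bar>" using t c1 by (intro mult_left_mono) auto
  moreover have "dx f (p t) t \<le> - c1 * \<bar>t\<bar>" by (rule branch_bounds(3)) (use t r(1) in auto)
  ultimately show "dx f z t \<le> - (c1 * r / 2)" by linarith
qed

lemma outer_tracking:
  assumes sub: "{t0..t1} \<subseteq> {-T..T}" and I: "\<And>t. t \<in> {t0..t1} \<Longrightarrow> r \<le> \<bar>t\<bar>"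
    and init: "\<bar>x t0 - p t0\<bar> < \<delta>" and t: "t \<in> {t0..t1}"
  shows "\<bar>x t - p t\<bar> < \<delta>"
proof (rule contraction_to_branch[OF sub, where D="\<lambda>_. \<delta>" and D'="\<lambda>_. 0" and k="c1 * r / 2"])
  fix s assume s: "s \<in> {t0..t1}"
  then have rs: "r \<le> \<bar>s\<bar>" "\<bar>s\<bar> \<le> T" using I sub by auto
  then show "r / 2 \<le> \<bar>s\<bar>" using r(1) by simp
  assume x: "\<bar>x s - p s\<bar> = \<delta>"
  then show "\<bar>x s\<bar> < d'" using stable_near_branch(1)[OF rs] by simp
  fix z assume "min (x s) (p s) < z" "z < max (x s) (p s)"
  then show "dx f z s \<le> - (c1 * r / 2)" using x by (intro stable_near_branch(2)[OF rs]) auto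
next
  show "4 * B / (c1 * r) - 0 < c1 * r / 2 * \<delta> / \<epsilon>" using \<epsilon>(1,4) by (simp add: pos_less_divide_eq mult.commute)
qed (use init t \<delta> in auto)

lemma strip_near_fold: "0 \<le> y \<Longrightarrow> y \<le> r1 \<Longrightarrow> \<bar>xc + y\<bar> < d'"
  using r1(1,3) d by (auto simp: abs_if split: if_splits)

text \<open>
  Concavity: \<open>dx (dx f)\<close> stays below \<open>- q / 2\<close> in the window because it equals \<open>- q\<close> at the fold and is
  Lipschitz.
\<close>

lemma dx_near_fold:
  assumes y: "0 \<le> y" "y \<le> r1" and t: "\<bar>t\<bar> \<le> r"
  shows "dx f (xc + y) t \<le> K * t\<^sup>2 - q / 2 * y" "- K * t\<^sup>2 - B * y \<le> dx f (xc + y) t"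
proof -
  have t0: "\<bar>t\<bar> \<le> r0" using t r by simp
  have "dx f (xc + y) t - dx f xc t \<le> - (q / 2) * y \<and> - B * y \<le> dx f (xc + y) t - dx f xc t"
  proof (cases "y = 0")
    case False
    then have "xc < xc + y" using y by simp
    then obtain z where z: "xc < z" "z < xc + y" "dx f (xc + y) t - dx f xc t = (xc + y - xc) * dx (dx f) z t"
      using mean_value_xx[of xc "xc + y" t] strip_near_fold[OF y] strip_near_fold[of 0] r1(1) by auto
    have zd: "\<bar>z\<bar> < d'" using strip_near_fold[of "z - xc"] z y by auto
    have xd: "\<bar>xc\<bar> < d'" using strip_near_fold[of 0] r1(1) by simp
    have "\<bar>dx (dx f) z t - dx (dx f) xc 0\<bar> \<le> B * (\<bar>z - xc\<bar> + \<bar>t - 0\<bar>)" by (rule lipschitz_dxx[OF zd xd])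
    also have "\<dots> \<le> B * (2 * r1)" using z y t r B by (intro mult_left_mono) auto
    also have "\<dots> \<le> q / 2" using r1(2) by simp
    finally have up: "dx (dx f) z t \<le> - (q / 2)" using q(2) by linarith
    have lo: "- B \<le> dx (dx f) z t" using dxx_bound[OF zd, of t] by simp
    have "y * dx (dx f) z t \<le> y * - (q / 2)" "y * - B \<le> y * dx (dx f) z t"
      using y up lo by (intro mult_left_mono; simp)+
    then show ?thesis using z(3) by (simp add: mult.commute)
  qed simp
  then show "dx f (xc + y) t \<le> K * t\<^sup>2 - q / 2 * y" "- K * t\<^sup>2 - B * y \<le> dx f (xc + y) t"
    using dx_xc[OF t0] by auto
qed

lemma f_at_fold:
  assumes t: "\<bar>t\<bar> \<le> r"
  shows "\<bar>f xc t - (a + \<alpha> * t\<^sup>2)\<bar> \<le> K * r1 * t\<^sup>2" "2 * (K * r1) * t\<^sup>2 \<le> \<alpha> / 2 * t\<^sup>2"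
proof -
  have "\<bar>t\<bar>^3 = \<bar>t\<bar> * t\<^sup>2" by (simp add: power3_eq_cube power2_eq_square)
  also have "\<dots> \<le> r1 * t\<^sup>2" using t r by (intro mult_right_mono) auto
  finally have "K * \<bar>t\<bar>^3 \<le> K * r1 * t\<^sup>2" using K by (simp add: mult_left_mono mult.assoc)
  then show "\<bar>f xc t - (a + \<alpha> * t\<^sup>2)\<bar> \<le> K * r1 * t\<^sup>2" using f_xc[of t] t r(2) by linarith
  show "2 * (K * r1) * t\<^sup>2 \<le> \<alpha> / 2 * t\<^sup>2" using r1(4) by (intro mult_right_mono) auto
qed

lemma f_lower_near_fold:
  assumes y: "0 \<le> y" "y \<le> r1" and t: "\<bar>t\<bar> \<le> r"
  shows "a + \<alpha> / 2 * t\<^sup>2 - B * y\<^sup>2 \<le> f (xc + y) t"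
proof -
  have "- (K * r1 * t\<^sup>2) - B * y\<^sup>2 \<le> f (xc + y) t - f xc t"
  proof (cases "y = 0")
    case False
    then have "xc < xc + y" using y by simp
    then obtain z where z: "xc < z" "z < xc + y" "f (xc + y) t - f xc t = (xc + y - xc) * dx f z t"
      using mean_value_x[of xc "xc + y" t] strip_near_fold[OF y] strip_near_fold[of 0] r1(1) by auto
    have "- K * t\<^sup>2 - B * (z - xc) \<le> dx f z t" using dx_near_fold(2)[of "z - xc" t] z y t by simp
    moreover have "B * (z - xc) \<le> B * y" using z B by (intro mult_left_mono) auto
    ultimately have "- K * t\<^sup>2 - B * y \<le> dx f z t" by linarith
    then have "y * (- K * t\<^sup>2 - B * y) \<le> y * dx f z t" using y by (intro mult_left_mono) auto
    moreover have "y * (K * t\<^sup>2) \<le> r1 * (K * t\<^sup>2)" using y K by (intro mult_right_mono) auto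
    ultimately show ?thesis using z(3) by (simp add: algebra_simps power2_eq_square)
  qed (use K r1(1) in auto)
  then show ?thesis using f_at_fold[OF t] by (auto simp: abs_le_iff)
qed

lemma f_neg_at_r1:
  assumes t: "\<bar>t\<bar> \<le> r"
  shows "f (xc + r1) t < 0"
proof -
  have h: "0 \<le> r1 / 2" "r1 / 2 \<le> r1" using r1(1) by auto
  obtain z where z: "xc < z" "z < xc + r1 / 2" "f (xc + r1 / 2) t - f xc t = (xc + r1 / 2 - xc) * dx f z t"
    using mean_value_x[of xc "xc + r1 / 2" t] strip_near_fold[OF h] strip_near_fold[of 0] r1(1) by auto
  obtain z' where z': "xc + r1 / 2 < z'" "z' < xc + r1"
      "f (xc + r1) t - f (xc + r1 / 2) t = (xc + r1 - (xc + r1 / 2)) * dx f z' t"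
    using mean_value_x[of "xc + r1 / 2" "xc + r1" t] strip_near_fold[OF h] strip_near_fold[of r1] r1(1) by auto
  have "dx f z t \<le> K * t\<^sup>2 - q / 2 * (z - xc)" using dx_near_fold(1)[of "z - xc" t] z h t by simp
  moreover have "0 \<le> q / 2 * (z - xc)" using z q by simp
  ultimately have "dx f z t \<le> K * t\<^sup>2" by linarith
  then have A: "r1 / 2 * dx f z t \<le> r1 / 2 * (K * t\<^sup>2)" using r1(1) by (intro mult_left_mono) auto
  have "dx f z' t \<le> K * t\<^sup>2 - q / 2 * (z' - xc)" using dx_near_fold(1)[of "z' - xc" t] z' h t by simp
  moreover have "q / 2 * (r1 / 2) \<le> q / 2 * (z' - xc)" using z' q by (intro mult_left_mono) auto
  ultimately have "dx f z' t \<le> K * t\<^sup>2 - q / 2 * (r1 / 2)" by linarith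
  then have B: "r1 / 2 * dx f z' t \<le> r1 / 2 * (K * t\<^sup>2 - q / 2 * (r1 / 2))" using r1(1) by (intro mult_left_mono) auto
  have C: "f (xc + r1) t \<le> f xc t + K * r1 * t\<^sup>2 - q * r1\<^sup>2 / 8"
    using A B z(3) z'(3) by (simp add: algebra_simps power2_eq_square)
  have "f (xc + r1) t \<le> a + 3 / 2 * \<alpha> * t\<^sup>2 - q * r1\<^sup>2 / 8"
    using C f_at_fold[OF t] by (auto simp: abs_le_iff)
  moreover have "\<bar>t\<bar>\<^sup>2 \<le> r\<^sup>2" using t by (intro power_mono) auto
  then have "\<alpha> * t\<^sup>2 \<le> \<alpha> * r\<^sup>2" using \<alpha> by (intro mult_left_mono) auto
  moreover have "0 < q * r1\<^sup>2" using q r1 by simp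
  ultimately show ?thesis using r(6) a_small(2) by linarith
qed

lemma start_near_fold: "\<bar>x (- r) - p (- r)\<bar> < \<delta>"
  by (rule outer_tracking[of "- T" "- r"]) (use r(1,4) x_init in auto)

lemma r_half: "r / 2 \<le> \<bar>- r\<bar>" "\<bar>- r\<bar> \<le> T" using r(1,4) by auto

lemma start_bounds: "xc + 6 * c * r \<le> x (- r)" "x (- r) < xc + r1"
proof -
  have "8 * c * r \<le> c1 * r" using c(5) r(1) by (intro mult_right_mono) auto
  then show "xc + 6 * c * r \<le> x (- r)"
    using branch_bounds(1)[OF r_half] start_near_fold \<delta>(2) r(1) unfolding abs_minus_cancel abs_of_pos[OF r(1)]
    by linarith
  have "p (-r) - xc \<le> C1 * r" "c1 * r \<le> C1 * r"
    using branch_bounds(1,2)[OF r_half] unfolding abs_minus_cancel abs_of_pos[OF r(1)] by linarith+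
  then show "x (- r) < xc + r1"
    using start_near_fold \<delta>(2) r(5) r1(1) by (auto simp: abs_less_iff)
qed

lemma near_fold_subset: "- r \<le> t0 \<Longrightarrow> t1 \<le> r \<Longrightarrow> {t0..t1} \<subseteq> {-T..T}"
  using r(4) by auto

lemma fence_slope_small: "B * c\<^sup>2 \<le> c / 8"
proof -
  have "(8 * B * c) * c \<le> 1 * c" using c by (intro mult_right_mono) auto
  then show ?thesis by (simp add: power2_eq_square)
qed

lemma constant_lipschitz: "\<exists>e>0. \<forall>s\<in>S. \<bar>s - t\<bar> < e \<longrightarrow> \<bar>xc - xc\<bar> \<le> 0 * \<bar>s - t\<bar>" for S :: "real set" and t :: real
  by (intro exI[of _ 1]) simp

lemma upper_near_fold:
  assumes t: "t \<in> {-r..r}" shows "x t < xc + r1"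
proof (rule upper_fence[where p="\<lambda>_. xc" and \<delta>="\<lambda>_. r1" and \<delta>'="\<lambda>_. 0" and L=0,
      OF continuous_on_const constant_lipschitz x_deriv[OF near_fold_subset[OF order_refl order_refl]]])
  fix s assume "s \<in> {-r..r}" "x s = xc + r1"
  then have "f (x s) s < 0" using f_neg_at_r1[of s] by auto
  then show "f (x s) s / \<epsilon> + 0 < 0" using \<epsilon>(1) by (simp add: divide_neg_pos)
qed (use t start_bounds in auto)

text \<open>
  While \<open>t \<le> sqrt \<epsilon>\<close> the fence moves down at speed \<open>c\<close>. This is what allows a gap \<open>a\<close> much smaller than \<open>\<epsilon>\<close>:
  near \<open>t = 0\<close> the drift on the fence may be as negative as \<open>- \<O>(c\<^sup>2 \<epsilon>)\<close>, and \<open>c \<epsilon>\<close> compensates for it. The solution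
  lags behind and passes at a distance of order \<open>sqrt \<epsilon>\<close>.
\<close>

lemma lower_near_fold_early:
  assumes t: "t \<in> {-r..sqrt \<epsilon>}" shows "xc + c * (2 * sqrt \<epsilon> - t) < x t"
proof -
  have sub: "{-r..sqrt \<epsilon>} \<subseteq> {-T..T}" using sqrt_small r by (intro near_fold_subset) auto
  have "xc - c * (t - 2 * sqrt \<epsilon>) < x t"
  proof (rule lower_fence[where p="\<lambda>_. xc" and \<delta>="\<lambda>t. c * (t - 2 * sqrt \<epsilon>)" and \<delta>'="\<lambda>_. c" and L=0,
      OF continuous_on_const constant_lipschitz x_deriv[OF sub]])
    fix s assume s: "s \<in> {-r..sqrt \<epsilon>}" "x s = xc - c * (s - 2 * sqrt \<epsilon>)"
    define y where "y = c * (2 * sqrt \<epsilon> - s)"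
    have xs: "x s = xc + y" using s(2) by (simp add: y_def algebra_simps)
    have sr: "\<bar>s\<bar> \<le> r" using s sqrt_small r(1) by auto
    have "s \<le> 2 * sqrt \<epsilon>" using s(1) sqrt_small(4) unfolding atLeastAtMost_iff by linarith
    then have y0: "0 \<le> y" using c(1) by (simp add: y_def)
    have "c * (2 * sqrt \<epsilon> - s) \<le> (1 / 3) * (2 * r)"
      using s(1) c(1,2) sqrt_small(2) \<open>s \<le> 2 * sqrt \<epsilon>\<close> by (intro mult_mono) auto
    then have y1: "y \<le> r1" using r(1,3) by (simp add: y_def)
    have "(2 * sqrt \<epsilon> - s)\<^sup>2 \<le> 8 * \<epsilon> + 2 * s\<^sup>2"
    proof -
      have "0 \<le> (2 * sqrt \<epsilon> + s)\<^sup>2" by simp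
      moreover have "(sqrt \<epsilon>)\<^sup>2 = \<epsilon>" using \<epsilon>(1) by simp
      moreover have "(2 * sqrt \<epsilon> - s)\<^sup>2 + (2 * sqrt \<epsilon> + s)\<^sup>2 = 8 * (sqrt \<epsilon>)\<^sup>2 + 2 * s\<^sup>2"
        by (simp add: power2_eq_square algebra_simps)
      ultimately show ?thesis by linarith
    qed
    then have "B * c\<^sup>2 * (2 * sqrt \<epsilon> - s)\<^sup>2 \<le> B * c\<^sup>2 * (8 * \<epsilon> + 2 * s\<^sup>2)"
      using B by (intro mult_left_mono) auto
    also have "\<dots> \<le> c / 8 * (8 * \<epsilon> + 2 * s\<^sup>2)" using fence_slope_small \<epsilon>(1) by (intro mult_right_mono) auto
    also have "\<dots> = c * \<epsilon> + c / 4 * s\<^sup>2" by (simp add: algebra_simps)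
    finally have "B * y\<^sup>2 \<le> c * \<epsilon> + c / 4 * s\<^sup>2" by (simp add: y_def power_mult_distrib mult.assoc)
    moreover have "c / 4 * s\<^sup>2 \<le> \<alpha> / 2 * s\<^sup>2" using c \<alpha> by (intro mult_right_mono) auto
    ultimately have "0 < f (x s) s + c * \<epsilon>" using f_lower_near_fold[OF y0 y1 sr] a xs by simp
    then have "- f (x s) s / \<epsilon> < c" using \<epsilon>(1) by (subst pos_divide_less_eq) auto
    then show "- (f (x s) s / \<epsilon>) + 0 < c" by simp
  next
    have "c * (2 * sqrt \<epsilon> + r) \<le> c * (2 * r)" using sqrt_small c by (intro mult_left_mono) auto
    moreover have "0 < c * r" using c r by simp
    ultimately show "xc - c * (- r - 2 * sqrt \<epsilon>) < x (- r)"
      using start_bounds(1) by (simp add: algebra_simps)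
  qed (use t in \<open>auto intro!: derivative_eq_intros\<close>)
  then show ?thesis by (simp add: algebra_simps)
qed

text \<open>
  From \<open>t = sqrt \<epsilon>\<close> on, \<open>\<alpha> t\<^sup>2 / 2\<close> is large enough to push the solution above a rising fence, since
  \<open>c \<epsilon> \<le> c t\<^sup>2\<close>.
\<close>

lemma lower_near_fold_late:
  assumes t: "t \<in> {sqrt \<epsilon>..r}" shows "xc + c * t < x t"
proof -
  have "- r \<le> sqrt \<epsilon>" using sqrt_small r(1) by linarith
  then have sub: "{sqrt \<epsilon>..r} \<subseteq> {-T..T}" by (rule near_fold_subset) simp
  have "xc - (- c * t) < x t"
  proof (rule lower_fence[where p="\<lambda>_. xc" and \<delta>="\<lambda>t. - c * t" and \<delta>'="\<lambda>_. - c" and L=0,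
      OF continuous_on_const constant_lipschitz x_deriv[OF sub]])
    fix s assume s: "s \<in> {sqrt \<epsilon>..r}" "x s = xc - (- c * s)"
    define y where "y = c * s"
    have xs: "x s = xc + y" using s(2) by (simp add: y_def)
    have s0: "0 < s" using s(1) sqrt_small(4) unfolding atLeastAtMost_iff by linarith
    have sr: "\<bar>s\<bar> \<le> r" using s s0 by auto
    have y0: "0 \<le> y" using s0 c by (simp add: y_def)
    have "c * s \<le> 1 * r" using s(1) s0 c by (intro mult_mono) auto
    then have y1: "y \<le> r1" using r(3) by (simp add: y_def)
    have "(sqrt \<epsilon>)\<^sup>2 \<le> s\<^sup>2" using s(1) sqrt_small by (intro power_mono) auto
    then have "c * \<epsilon> \<le> c * s\<^sup>2" using \<epsilon>(1) c by (intro mult_left_mono) auto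
    moreover have "B * y\<^sup>2 \<le> c / 8 * s\<^sup>2"
      using mult_right_mono[OF fence_slope_small, of "s\<^sup>2"] by (simp add: y_def power_mult_distrib mult.assoc)
    moreover have "4 * c * s\<^sup>2 \<le> \<alpha> * s\<^sup>2" using c by (intro mult_right_mono) auto
    moreover have "0 < c * s\<^sup>2" using c s0 by simp
    ultimately have "c * \<epsilon> < f (x s) s" using f_lower_near_fold[OF y0 y1 sr] a xs by simp
    then have "c < f (x s) s / \<epsilon>" using \<epsilon>(1) by (simp add: pos_less_divide_eq)
    then show "- (f (x s) s / \<epsilon>) + 0 < - c" by simp
  next
    have "xc + c * (2 * sqrt \<epsilon> - sqrt \<epsilon>) < x (sqrt \<epsilon>)"
      using lower_near_fold_early[of "sqrt \<epsilon>"] sqrt_small r(1) by auto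
    then show "xc - (- c * sqrt \<epsilon>) < x (sqrt \<epsilon>)" by simp
  qed (use t in \<open>auto intro!: derivative_eq_intros\<close>)
  then show ?thesis by simp
qed

text \<open>
  When the gap is wide compared with \<open>\<epsilon>\<close> it keeps the drift positive on a constant fence of height
  \<open>c sqrt a\<close>.
\<close>

lemma lower_near_fold_gap:
  assumes t: "t \<in> {-r..r}" shows "xc + c * sqrt a < x t"
proof -
  have "xc - (- c * sqrt a) < x t"
  proof (rule lower_fence[where p="\<lambda>_. xc" and \<delta>="\<lambda>_. - c * sqrt a" and \<delta>'="\<lambda>_. 0" and L=0,
      OF continuous_on_const constant_lipschitz x_deriv[OF near_fold_subset[OF order_refl order_refl]]])
    fix s assume s: "s \<in> {-r..r}" "x s = xc - (- c * sqrt a)"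
    define y where "y = c * sqrt a"
    have xs: "x s = xc + y" using s(2) by (simp add: y_def)
    have sr: "\<bar>s\<bar> \<le> r" using s by auto
    have y0: "0 \<le> y" using c a by (simp add: y_def)
    have "c * sqrt a \<le> 1 * r" using sqrt_small c r(1) by (intro mult_mono) auto
    then have y1: "y \<le> r1" using r(3) by (simp add: y_def)
    have "B * y\<^sup>2 \<le> c / 8 * a"
      using mult_right_mono[OF fence_slope_small, of a] a by (simp add: y_def power_mult_distrib mult.assoc)
    also have "\<dots> < a" using c a by simp
    finally have "B * y\<^sup>2 < a" .
    moreover have "0 \<le> \<alpha> / 2 * s\<^sup>2" using \<alpha> by simp
    ultimately have "0 < f (x s) s" using f_lower_near_fold[OF y0 y1 sr] xs by simp
    then show "- (f (x s) s / \<epsilon>) + 0 < 0" using \<epsilon>(1) by simp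
  next
    have "c * sqrt a \<le> c * r" using sqrt_small c r(1) by (intro mult_left_mono) auto
    moreover have "0 < c * r" using c r by simp
    ultimately show "xc - (- c * sqrt a) < x (- r)"
      using start_bounds(1) by simp
  qed (use t in auto)
  then show ?thesis by simp
qed

text \<open>
  Up to a constant factor, a lower bound for the height of the solution above the fold.
\<close>

definition width :: "real \<Rightarrow> real" where "width t = max \<bar>t\<bar> (max (sqrt a) (sqrt \<epsilon>))"

lemma lower_near_fold:
  assumes t: "t \<in> {-r..r}" shows "xc + c * width t < x t"
proof -
  have "xc + c * \<bar>t\<bar> < x t \<and> xc + c * sqrt \<epsilon> < x t"
  proof (cases "t \<le> sqrt \<epsilon>")
    case True
    then have "\<bar>t\<bar> \<le> 2 * sqrt \<epsilon> - t" "sqrt \<epsilon> \<le> 2 * sqrt \<epsilon> - t" using sqrt_small(4) by linarith+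
    then have "c * \<bar>t\<bar> \<le> c * (2 * sqrt \<epsilon> - t)" "c * sqrt \<epsilon> \<le> c * (2 * sqrt \<epsilon> - t)"
      using c by (simp_all add: mult_left_mono)
    then show ?thesis using lower_near_fold_early[of t] True t by auto
  next
    case False
    then have "c * sqrt \<epsilon> \<le> c * t" using c by (simp add: mult_left_mono)
    moreover have "\<bar>t\<bar> = t" using False sqrt_small(4) by linarith
    ultimately show ?thesis using lower_near_fold_late[of t] False t by auto
  qed
  then show ?thesis using lower_near_fold_gap[OF t] by (auto simp: width_def max_def)
qed

text \<open>
  Above the fence \<open>xc + c w\<close> concavity gives \<open>- q c w / 2\<close>; half of it pays for \<open>K t\<^sup>2 \<le> K r w\<close>.
\<close>

lemma dx_beyond_fold:
  assumes t: "t \<in> {-r..r}" and w: "\<bar>t\<bar> \<le> w" and z: "xc + c * w \<le> z" "z \<le> xc + r1"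
  shows "dx f z t \<le> - (q * c / 4 * w)"
proof -
  have w0: "0 \<le> w" using w by simp
  have "0 \<le> c * w" using c w0 by simp
  then have "dx f z t \<le> K * t\<^sup>2 - q / 2 * (z - xc)" using dx_near_fold(1)[of "z - xc" t] z t by auto
  moreover have "q / 2 * (c * w) \<le> q / 2 * (z - xc)" using z q by (intro mult_left_mono) auto
  moreover have "K * t\<^sup>2 \<le> q * c / 4 * w"
  proof -
    have "t\<^sup>2 = \<bar>t\<bar> * \<bar>t\<bar>" by (simp add: power2_eq_square)
    also have "\<dots> \<le> r * w" using t w w0 by (intro mult_mono) auto
    finally have "K * t\<^sup>2 \<le> K * r * w" using K by (simp add: mult.assoc mult_left_mono)
    also have "\<dots> \<le> q * c / 4 * w" using r(7) w0 by (intro mult_right_mono) auto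
    finally show ?thesis .
  qed
  moreover have "q / 2 * (c * w) = 2 * (q * c / 4 * w)" by simp
  ultimately show ?thesis by linarith
qed

text \<open>
  The lower fence near the fold has a small slope, so at time \<open>r / 2\<close> the solution may be far below the
  branch. In the concave window the whole strip between fence and branch is attracting, and a tolerance that shrinks
  linearly from \<open>r1\<close> to \<open>\<delta>\<close> brings the solution to the branch by time \<open>r\<close>.
\<close>

lemma relaxation:
  assumes t: "t \<in> {r / 2..r}"
  shows "\<bar>x t - p t\<bar> < r1 - (r1 - \<delta>) * (t - r / 2) / (r / 2)"
proof -
  define D where "D s = r1 - (r1 - \<delta>) * (s - r / 2) / (r / 2)" for s
  define m where "m = (r1 - \<delta>) / (r / 2)"
  have D: "(D has_real_derivative - m) (at s within {r/2..r})" for s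
  proof -
    have "D = (\<lambda>s. r1 - m * (s - r / 2))" by (simp add: D_def m_def fun_eq_iff)
    then show ?thesis by (auto intro!: derivative_eq_intros)
  qed
  have sub: "{r/2..r} \<subseteq> {-T..T}" using r by (intro near_fold_subset) auto
  have "c1 * r \<le> C1 * r"
    using branch_bounds(1,2)[OF r_half] unfolding abs_minus_cancel abs_of_pos[OF r(1)] by linarith
  then have \<delta>r1: "\<delta> < r1" using \<delta>(2) r(5) r1(1) by simp
  have m: "m \<le> 2 * r1 / r" using \<delta>(1) r(1) by (simp add: m_def divide_right_mono)
  have D\<delta>: "\<delta> \<le> D s" if "s \<in> {r/2..r}" for s
  proof -
    have "(s - r / 2) / (r / 2) \<le> 1" using that r(1) by (simp add: divide_le_eq_1)
    then have "(r1 - \<delta>) * ((s - r / 2) / (r / 2)) \<le> (r1 - \<delta>) * 1" using \<delta>r1 by (intro mult_left_mono) auto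
    then have "(r1 - \<delta>) * ((s - r / 2) / (r / 2)) \<le> r1 - \<delta>" by (simp only: mult_1_right)
    moreover have "D s = r1 - (r1 - \<delta>) * ((s - r / 2) / (r / 2))" by (simp only: D_def times_divide_eq_right)
    ultimately show ?thesis by linarith
  qed
  have I: "r / 2 \<le> \<bar>s\<bar> \<and> \<bar>s\<bar> \<le> T" if "s \<in> {r/2..r}" for s using that r by auto
  have pin: "xc + c * s < p s" "p s < xc + r1" if s: "s \<in> {r/2..r}" for s
  proof -
    have s0: "0 < s" using s r(1) by auto
    have "c * s < c1 * s" using c s0 by (intro mult_strict_right_mono) auto
    moreover have "c1 * \<bar>s\<bar> \<le> p s - xc" by (rule branch_bounds(1)) (use I[OF s] in auto)
    ultimately show "xc + c * s < p s" unfolding abs_of_pos[OF s0] by linarith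
    have "0 < C1" using branch_bounds(1,2)[of s] I[OF s] s0 c1 by (smt (verit) mult_nonneg_nonneg mult_nonpos_nonneg zero_less_mult_iff)
    then have "C1 * s \<le> C1 * r" using s by (intro mult_left_mono) auto
    then show "p s < xc + r1" using branch_bounds(2)[of s] I[OF s] s0 r(5) r1(1) by auto
  qed
  have xin: "xc + c * s < x s" "x s < xc + r1" if s: "s \<in> {r/2..r}" for s
  proof -
    have "c * \<bar>s\<bar> \<le> c * width s" using c by (intro mult_left_mono) (auto simp: width_def)
    then show "xc + c * s < x s" using lower_near_fold[of s] s r(1) by auto
    show "x s < xc + r1" using upper_near_fold[of s] s r(1) by auto
  qed
  have slope: "dx f z s \<le> - (q * c * r / 8)" if s: "s \<in> {r/2..r}" and z: "xc + c * s \<le> z" "z \<le> xc + r1" for s z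
  proof -
    have "dx f z s \<le> - (q * c / 4 * s)" using s z r(1) by (intro dx_beyond_fold) auto
    moreover have "q * c / 4 * (r / 2) \<le> q * c / 4 * s" using s q c by (intro mult_left_mono) auto
    moreover have "q * c / 4 * (r / 2) = q * c * r / 8" by simp
    ultimately show ?thesis by linarith
  qed
  have "4 * B / (c1 * r) + 2 * r1 / r < q * c * r / 8 * \<delta> / \<epsilon>"
    using \<epsilon>(1,3) by (simp only: pos_less_divide_eq mult.commute)
  then have e: "4 * B / (c1 * r) + m < q * c * r / 8 * \<delta> / \<epsilon>" using m by linarith
  have "\<bar>x t - p t\<bar> < D t"
  proof (rule contraction_to_branch[OF sub _ D, where k="q * c * r / 8"])
    fix s assume s: "s \<in> {r/2..r}"
    show "r / 2 \<le> \<bar>s\<bar>" using s by auto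
    show "0 < D s" using D\<delta>[OF s] \<delta>(1) by linarith
    have "q * c * r / 8 * \<delta> / \<epsilon> \<le> q * c * r / 8 * D s / \<epsilon>"
      using D\<delta>[OF s] q c r \<epsilon> by (intro divide_right_mono mult_left_mono) auto
    then show "4 * B / (c1 * r) - (- m) < q * c * r / 8 * D s / \<epsilon>" using e by linarith
    have "0 \<le> c * s" using s c r(1) by simp
    then show "\<bar>x s\<bar> < d'" using strip_near_fold[of "x s - xc"] xin[OF s] by simp
    fix z assume "min (x s) (p s) < z" "z < max (x s) (p s)"
    then show "dx f z s \<le> - (q * c * r / 8)" using pin[OF s] xin[OF s] by (intro slope[OF s]) auto
  next
    have "r / 2 \<in> {r/2..r}" using r(1) by simp
    note pin[OF this] xin[OF this]
    moreover have "0 < c * (r/2)" using c r by simp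
    ultimately show "\<bar>x (r/2) - p (r/2)\<bar> < D (r/2)" by (auto simp: D_def abs_less_iff)
  qed (use t in auto)
  then show ?thesis unfolding D_def .
qed

lemma end_near_fold: "\<bar>x r - p r\<bar> < \<delta>"
  using relaxation[of r] r(1) by simp

lemma stability_along_solution:
  assumes t: "t \<in> {-T..T}"
  shows "\<bar>x t\<bar> < d + \<delta>" "dx f (x t) t \<le> - (min (q * c / 4) (c1 * r / (2 * T)) * width t)"
proof -
  let ?k = "min (q * c / 4) (c1 * r / (2 * T))"
  have w: "0 \<le> width t" by (simp add: width_def)
  have "\<bar>x t\<bar> < d + \<delta> \<and> dx f (x t) t \<le> - (?k * width t)"
  proof (cases "\<bar>t\<bar> \<le> r")
    case True
    then have tr: "t \<in> {-r..r}" by auto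
    note b = lower_near_fold[OF tr] upper_near_fold[OF tr]
    have "0 \<le> c * width t" using c w by simp
    then have "\<bar>x t\<bar> < d + \<delta>" using b r1(1,3) \<delta>(1) by (auto simp: abs_less_iff)
    moreover have "dx f (x t) t \<le> - (q * c / 4 * width t)"
      by (rule dx_beyond_fold[OF tr]) (use b in \<open>auto simp: width_def\<close>)
    moreover have "?k * width t \<le> q * c / 4 * width t"
      using w by (intro mult_right_mono) auto
    ultimately show ?thesis by linarith
  next
    case False
    have "\<bar>x t - p t\<bar> < \<delta>"
    proof (cases "t < 0")
      case True
      then show ?thesis using False t x_init by (intro outer_tracking[of "-T" "-r" t]) (use r(1,4) in auto)
    next
      case nonneg: False
      then show ?thesis using False t end_near_fold r by (intro outer_tracking[of r T t]) auto
    qed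
    then have "\<bar>x t\<bar> < d + \<delta>" and s: "dx f (x t) t \<le> - (c1 * r / 2)"
      using p_d[of t] stable_near_branch(2)[of t "x t"] False t by auto
    have "width t \<le> T" using t sqrt_small r by (auto simp: width_def)
    then have "c1 * r / (2 * T) * width t \<le> c1 * r / (2 * T) * T" using c1 r T by (intro mult_left_mono) auto
    moreover have "c1 * r / (2 * T) * T = c1 * r / 2" using T by simp
    moreover have "?k * width t \<le> c1 * r / (2 * T) * width t"
      using w by (intro mult_right_mono) auto
    ultimately have "dx f (x t) t \<le> - (?k * width t)" using s by linarith
    then show ?thesis using \<open>\<bar>x t\<bar> < d + \<delta>\<close> by simp
  qed
  then show "\<bar>x t\<bar> < d + \<delta>" "dx f (x t) t \<le> - (?k * width t)" by auto
qed

end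

section \<open>Stability along the upper branch of the double well\<close>

lemma bounded_C_mono: "bounded_C k B U g \<Longrightarrow> B \<le> B' \<Longrightarrow> bounded_C k B' U g"
proof (induction k arbitrary: g)
  case 0
  then show ?case by force
next
  case (Suc k)
  from Suc.prems(1) have c: "continuous_on U (\<lambda>(x, t). g x t)" and b: "\<forall>(x, t)\<in>U. \<bar>g x t\<bar> \<le> B"
    unfolding bounded_C.simps by blast+
  from Suc.prems(1) obtain gx gt where
    d: "\<forall>(x, t)\<in>U. ((\<lambda>y. g y t) has_real_derivative gx x t) (at x)"
    "\<forall>(x, t)\<in>U. ((\<lambda>s. g x s) has_real_derivative gt x t) (at t)"
    and k: "bounded_C k B U gx" "bounded_C k B U gt"
    unfolding bounded_C.simps by blast
  have "\<forall>(x, t)\<in>U. \<bar>g x t\<bar> \<le> B'" using b Suc.prems(2) by force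
  then show ?case
    unfolding bounded_C.simps using c d Suc.IH[OF k(1) Suc.prems(2)] Suc.IH[OF k(2) Suc.prems(2)] by blast
qed

lemma ex_pos_below_finite:
  fixes S :: "real set"
  assumes "finite S" "\<forall>b\<in>S. 0 < b"
  shows "\<exists>r>0. \<forall>b\<in>S. r \<le> b"
  using assms by (intro exI[of _ "Min (insert 1 S)"]) auto

lemma ex_pos_below_four:
  fixes A B C D :: real
  assumes "0 < A" "0 < B" "0 < C" "0 < D"
  shows "\<exists>e>0. e \<le> A \<and> e \<le> B \<and> e \<le> C \<and> e \<le> D"
  using assms by (intro exI[of _ "min (min A B) (min C D)"]) auto

lemma times_le_of_le_divide: "(0::real) < b \<Longrightarrow> x \<le> a / b \<Longrightarrow> b * x \<le> a"
  by (simp add: pos_le_divide_eq mult.commute)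

context asymmetric_double_well
begin

lemma fold_expansion:
  obtains xc q K \<alpha> r0 where "\<bar>xc\<bar> < d" "0 < q" "0 \<le> K" "0 < \<alpha>" "0 < r0"
    "branches_near F {0<..amax} T 1 xc 0 xp xz xm"
    "\<forall>a\<in>{0<..amax}. dx (dx (F a)) xc 0 = - q"
    "\<forall>a\<in>{0<..amax}. \<forall>t. \<bar>t\<bar> \<le> r0 \<longrightarrow> \<bar>dx (F a) xc t\<bar> \<le> K * t\<^sup>2 \<and>
      \<bar>F a xc t - (a + \<alpha> * t\<^sup>2)\<bar> \<le> K * \<bar>t\<bar>^3"
proof -
  from bifurcation_at_0 obtain xc where xc: "xc \<in> {-d<..<d}"
    and av: "avoided_bifurcation F {0<..amax} 1 xc 0"
    and br: "branches_near F {0<..amax} T 1 xc 0 xp xz xm" by blast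
  from av obtain q where q: "0 < q" "\<forall>a\<in>{0<..amax}. 1 * dx (dx (F a)) xc 0 = - q"
    unfolding avoided_bifurcation_def by blast
  from av obtain K1 ra where 1: "0 < ra"
    "\<forall>a\<in>{0<..amax}. \<forall>t. \<bar>t - 0\<bar> \<le> ra \<longrightarrow> \<bar>dx (F a) xc t\<bar> \<le> K1 * \<bar>t - 0\<bar>^2"
    unfolding avoided_bifurcation_def by blast
  from av obtain \<alpha> K2 rb where 2: "0 < \<alpha>" "0 < rb"
    "\<forall>a\<in>{0<..amax}. \<forall>t. \<bar>t - 0\<bar> \<le> rb \<longrightarrow> \<bar>1 * F a xc t - (a + \<alpha> * (t - 0)^2)\<bar> \<le> K2 * \<bar>t - 0\<bar>^3"
    unfolding avoided_bifurcation_def by blast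
  define K where "K = max \<bar>K1\<bar> \<bar>K2\<bar>"
  show ?thesis
  proof (rule that[of xc q K \<alpha> "min ra rb"])
    have "\<bar>dx (F a) xc t\<bar> \<le> K * t\<^sup>2 \<and> \<bar>F a xc t - (a + \<alpha> * t\<^sup>2)\<bar> \<le> K * \<bar>t\<bar>^3"
      if a: "a \<in> {0<..amax}" and t: "\<bar>t\<bar> \<le> min ra rb" for a t
    proof -
      have "K1 \<le> K" "K2 \<le> K" by (simp_all add: K_def)
      then have "K1 * t^2 \<le> K * t^2" "K2 * \<bar>t\<bar>^3 \<le> K * \<bar>t\<bar>^3"
        by (simp_all add: mult_right_mono)
      moreover have "\<bar>dx (F a) xc t\<bar> \<le> K1 * t^2" using 1(2) a t by simp
      moreover have "\<bar>F a xc t - (a + \<alpha> * t\<^sup>2)\<bar> \<le> K2 * \<bar>t\<bar>^3" using 2(3) a t by simp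
      ultimately show ?thesis by (intro conjI) linarith+
    qed
    then show "\<forall>a\<in>{0<..amax}. \<forall>t. \<bar>t\<bar> \<le> min ra rb \<longrightarrow> \<bar>dx (F a) xc t\<bar> \<le> K * t\<^sup>2 \<and>
      \<bar>F a xc t - (a + \<alpha> * t\<^sup>2)\<bar> \<le> K * \<bar>t\<bar>^3" by blast
    show "\<bar>xc\<bar> < d" using xc by (simp add: abs_less_iff)
    show "0 \<le> K" by (simp add: K_def)
    show "0 < min ra rb" using 1(1) 2(2) by simp
    show "\<forall>a\<in>{0<..amax}. dx (dx (F a)) xc 0 = - q" using q(2) by (simp only: mult_1)
  qed (fact q(1) 2(1) br)+
qed

lemma upper_branch_growth:
  assumes "branches_near F {0<..amax} T 1 xc 0 xp xz xm"
  obtains c1 C1 where "0 < c1" "0 < C1"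
    "\<forall>a\<in>{0<..amax}. \<forall>t. sqrt a \<le> \<bar>t\<bar> \<longrightarrow> \<bar>t\<bar> \<le> T \<longrightarrow>
      c1 * \<bar>t\<bar> \<le> xp a t - xc \<and> xp a t - xc \<le> C1 * \<bar>t\<bar> \<and> dx (F a) (xp a t) t \<le> - c1 * \<bar>t\<bar>"
proof -
  let ?O = "{(a, t). a \<in> {0<..amax} \<and> sqrt a \<le> \<bar>t - 0\<bar> \<and> \<bar>t - 0\<bar> \<le> T}"
  have "comparable_on ?O (\<lambda>(a, t). 1 * (xp a t - xc)) (\<lambda>(a, t). \<bar>t - 0\<bar>)"
    and "comparable_on ?O (\<lambda>(a, t). - dx (F a) (xp a t) t) (\<lambda>(a, t). \<bar>t - 0\<bar>)"
    using assms unfolding branches_near_def Let_def by blast+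
  then obtain cA cB CA where c: "0 < cA" "0 < cB" "0 < CA"
    and A: "\<forall>i\<in>?O. cA * (case i of (a, t) \<Rightarrow> \<bar>t - 0\<bar>) \<le> (case i of (a, t) \<Rightarrow> 1 * (xp a t - xc))
      \<and> (case i of (a, t) \<Rightarrow> 1 * (xp a t - xc)) \<le> CA * (case i of (a, t) \<Rightarrow> \<bar>t - 0\<bar>)"
    and B: "\<forall>i\<in>?O. cB * (case i of (a, t) \<Rightarrow> \<bar>t - 0\<bar>) \<le> (case i of (a, t) \<Rightarrow> - dx (F a) (xp a t) t)"
    unfolding comparable_on_def by blast
  show ?thesis
  proof (rule that[of "min cA cB" CA])
    have "min cA cB * \<bar>t\<bar> \<le> xp a t - xc \<and> xp a t - xc \<le> CA * \<bar>t\<bar> \<and>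
        dx (F a) (xp a t) t \<le> - min cA cB * \<bar>t\<bar>"
      if h: "a \<in> {0<..amax}" "sqrt a \<le> \<bar>t\<bar>" "\<bar>t\<bar> \<le> T" for a t
    proof -
      from h have i: "(a, t) \<in> ?O" by simp
      have "cA * \<bar>t\<bar> \<le> xp a t - xc" "xp a t - xc \<le> CA * \<bar>t\<bar>" using bspec[OF A i] by simp_all
      moreover have "cB * \<bar>t\<bar> \<le> - dx (F a) (xp a t) t" using bspec[OF B i] by simp
      moreover have "min cA cB * \<bar>t\<bar> \<le> cA * \<bar>t\<bar>" "min cA cB * \<bar>t\<bar> \<le> cB * \<bar>t\<bar>"
        by (intro mult_right_mono; simp)+
      ultimately show ?thesis unfolding mult_minus_left by linarith
    qed
    then show "\<forall>a\<in>{0<..amax}. \<forall>t. sqrt a \<le> \<bar>t\<bar> \<longrightarrow> \<bar>t\<bar> \<le> T \<longrightarrow>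
      min cA cB * \<bar>t\<bar> \<le> xp a t - xc \<and> xp a t - xc \<le> CA * \<bar>t\<bar> \<and>
        dx (F a) (xp a t) t \<le> - min cA cB * \<bar>t\<bar>" by blast
  qed (use c in auto)
qed

text \<open>
  The numbers \<open>a1\<close> and \<open>e1\<close> are thresholds for \<open>a\<close> and \<open>\<epsilon>\<close>.
\<close>

definition tracks_upper_branch :: "real \<Rightarrow> real \<Rightarrow> real \<Rightarrow> real \<Rightarrow> real \<Rightarrow> bool" where
  "tracks_upper_branch D \<kappa> cp a1 e1 \<longleftrightarrow>
    (\<forall>a\<in>{0<..amax}. \<forall>\<epsilon> x. a \<le> a1 \<longrightarrow> 0 < \<epsilon> \<longrightarrow> \<epsilon> \<le> e1 \<longrightarrow>
      \<bar>x (- T) - xp a (- T)\<bar> \<le> cp * \<epsilon> \<longrightarrow>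
      (\<forall>t\<in>{-T..T}. (x has_real_derivative F a (x t) t / \<epsilon>) (at t within {-T..T})) \<longrightarrow>
      (\<forall>t\<in>{-T..T}. \<bar>x t\<bar> < D \<and>
         dx (F a) (x t) t \<le> - (\<kappa> * max \<bar>t\<bar> (max (sqrt a) (sqrt \<epsilon>)))))"

text \<open>
  The geometric constants of \<open>fold_passage\<close> can be chosen for the whole family at once and without reference to
  \<open>cp\<close>; the initial distance \<open>cp \<epsilon>\<close> only has to be smaller than \<open>\<delta>\<close>, which is a condition on the threshold \<open>e1\<close>.
\<close>

lemma uniform_stability:
  "\<exists>d' B \<kappa>. d < d' \<and> 0 < B \<and> 0 < \<kappa> \<and> (\<forall>a\<in>{0<..amax}. smooth_strip (F a) d' B) \<and>
    (\<forall>cp. \<exists>a1>0. \<exists>e1>0. tracks_upper_branch ((d + d') / 2) \<kappa> cp a1 e1)"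
proof -
  from smooth obtain \<eta> B0 where \<eta>: "0 < \<eta>"
    and B0: "\<forall>a\<in>{0<..amax}. bounded_C 3 B0 ({-(d + \<eta>)<..<d + \<eta>} \<times> UNIV) (F a)" by blast
  define d' where "d' = d + \<eta>"
  define B where "B = max B0 1"
  have B: "0 < B" and d': "d < d'" using \<eta> by (auto simp: B_def d'_def)
  have strip: "smooth_strip (F a) d' B" if "a \<in> {0<..amax}" for a
  proof (rule bounded_C_3_smooth_strip[OF bounded_C_mono B])
    show "bounded_C 3 B0 ({-d'<..<d'} \<times> UNIV) (F a)" using B0 that unfolding d'_def by blast
    show "B0 \<le> B" by (simp add: B_def)
  qed
  obtain xc q K \<alpha> r0 where xc: "\<bar>xc\<bar> < d" and q: "0 < q" and K: "0 \<le> K" and \<alpha>: "0 < \<alpha>" and r0: "0 < r0"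
    and br: "branches_near F {0<..amax} T 1 xc 0 xp xz xm"
    and curv: "\<forall>a\<in>{0<..amax}. dx (dx (F a)) xc 0 = - q"
    and expand: "\<forall>a\<in>{0<..amax}. \<forall>t. \<bar>t\<bar> \<le> r0 \<longrightarrow> \<bar>dx (F a) xc t\<bar> \<le> K * t\<^sup>2 \<and>
      \<bar>F a xc t - (a + \<alpha> * t\<^sup>2)\<bar> \<le> K * \<bar>t\<bar>^3"
    by (rule fold_expansion)
  obtain c1 C1 where c1: "0 < c1" and C1: "0 < C1"
    and grow: "\<forall>a\<in>{0<..amax}. \<forall>t. sqrt a \<le> \<bar>t\<bar> \<longrightarrow> \<bar>t\<bar> \<le> T \<longrightarrow>
      c1 * \<bar>t\<bar> \<le> xp a t - xc \<and> xp a t - xc \<le> C1 * \<bar>t\<bar> \<and> dx (F a) (xp a t) t \<le> - c1 * \<bar>t\<bar>"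
    by (rule upper_branch_growth[OF br])
  have "\<exists>r>0. \<forall>b\<in>{q / (4 * B), d - \<bar>xc\<bar>, \<alpha> / (4 * (K + 1))}. r \<le> b"
    using q B xc \<alpha> K by (intro ex_pos_below_finite) auto
  then obtain r1 where r1: "0 < r1" "r1 \<le> q / (4 * B)" "r1 \<le> d - \<bar>xc\<bar>" "r1 \<le> \<alpha> / (4 * (K + 1))" by auto
  have r1': "4 * B * r1 \<le> q" by (rule times_le_of_le_divide[OF _ r1(2)]) (use B in simp)
  have "4 * (K + 1) * r1 \<le> \<alpha>" by (rule times_le_of_le_divide[OF _ r1(4)]) (use K in simp)
  moreover have "4 * K * r1 \<le> 4 * (K + 1) * r1" using r1(1) by (intro mult_right_mono) simp_all
  ultimately have r1'': "4 * K * r1 \<le> \<alpha>" by (rule order_trans[rotated])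
  have "\<exists>r>0. \<forall>b\<in>{1 / 3, 1 / (8 * B), \<alpha> / 4, c1 / 8}. r \<le> b"
    using B \<alpha> c1 by (intro ex_pos_below_finite) auto
  then obtain c where c: "0 < c" "3 * c \<le> 1" "c \<le> 1 / (8 * B)" "4 * c \<le> \<alpha>" "8 * c \<le> c1" by auto
  have c': "8 * B * c \<le> 1" by (rule times_le_of_le_divide[OF _ c(3)]) (use B in simp)
  have "\<exists>r>0. \<forall>b\<in>{1, r0, r1, T, r1 / (2 * C1), q * r1\<^sup>2 / (64 * \<alpha>), q * c / (4 * (K + 1))}. r \<le> b"
    using r0 r1(1) T_pos C1 q \<alpha> c K by (intro ex_pos_below_finite) auto
  then obtain r where r: "0 < r" "r \<le> 1" "r \<le> r0" "r \<le> r1" "r \<le> T" "r \<le> r1 / (2 * C1)"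
    "r \<le> q * r1\<^sup>2 / (64 * \<alpha>)" "r \<le> q * c / (4 * (K + 1))" by auto
  have rC: "2 * C1 * r \<le> r1" by (rule times_le_of_le_divide[OF _ r(6)]) (use C1 in simp)
  have r\<alpha>: "64 * \<alpha> * r\<^sup>2 \<le> q * r1\<^sup>2"
  proof -
    have "r\<^sup>2 \<le> r" using mult_left_mono[OF r(2) less_imp_le[OF r(1)]] by (simp only: power2_eq_square mult_1_right)
    then have "64 * \<alpha> * r\<^sup>2 \<le> 64 * \<alpha> * r" using \<alpha> by (intro mult_left_mono) simp_all
    also have "\<dots> \<le> q * r1\<^sup>2" by (rule times_le_of_le_divide[OF _ r(7)]) (use \<alpha> in simp)
    finally show ?thesis .
  qed
  have "4 * (K + 1) * r \<le> q * c" by (rule times_le_of_le_divide[OF _ r(8)]) (use K in simp)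
  moreover have "4 * K * r \<le> 4 * (K + 1) * r" using r(1) by (intro mult_right_mono) simp_all
  ultimately have rK: "4 * K * r \<le> q * c" by (rule order_trans[rotated])
  have "\<exists>x>0. \<forall>b\<in>{c1 * r / 4, c1 * r / (2 * B), (d' - d) / 2}. x \<le> b"
    using c1 r B d' by (intro ex_pos_below_finite) auto
  then obtain \<delta> where \<delta>: "0 < \<delta>" "4 * \<delta> \<le> c1 * r" "\<delta> \<le> c1 * r / (2 * B)" "2 * \<delta> \<le> d' - d" by auto
  have \<delta>': "2 * B * \<delta> \<le> c1 * r" by (rule times_le_of_le_divide[OF _ \<delta>(3)]) (use B in simp)
  define L where "L = 4 * B / (c1 * r)"
  have L: "0 < L" using B c1 r by (simp add: L_def)
  define \<kappa> where "\<kappa> = min (q * c / 4) (c1 * r / (2 * T))"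
  have \<kappa>: "0 < \<kappa>" using q c c1 r T_pos by (simp add: \<kappa>_def)
  have main: "\<exists>a1>0. \<exists>e1>0. tracks_upper_branch ((d + d') / 2) \<kappa> cp a1 e1" for cp
  proof -
    have X1: "0 < L + 2 * r1 / r" using L r1(1) r(1) by (intro add_pos_pos) simp_all
    have Y1: "0 < q * c * r / 8 * \<delta>" using q c(1) r(1) \<delta>(1) by simp
    have Y2: "0 < c1 * r / 2 * \<delta>" using c1 r(1) \<delta>(1) by simp
    have P: "0 < r\<^sup>2 / 4" "0 < (q * c * r / 8 * \<delta>) / (2 * (L + 2 * r1 / r))"
        "0 < (c1 * r / 2 * \<delta>) / (2 * L)" "0 < \<delta> / (2 * (\<bar>cp\<bar> + 1))"
      by (intro divide_pos_pos Y1 Y2 mult_pos_pos X1 L \<delta>(1) zero_less_numeral zero_less_power r(1)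
          add_nonneg_pos abs_ge_zero zero_less_one)+
    obtain e1 where e1: "0 < e1" "e1 \<le> r\<^sup>2 / 4" "e1 \<le> (q * c * r / 8 * \<delta>) / (2 * (L + 2 * r1 / r))"
      "e1 \<le> (c1 * r / 2 * \<delta>) / (2 * L)" "e1 \<le> \<delta> / (2 * (\<bar>cp\<bar> + 1))"
      using ex_pos_below_four[OF P] by blast
    have half: "\<epsilon> * X < Y" if "0 < X" "0 < Y" "\<epsilon> \<le> e1" "e1 \<le> Y / (2 * X)" for X Y \<epsilon> :: real
    proof -
      have "\<epsilon> \<le> Y / (2 * X)" using that by simp
      then have "\<epsilon> * (2 * X) \<le> Y" using that(1) by (simp add: pos_le_divide_eq)
      then show ?thesis using that(2) by simp
    qed
    define a1 where "a1 = min (r\<^sup>2 / 4) (q * r1\<^sup>2 / 32)"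
    have a1: "0 < a1" using r q r1 by (simp add: a1_def)
    have key: "\<bar>x t\<bar> < (d + d') / 2 \<and> dx (F a) (x t) t \<le> - (\<kappa> * max \<bar>t\<bar> (max (sqrt a) (sqrt \<epsilon>)))"
      if a: "a \<in> {0<..amax}" "a \<le> a1" and \<epsilon>: "0 < \<epsilon>" "\<epsilon> \<le> e1" and init: "\<bar>x (- T) - xp a (- T)\<bar> \<le> cp * \<epsilon>"
        and ode: "\<forall>t\<in>{-T..T}. (x has_real_derivative F a (x t) t / \<epsilon>) (at t within {-T..T})"
        and t: "t \<in> {-T..T}" for a \<epsilon> x t
    proof -
      interpret smooth_strip "F a" d' B by (rule strip[OF a(1)])
      have xpd: "\<bar>xp a t\<bar> \<le> d" for t
      proof -
        have "-d \<le> xm a t \<and> xm a t < xz a t \<and> xz a t < xp a t \<and> xp a t \<le> d"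
          using branches_ordered a(1) by blast
        then show ?thesis by linarith
      qed
      have "cp * \<epsilon> \<le> (\<bar>cp\<bar> + 1) * \<epsilon>" using \<epsilon>(1) by (intro mult_right_mono) auto
      also have "\<dots> = \<epsilon> * (\<bar>cp\<bar> + 1)" by (rule mult.commute)
      also have "\<dots> < \<delta>" by (rule half[OF _ \<delta>(1) \<epsilon>(2) e1(5)]) simp
      finally have init': "\<bar>x (- T) - xp a (- T)\<bar> < \<delta>" using init by linarith
      have small: "0 < a" "4 * a \<le> r\<^sup>2" "32 * a \<le> q * r1\<^sup>2" "4 * \<epsilon> \<le> r\<^sup>2" "\<bar>xc\<bar> + r1 \<le> d"
        using a \<epsilon>(2) e1(2) r1(3) unfolding a1_def greaterThanAtMost_iff min.bounded_iff
        by linarith+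
      interpret fold_passage "F a" d' B xc d q K \<alpha> r0 c1 C1 T a \<epsilon> r1 r c \<delta> "xp a" x
      proof
        show "\<epsilon> * (4 * B / (c1 * r) + 2 * r1 / r) < q * c * r / 8 * \<delta>"
          unfolding L_def[symmetric] by (rule half[OF X1 Y1 \<epsilon>(2) e1(3)])
        show "\<epsilon> * (4 * B / (c1 * r)) < c1 * r / 2 * \<delta>"
          unfolding L_def[symmetric] by (rule half[OF L Y2 \<epsilon>(2) e1(4)])
        show "continuous_on UNIV (xp a)" using branches_continuous a(1) by blast
        fix t :: real
        have "xp a t \<in> {-d..d}" using xpd[of t] by (simp add: abs_le_iff)
        then show "F a (xp a t) t = 0" using zeros a(1) by blast
        show "\<bar>xp a t\<bar> \<le> d" by (rule xpd)
        show "\<bar>t\<bar> \<le> r0 \<Longrightarrow> \<bar>dx (F a) xc t\<bar> \<le> K * t\<^sup>2" using expand a(1) by blast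
        show "\<bar>t\<bar> \<le> r0 \<Longrightarrow> \<bar>F a xc t - (a + \<alpha> * t\<^sup>2)\<bar> \<le> K * \<bar>t\<bar>^3" using expand a(1) by blast
        show "sqrt a \<le> \<bar>t\<bar> \<Longrightarrow> \<bar>t\<bar> \<le> T \<Longrightarrow> c1 * \<bar>t\<bar> \<le> xp a t - xc \<and> xp a t - xc \<le> C1 * \<bar>t\<bar> \<and>
          dx (F a) (xp a t) t \<le> - c1 * \<bar>t\<bar>" using grow a(1) by blast
        show "t \<in> {-T..T} \<Longrightarrow> (x has_real_derivative F a (x t) t / \<epsilon>) (at t within {-T..T})" using ode by blast
        show "dx (dx (F a)) xc 0 = - q" using curv a(1) by blast
      qed (fact d' q K \<alpha> T_pos c1 r1 r1' r1'' c c' r rC r\<alpha> rK \<delta> \<delta>' init' \<epsilon> small)+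
      have "\<bar>x t\<bar> < d + \<delta>" by (rule stability_along_solution(1)[OF t])
      moreover have "d + \<delta> \<le> (d + d') / 2" using \<delta>(4) by (simp add: field_simps)
      ultimately show ?thesis
        using stability_along_solution(2)[OF t] unfolding \<kappa>_def width_def by linarith
    qed
    show ?thesis
      by (rule exI[of _ a1], rule conjI[OF a1], rule exI[of _ e1], rule conjI[OF e1(1)],
          unfold tracks_upper_branch_def, intro ballI allI impI, rule key)
  qed
  show ?thesis
    by (rule exI[of _ d'], rule exI[of _ B], rule exI[of _ \<kappa>], intro conjI d' B \<kappa> ballI allI strip main)
qed

end

section \<open>Leaving the tube around the deterministic solution\<close>

lemma exit_time_first_contact:
  fixes y Y :: "real \<Rightarrow> real"
  assumes exit: "exit_time {(v, s). \<bar>s\<bar> \<le> T \<and> \<bar>v - x s\<bar> < h * r s} (- T) T X < ereal t" and t: "t \<le> T"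
    and X: "continuous_on {-T..T} X" and x: "continuous_on {-T..T} x" and r: "continuous_on {-T..t} r"
    and init: "X (- T) = x (- T)" "0 < h * r (- T)"
  shows "\<exists>\<tau>\<in>{-T..t}. \<bar>X \<tau> - x \<tau>\<bar> = h * r \<tau> \<and> (\<forall>s\<in>{-T..\<tau>}. \<bar>X s - x s\<bar> \<le> h * r s)"
proof -
  obtain s where s: "s \<in> {-T..T}" "(X s, s) \<notin> {(v, s). \<bar>s\<bar> \<le> T \<and> \<bar>v - x s\<bar> < h * r s}" "s < t"
    using exit unfolding exit_time_def Inf_less_iff by auto
  have out: "h * r s \<le> \<bar>X s - x s\<bar>" using s(1,2) by (auto simp: abs_le_iff)
  let ?u = "\<lambda>s. h * r s - \<bar>X s - x s\<bar>"
  have "continuous_on {-T..s} ?u"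
    by (intro continuous_intros continuous_on_subset[OF X] continuous_on_subset[OF x] continuous_on_subset[OF r])
      (use s t in auto)
  moreover have "0 < ?u (- T)" using init by simp
  moreover have "- T \<le> s" "?u s \<le> 0" using s(1) out by auto
  ultimately obtain z where z: "- T < z" "z \<le> s" "?u z = 0" "\<forall>v. - T \<le> v \<longrightarrow> v < z \<longrightarrow> 0 < ?u v"
    using first_zero[of "- T" s ?u] by blast
  have "\<bar>X v - x v\<bar> \<le> h * r v" if "v \<in> {-T..z}" for v
    using z(3) z(4)[rule_format, of v] that by (cases "v = z") auto
  then show ?thesis using z s(3) by (intro bexI[of _ z]) auto
qed

text \<open>
  The rate \<open>\<kappa> \<bar>s\<bar>\<close> degenerates at \<open>s = 0\<close>, but \<open>s \<le> - T / 2\<close> alone makes the integral comparable to the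
  elapsed time. Hence pieces of equal length in time are as good as pieces of equal \<open>\<alpha>\<close>.
\<close>

lemma integral_stability_rate_ge:
  fixes \<kappa> T t :: real
  assumes a: "continuous_on {-T..t} a" and neg: "\<And>s. s \<in> {-T..t} \<Longrightarrow> a s \<le> - (\<kappa> * \<bar>s\<bar>)"
    and \<kappa>: "0 < \<kappa>" and t: "- T < t" "t \<le> T"
  shows "\<kappa> * T / 8 * (t + T) \<le> \<bar>integral {-T..t} a\<bar>"
proof -
  define u where "u = min t (- T / 2)"
  have u: "- T \<le> u" "u \<le> t" "u \<le> - T / 2" using t by (auto simp: u_def)
  have int: "a integrable_on {v..w}" if "- T \<le> v" "w \<le> t" for v w
    by (intro integrable_continuous_interval continuous_on_subset[OF a]) (use that in auto)
  have "integral {-T..u} a \<le> integral {-T..u} (\<lambda>_. - (\<kappa> * (T / 2)))"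
  proof (intro integral_le int integrable_const_ivl)
    fix s assume s: "s \<in> {-T..u}"
    then have "\<kappa> * (T / 2) \<le> \<kappa> * \<bar>s\<bar>" using u \<kappa> by (intro mult_left_mono) auto
    then show "a s \<le> - (\<kappa> * (T / 2))" using neg[of s] s u by auto
  qed (use u in auto)
  also have "\<dots> = - (\<kappa> * T / 2 * (u + T))" using u by simp
  finally have "integral {-T..u} a \<le> - (\<kappa> * T / 2 * (u + T))" .
  moreover have "integral {u..t} a \<le> integral {u..t} (\<lambda>_. 0)"
  proof (intro integral_le int integrable_const_ivl)
    fix s assume s: "s \<in> {u..t}"
    have "0 \<le> \<kappa> * \<bar>s\<bar>" using \<kappa> by simp
    then show "a s \<le> 0" using neg[of s] s u by auto
  qed (use u in auto)
  moreover have "integral {-T..u} a + integral {u..t} a = integral {-T..t} a"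
    by (rule Henstock_Kurzweil_Integration.integral_combine) (use u int in auto)
  ultimately have "\<kappa> * T / 2 * (u + T) \<le> \<bar>integral {-T..t} a\<bar>" by simp
  moreover have "\<kappa> * T / 2 * ((t + T) / 4) \<le> \<kappa> * T / 2 * (u + T)"
    using \<kappa> t by (intro mult_left_mono) (auto simp: u_def min_def)
  moreover have "\<kappa> * T / 2 * ((t + T) / 4) = \<kappa> * T / 8 * (t + T)" by simp
  ultimately show ?thesis by linarith
qed

text \<open>
  Two lower bounds on the contraction rate are kept apart. The uniform one with \<open>\<phi>\<close> controls \<open>\<zeta>\<close>; the one
  proportional to \<open>\<bar>s\<bar>\<close> controls \<open>\<alpha>(t, -T)\<close> with a constant that does not degenerate as \<open>\<phi>\<close> tends to 0.
\<close>

locale linearised_tube = smooth_strip f d' B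
  for f :: "real \<Rightarrow> real \<Rightarrow> real" and d' B :: real +
  fixes x :: "real \<Rightarrow> real" and \<epsilon> T x0 D \<kappa> \<phi> t :: real
  assumes T: "0 < T" and \<epsilon>: "0 < \<epsilon>" and t: "- T < t" "t \<le> T"
    and ode: "ode_solution (\<lambda>x t. f x t / \<epsilon>) (- T) T x0 x"
    and inside: "s \<in> {-T..T} \<Longrightarrow> \<bar>x s\<bar> \<le> D" "D < d'"
    and stable: "s \<in> {-T..t} \<Longrightarrow> a_bar f x s \<le> - (\<kappa> * \<bar>s\<bar>)" "s \<in> {-T..t} \<Longrightarrow> a_bar f x s \<le> - (\<kappa> * \<phi>)"
    and pos: "0 < \<kappa>" "0 < \<phi>"
begin

definition \<alpha> :: "real \<Rightarrow> real" where "\<alpha> s = alpha_bar f x s (- T)"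
definition g :: "real \<Rightarrow> real" where "g s = exp (- \<alpha> s / \<epsilon>)"
text \<open>
  The rescaled variance \<open>g\<^sup>2 \<zeta>\<close> (see \<open>zeta_rescaled\<close>).
\<close>

definition Z :: "real \<Rightarrow> real" where
  "Z s = 1 / (2 * \<bar>a_bar f x (- T)\<bar>) + integral {-T..s} (\<lambda>u. (g u)\<^sup>2) / \<epsilon>"

lemma x_deriv: "s \<in> {-T..T} \<Longrightarrow> (x has_real_derivative f (x s) s / \<epsilon>) (at s within {-T..T})"
  and x_init: "x (- T) = x0"
  using ode by (auto simp: ode_solution_def)

lemma x_cont: "continuous_on {-T..T} x"
  by (rule DERIV_continuous_on[OF x_deriv])

lemma continuous_along:
  assumes h: "continuous_on ({-d'<..<d'} \<times> UNIV) (\<lambda>(v, s). h v s)"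
    and y: "continuous_on S y" "\<And>s. s \<in> S \<Longrightarrow> \<bar>y s\<bar> < d'"
  shows "continuous_on S (\<lambda>s. h (y s) s)"
proof -
  have "y s \<in> {-d'<..<d'}" if "s \<in> S" for s
    using y(2)[OF that] unfolding greaterThanLessThan_iff by linarith
  then have "continuous_on S ((\<lambda>(v, s). h v s) \<circ> (\<lambda>s. (y s, s)))"
    by (intro continuous_on_compose continuous_intros y(1) continuous_on_subset[OF h]) auto
  then show ?thesis by (simp add: comp_def)
qed

lemma x_strip: "s \<in> {-T..T} \<Longrightarrow> \<bar>x s\<bar> < d'"
  using inside by (meson le_less_trans)

lemma a_cont: "continuous_on {-T..T} (a_bar f x)"
  using continuous_along[OF cont_dx x_cont x_strip] by (simp add: a_bar_def[abs_def])

lemma a_bound: "s \<in> {-T..T} \<Longrightarrow> \<bar>a_bar f x s\<bar> \<le> B"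
  unfolding a_bar_def by (rule dx_bound[OF x_strip])

lemma g_deriv: "s \<in> {-T..T} \<Longrightarrow> (g has_real_derivative - (a_bar f x s / \<epsilon>) * g s) (at s within {-T..T})"
  unfolding g_def[abs_def] \<alpha>_def alpha_bar_def using \<epsilon>
  by (auto intro!: derivative_eq_intros integral_has_real_derivative[OF a_cont])

lemma g_pos: "0 < g s" by (simp add: g_def)

lemma g_init: "g (- T) = 1" by (simp add: g_def \<alpha>_def alpha_bar_def)

lemma g_cont: "continuous_on {-T..T} g"
  by (rule DERIV_continuous_on[OF g_deriv])

lemma Z_deriv: "s \<in> {-T..T} \<Longrightarrow> (Z has_real_derivative (g s)\<^sup>2 / \<epsilon>) (at s within {-T..T})"
  unfolding Z_def[abs_def] using \<epsilon>
  by (auto intro!: derivative_eq_intros integral_has_real_derivative[of "-T" T] continuous_intros g_cont)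

lemma a_init: "a_bar f x (- T) < 0" "1 / (2 * \<bar>a_bar f x (- T)\<bar>) \<le> 1 / (2 * (\<kappa> * \<phi>))"
  "1 / (2 * B) \<le> 1 / (2 * \<bar>a_bar f x (- T)\<bar>)" "0 < 1 / (2 * \<bar>a_bar f x (- T)\<bar>)"
proof -
  have m: "0 < \<kappa> * \<phi>" using pos by simp
  have s: "a_bar f x (- T) \<le> - (\<kappa> * \<phi>)" using t by (intro stable) auto
  show n: "a_bar f x (- T) < 0" using s m by linarith
  then show "0 < 1 / (2 * \<bar>a_bar f x (- T)\<bar>)" by simp
  show "1 / (2 * \<bar>a_bar f x (- T)\<bar>) \<le> 1 / (2 * (\<kappa> * \<phi>))"
  proof (rule divide_left_mono)
    show "0 < 2 * \<bar>a_bar f x (- T)\<bar> * (2 * (\<kappa> * \<phi>))" by (intro mult_pos_pos zero_less_numeral pos) (use n in simp)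
  qed (use s in auto)
  show "1 / (2 * B) \<le> 1 / (2 * \<bar>a_bar f x (- T)\<bar>)"
  proof (rule divide_left_mono)
    show "0 < 2 * B * (2 * \<bar>a_bar f x (- T)\<bar>)"
      by (intro mult_pos_pos zero_less_numeral B) (use n in simp)
  qed (use a_bound[of "- T"] T in auto)
qed

lemma Z_pos: "s \<in> {-T..T} \<Longrightarrow> 0 < Z s"
proof -
  assume s: "s \<in> {-T..T}"
  have "0 \<le> integral {-T..s} (\<lambda>u. (g u)\<^sup>2)"
    by (intro integral_nonneg integrable_continuous_interval continuous_intros continuous_on_subset[OF g_cont])
      (use s in auto)
  then show ?thesis unfolding Z_def using a_init(4) \<epsilon> by (intro add_pos_nonneg) auto
qed

text \<open>
  Each exponential in \<open>zeta\<close> factors as \<open>g(u)\<^sup>2 / g(s)\<^sup>2\<close> because \<open>\<alpha>(s, u) = \<alpha>(s, -T) - \<alpha>(u, -T)\<close>.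
\<close>

lemma zeta_rescaled: "s \<in> {-T..T} \<Longrightarrow> (g s)\<^sup>2 * zeta f x \<epsilon> T s = Z s"
proof -
  assume s: "s \<in> {-T..T}"
  have ai: "a_bar f x integrable_on {-T..s}"
    by (intro integrable_continuous_interval continuous_on_subset[OF a_cont]) (use s in auto)
  have "alpha_bar f x s u = \<alpha> s - \<alpha> u" if "u \<in> {-T..s}" for u
    using Henstock_Kurzweil_Integration.integral_combine[of "- T" u s "a_bar f x"] that ai
    by (simp add: alpha_bar_def \<alpha>_def)
  moreover have "2 * (\<alpha> s - \<alpha> u) / \<epsilon> = 2 * (- \<alpha> u / \<epsilon>) - 2 * (- \<alpha> s / \<epsilon>)" for u
    by (simp add: diff_divide_distrib algebra_simps)
  ultimately have "exp (2 * alpha_bar f x s u / \<epsilon>) = (g u)\<^sup>2 / (g s)\<^sup>2" if "u \<in> {-T..s}" for u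
    using that by (simp only: g_def exp_diff exp_double)
  then have "integral {-T..s} (\<lambda>u. exp (2 * alpha_bar f x s u / \<epsilon>)) = integral {-T..s} (\<lambda>u. (g u)\<^sup>2 / (g s)\<^sup>2)"
    by (rule integral_cong)
  also have "\<dots> = integral {-T..s} (\<lambda>u. (g u)\<^sup>2) / (g s)\<^sup>2" by (rule integral_divide)
  finally have i: "integral {-T..s} (\<lambda>u. exp (2 * alpha_bar f x s u / \<epsilon>)) = integral {-T..s} (\<lambda>u. (g u)\<^sup>2) / (g s)\<^sup>2" .
  have e: "exp (2 * alpha_bar f x s (- T) / \<epsilon>) = 1 / (g s)\<^sup>2"
    by (simp add: g_def \<alpha>_def exp_double[symmetric] exp_minus field_simps)
  show ?thesis
    unfolding zeta_def i e Z_def using g_pos[of s] by (simp add: field_simps)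
qed


text \<open>
  The uniform bound on \<open>zeta\<close>.
\<close>

definition m :: real where "m = 1 / (2 * (\<kappa> * \<phi>))"

lemma sub_t: "{-T..t} \<subseteq> {-T..T}" using t by auto

lemma g_deriv_t: "s \<in> {-T..t} \<Longrightarrow> (g has_real_derivative - (a_bar f x s / \<epsilon>) * g s) (at s within {-T..t})"
  using sub_t by (blast intro: DERIV_subset[OF g_deriv])

lemma Z_deriv_t: "s \<in> {-T..t} \<Longrightarrow> (Z has_real_derivative (g s)\<^sup>2 / \<epsilon>) (at s within {-T..t})"
  using sub_t by (blast intro: DERIV_subset[OF Z_deriv])

lemma Z_le: "s \<in> {-T..t} \<Longrightarrow> Z s \<le> m * (g s)\<^sup>2"
proof -
  assume s: "s \<in> {-T..t}"
  have "Z s \<le> (g s)\<^sup>2 / (2 * (\<kappa> * \<phi>))"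
  proof (rule rescaled_variance_le[OF \<epsilon> g_deriv_t g_pos Z_deriv_t Z_pos stable(2) _ _ s])
    show "0 < \<kappa> * \<phi>" using pos by simp
    show "Z (- T) \<le> (g (- T))\<^sup>2 / (2 * (\<kappa> * \<phi>))" using a_init(2) by (simp add: Z_def g_init)
  qed (use sub_t in auto)
  then show ?thesis by (simp add: m_def)
qed

lemma Z_ge: "s \<in> {-T..t} \<Longrightarrow> (g s)\<^sup>2 / (2 * B) \<le> Z s"
proof -
  assume s: "s \<in> {-T..t}"
  show ?thesis
  proof (rule rescaled_variance_ge[OF \<epsilon> g_deriv_t g_pos Z_deriv_t Z_pos a_bound B _ s])
    show "(g (- T))\<^sup>2 / (2 * B) \<le> Z (- T)" using a_init(3) by (simp add: Z_def g_init)
  qed (use sub_t in auto)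
qed

lemma sqrt_zeta: "s \<in> {-T..T} \<Longrightarrow> g s * sqrt (zeta f x \<epsilon> T s) = sqrt (Z s)"
  using zeta_rescaled[of s, symmetric] g_pos[of s] by (simp add: real_sqrt_mult)

lemma zeta_le: "s \<in> {-T..t} \<Longrightarrow> zeta f x \<epsilon> T s \<le> m"
proof -
  assume s: "s \<in> {-T..t}"
  have "(g s)\<^sup>2 * zeta f x \<epsilon> T s \<le> (g s)\<^sup>2 * m"
    using Z_le[OF s] zeta_rescaled[of s] s sub_t by (simp add: mult.commute subset_iff)
  then show ?thesis using g_pos[of s] by (simp add: mult_le_cancel_left_pos)
qed

lemma zeta_cont: "continuous_on {-T..T} (zeta f x \<epsilon> T)"
proof -
  have "continuous_on {-T..T} (\<lambda>s. Z s / (g s)\<^sup>2)"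
    using g_pos by (intro continuous_intros g_cont DERIV_continuous_on[OF Z_deriv]) (auto simp: less_le)
  then show ?thesis
  proof (rule continuous_on_eq)
    fix s assume "s \<in> {-T..T}"
    from zeta_rescaled[OF this] show "Z s / (g s)\<^sup>2 = zeta f x \<epsilon> T s"
      using g_pos[of s] by (simp add: field_simps)
  qed
qed

text \<open>
  The condition \<open>D + h sqrt m < d'\<close> keeps the random path inside the strip up to the exit time. Inside
  the strip the Taylor remainder of \<open>f\<close> is quadratic.
\<close>

lemma exit_forces_noise:
  assumes h: "0 < h" "D + h * sqrt m < d'"
    and X: "continuous_on {-T..T} X" and w: "continuous_on {-T..T} w"
    and eq: "\<And>s. s \<in> {-T..T} \<Longrightarrow> X s = x0 + integral {-T..s} (\<lambda>v. f (X v) v / \<epsilon>) + c * (w s - w (- T))"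
    and exit: "exit_time (tube f x \<epsilon> T h) (- T) T X < ereal t"
  shows "\<exists>\<tau>\<in>{-T..t}. h * (1 - 2 * B * h * (m * sqrt m)) * sqrt (Z \<tau>)
    \<le> \<bar>c * wiener_integral (- T) g (\<lambda>v. - (a_bar f x v / \<epsilon>) * g v) w \<tau>\<bar>"
proof -
  let ?r = "\<lambda>s. sqrt (zeta f x \<epsilon> T s)"
  have mT: "- T \<in> {-T..T}" using T by simp
  have "X (- T) = x (- T)" using eq[OF mT] x_init by simp
  moreover have "0 < h * ?r (- T)"
    using sqrt_zeta[OF mT] Z_pos[OF mT] g_init h(1) by simp
  moreover have "continuous_on {-T..t} ?r"
    by (intro continuous_intros continuous_on_subset[OF zeta_cont sub_t])
  ultimately have "\<exists>\<tau>\<in>{-T..t}. \<bar>X \<tau> - x \<tau>\<bar> = h * ?r \<tau> \<and> (\<forall>s\<in>{-T..\<tau>}. \<bar>X s - x s\<bar> \<le> h * ?r s)"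
    using exit_time_first_contact[OF exit[unfolded tube_def] t(2) X x_cont] by blast
  then obtain \<tau> where \<tau>: "\<tau> \<in> {-T..t}" "\<bar>X \<tau> - x \<tau>\<bar> = h * ?r \<tau>"
    and before: "\<And>s. s \<in> {-T..\<tau>} \<Longrightarrow> \<bar>X s - x s\<bar> \<le> h * ?r s"
    by blast
  have sub: "{-T..\<tau>} \<subseteq> {-T..T}" "{-T..\<tau>} \<subseteq> {-T..t}" using \<tau>(1) t by auto
  have X\<tau>: "continuous_on {-T..\<tau>} X" and x\<tau>: "continuous_on {-T..\<tau>} x" and w\<tau>: "continuous_on {-T..\<tau>} w"
    using X x_cont w sub(1) by (auto intro: continuous_on_subset)
  have Xd: "\<bar>X s\<bar> < d'" if s: "s \<in> {-T..\<tau>}" for s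
  proof -
    have "h * ?r s \<le> h * sqrt m" using zeta_le[of s] s sub h(1) by (auto intro!: mult_left_mono)
    moreover have "\<bar>x s\<bar> \<le> D" using inside(1) s sub by blast
    ultimately show ?thesis using before[OF s] h(2) by linarith
  qed
  have xd: "\<bar>x s\<bar> < d'" if "s \<in> {-T..\<tau>}" for s using x_strip that sub(1) by blast
  have fX: "continuous_on {-T..\<tau>} (\<lambda>s. f (X s) s)" by (rule continuous_along[OF cont X\<tau> Xd])
  have fx: "continuous_on {-T..\<tau>} (\<lambda>s. f (x s) s)" by (rule continuous_along[OF cont x\<tau> xd])
  have a\<tau>: "continuous_on {-T..\<tau>} (a_bar f x)" by (rule continuous_on_subset[OF a_cont sub(1)])
  define y where "y s = X s - x s" for s
  define b where "b s = f (X s) s - f (x s) s - a_bar f x s * y s" for s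
  have y_cont: "continuous_on {-T..\<tau>} y" unfolding y_def by (intro continuous_intros X\<tau> x\<tau>)
  have b_cont: "continuous_on {-T..\<tau>} b" unfolding b_def by (intro continuous_intros fX fx a\<tau> y_cont)
  have y_eq: "y s = integral {-T..s} (\<lambda>v. (a_bar f x v * y v + b v) / \<epsilon>) + c * (w s - w (- T))"
    if s: "s \<in> {-T..\<tau>}" for s
  proof -
    have sT: "s \<in> {-T..T}" and ss: "{-T..s} \<subseteq> {-T..\<tau>}" using s sub(1) by auto
    have "((\<lambda>v. f (x v) v / \<epsilon>) has_integral (x s - x (- T))) {-T..s}"
      by (rule has_integral_derivative_subinterval[OF x_deriv]) (use sT in auto)
    from integral_unique[OF this] have ix: "integral {-T..s} (\<lambda>v. f (x v) v / \<epsilon>) = x s - x0"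
      by (simp only: x_init)
    have "integral {-T..s} (\<lambda>v. (a_bar f x v * y v + b v) / \<epsilon>)
        = integral {-T..s} (\<lambda>v. f (X v) v / \<epsilon> - f (x v) v / \<epsilon>)"
      by (simp add: b_def diff_divide_distrib)
    also have "\<dots> = integral {-T..s} (\<lambda>v. f (X v) v / \<epsilon>) - integral {-T..s} (\<lambda>v. f (x v) v / \<epsilon>)"
      using \<epsilon> by (intro Henstock_Kurzweil_Integration.integral_diff integrable_continuous_interval
          continuous_intros continuous_on_subset[OF fX ss] continuous_on_subset[OF fx ss]) auto
    finally show ?thesis using eq[OF sT] ix by (simp add: y_def)
  qed
  have quad: "\<bar>b v\<bar> \<le> B * (y v)\<^sup>2" if "v \<in> {-T..\<tau>}" for v
    unfolding b_def y_def a_bar_def by (rule taylor_remainder[OF xd[OF that] Xd[OF that]])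
  have gy: "g v * (h * ?r v) = h * sqrt (Z v)" if "v \<in> {-T..\<tau>}" for v
    using sqrt_zeta[of v] that sub(1) by (metis mult.left_commute subsetD)
  have tube: "g v * \<bar>y v\<bar> \<le> h * sqrt (Z v)" if "v \<in> {-T..\<tau>}" for v
    using mult_left_mono[OF before[OF that] less_imp_le[OF g_pos[of v]]] unfolding gy[OF that] y_def .
  have out: "h * sqrt (Z \<tau>) \<le> g \<tau> * \<bar>y \<tau>\<bar>"
    unfolding y_def \<tau>(2) by (rule eq_refl[OF gy[symmetric]]) (use \<tau>(1) in simp)
  have "h * (1 - 2 * B * h * (m * sqrt m)) * sqrt (Z \<tau>)
    \<le> \<bar>c * wiener_integral (- T) g (\<lambda>v. - (a_bar f x v / \<epsilon>) * g v) w \<tau>\<bar>"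
    by (rule exit_forces_large_wiener_integral[OF \<epsilon> g_deriv_t g_pos Z_deriv_t Z_pos \<tau>(1) a\<tau> y_cont b_cont w\<tau>
          y_eq quad less_imp_le[OF B] Z_le tube out]) (use sub_t in auto)
  then show ?thesis using \<tau>(1) by blast
qed

text \<open>
  The exit event is covered by the event of \<open>wiener_integral_tube\<close> and the null set on which the integral
  equation fails. The factor \<open>\<theta> < 1\<close> is the room needed by the maximal inequality.
\<close>

lemma tube_exit_probability:
  assumes sde: "sde_solution M \<F> W (\<lambda>x t. f x t / \<epsilon>) (\<sigma> / sqrt \<epsilon>) (- T) T x0 X"
    and \<sigma>: "0 < \<sigma>" and h: "0 < h" "D + h * sqrt m < d'" "0 < 1 - 2 * B * h * (m * sqrt m)"
    and \<theta>: "0 < \<theta>" "\<theta> < 1"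
  shows "measure M {\<omega> \<in> space M. exit_time (tube f x \<epsilon> T h) (- T) T (\<lambda>s. X s \<omega>) < ereal t}
    \<le> prefactor f x \<epsilon> T t *
        exp (- (\<theta>\<^sup>2 * (h * (1 - 2 * B * h * (m * sqrt m)))\<^sup>2 * exp (- (32 * B / (\<kappa> * T) * \<epsilon>)) / (2 * \<sigma>\<^sup>2)))"
proof -
  let ?eq = "\<lambda>\<omega>. (\<lambda>s. f (X s \<omega>) s / \<epsilon>) integrable_on {-T..T} \<and>
      (\<forall>t\<in>{-T..T}. X t \<omega> = x0 + integral {-T..t} (\<lambda>s. f (X s \<omega>) s / \<epsilon>) + \<sigma> / sqrt \<epsilon> * (W t \<omega> - W (- T) \<omega>))"
  let ?\<gamma> = "32 * B / (\<kappa> * T) * \<epsilon>"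
  define H where "H = h * (1 - 2 * B * h * (m * sqrt m))"
  have H: "0 < H" unfolding H_def using h(1,3) by (rule mult_pos_pos)
  have W: "wiener_process M \<F> (- T) T W"
    and Xc: "\<And>\<omega>. \<omega> \<in> space M \<Longrightarrow> continuous_on {-T..T} (\<lambda>t. X t \<omega>)"
    and ae: "AE \<omega> in M. ?eq \<omega>"
    using sde by (auto simp: sde_solution_def)
  have Wc: "\<And>\<omega>. \<omega> \<in> space M \<Longrightarrow> continuous_on {-T..T} (\<lambda>t. W t \<omega>)"
    using W by (auto simp: wiener_process_def)
  interpret prob_space M using W by (simp add: wiener_process_def)
  obtain N where N: "{\<omega> \<in> space M. \<not> ?eq \<omega>} \<subseteq> N"
    "N \<in> null_sets M"
    using AE_E[OF ae] by (metis (mono_tags, lifting) null_setsI)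
  \<comment> \<open>twice this number is at most the prefactor\<close>
  define n where "n = nat \<lceil>\<bar>\<alpha> t\<bar> / (2 * \<epsilon>\<^sup>2)\<rceil>"
  have low: "\<kappa> * T / 8 * (t + T) \<le> \<bar>\<alpha> t\<bar>" unfolding \<alpha>_def alpha_bar_def
    by (rule integral_stability_rate_ge[OF continuous_on_subset[OF a_cont sub_t] stable(1) pos(1) t])
  have "0 < \<kappa> * T / 8 * (t + T)" using pos(1) T t(1) by simp
  then have \<alpha>t: "0 < \<bar>\<alpha> t\<bar>" using low by linarith
  have q: "0 < \<bar>\<alpha> t\<bar> / (2 * \<epsilon>\<^sup>2)" using \<alpha>t \<epsilon> by simp
  then have n: "0 < n" "\<bar>\<alpha> t\<bar> / (2 * \<epsilon>\<^sup>2) \<le> real n" "real n \<le> \<bar>\<alpha> t\<bar> / (2 * \<epsilon>\<^sup>2) + 1"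
    unfolding n_def by linarith+
  have pre: "2 * real n \<le> prefactor f x \<epsilon> T t"
    using n(3) unfolding prefactor_def \<alpha>_def by (simp add: field_simps)
  have step: "2 * B * ((t - - T) / real n) / \<epsilon> \<le> ?\<gamma>"
  proof -
    have "(t + T) * (\<kappa> * T) \<le> 16 * \<epsilon>\<^sup>2 * real n"
      using low n(2) \<epsilon> by (simp add: field_simps)
    then have "(t + T) / real n \<le> 16 * \<epsilon>\<^sup>2 / (\<kappa> * T)"
      using n(1) pos(1) T by (simp add: field_simps)
    then have "2 * B * ((t + T) / real n) / \<epsilon> \<le> 2 * B * (16 * \<epsilon>\<^sup>2 / (\<kappa> * T)) / \<epsilon>"
      using B \<epsilon> by (intro divide_right_mono mult_left_mono) auto
    also have "\<dots> = ?\<gamma>" using \<epsilon> by (simp add: power2_eq_square)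
    finally show ?thesis by simp
  qed
  have slow: "Z v \<le> exp ?\<gamma> * Z u"
    if uv: "- T \<le> u" "u \<le> v" "v \<le> t" "v - u \<le> (t - - T) / real n" for u v
  proof -
    have "Z v \<le> exp (2 * B * (v - u) / \<epsilon>) * Z u"
      by (rule rescaled_variance_slow[OF \<epsilon> g_deriv_t g_pos Z_deriv_t Z_pos Z_ge B uv(1-3)]) (use sub_t in auto)
    also have "\<dots> \<le> exp ?\<gamma> * Z u"
    proof (intro mult_right_mono less_imp_le[OF Z_pos])
      have "2 * B * (v - u) / \<epsilon> \<le> 2 * B * ((t - - T) / real n) / \<epsilon>"
        using uv(4) B \<epsilon> by (intro divide_right_mono mult_left_mono) auto
      then show "exp (2 * B * (v - u) / \<epsilon>) \<le> exp ?\<gamma>" using step by simp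
      show "u \<in> {-T..T}" using uv t by auto
    qed
    finally show ?thesis .
  qed
  let ?g' = "\<lambda>v. - (a_bar f x v / \<epsilon>) * g v"
  have g'0: "0 \<le> ?g' v" if "v \<in> {-T..t}" for v
  proof -
    have "0 < \<kappa> * \<phi>" using pos by simp
    then have "a_bar f x v \<le> 0" using stable(2)[OF that] by linarith
    then show ?thesis using g_pos[of v] \<epsilon> by (intro mult_nonneg_nonneg) (auto simp: divide_nonpos_pos)
  qed
  have "continuous_on {-T..t} ?g'"
    by (rule continuous_on_subset[OF _ sub_t]) (use \<epsilon> in \<open>intro continuous_intros a_cont g_cont; simp\<close>)
  then obtain E where E: "E \<in> sets M"
    "{\<omega>\<in>space M. \<exists>s\<in>{-T..t}. H * sqrt (Z s) \<le> \<bar>\<sigma> / sqrt \<epsilon> * wiener_integral (- T) g ?g' (\<lambda>v. W v \<omega>) s\<bar>} \<subseteq> E"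
    "measure M E \<le> 2 * real n * exp (- (\<theta>\<^sup>2 * H\<^sup>2 * exp (- ?\<gamma>) / (2 * \<sigma>\<^sup>2)))"
    using wiener_integral_tube[OF W t g_deriv_t _ g'0 g_pos \<epsilon> \<sigma> H \<theta> n(1), of Z "1 / (2 * \<bar>a_bar f x (- T)\<bar>)"
        "?\<gamma>"] slow a_init(4) unfolding Z_def by blast
  let ?A = "{\<omega> \<in> space M. exit_time (tube f x \<epsilon> T h) (- T) T (\<lambda>s. X s \<omega>) < ereal t}"
  have "?A \<subseteq> E \<union> N"
  proof
    fix \<omega> assume \<omega>: "\<omega> \<in> ?A"
    show "\<omega> \<in> E \<union> N"
    proof (cases "\<omega> \<in> N")
      case False
      then have eq: "X s \<omega> = x0 + integral {-T..s} (\<lambda>s. f (X s \<omega>) s / \<epsilon>) + \<sigma> / sqrt \<epsilon> * (W s \<omega> - W (- T) \<omega>)"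
        if "s \<in> {-T..T}" for s using N(1) \<omega> that by blast
      have "\<exists>\<tau>\<in>{-T..t}. H * sqrt (Z \<tau>) \<le> \<bar>\<sigma> / sqrt \<epsilon> * wiener_integral (- T) g ?g' (\<lambda>v. W v \<omega>) \<tau>\<bar>"
        unfolding H_def by (rule exit_forces_noise[OF h(1,2) Xc Wc eq]) (use \<omega> in auto)
      then show ?thesis using E(2) \<omega> by blast
    qed simp
  qed
  \<comment> \<open>a non-measurable set has measure 0 by convention\<close>
  have "measure M ?A \<le> measure M (E \<union> N)"
  proof (cases "?A \<in> sets M")
    case True
    then show ?thesis using \<open>?A \<subseteq> E \<union> N\<close> E(1) N(2) by (intro finite_measure_mono) auto
  next
    case False
    then show ?thesis by (simp add: measure_notin_sets)
  qed
  also have "\<dots> = measure M E" using E(1) N(2) by (simp add: measure_Un_null_set)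
  also have "\<dots> \<le> prefactor f x \<epsilon> T t * exp (- (\<theta>\<^sup>2 * H\<^sup>2 * exp (- ?\<gamma>) / (2 * \<sigma>\<^sup>2)))"
    by (rule order_trans[OF E(3) mult_right_mono[OF pre]]) simp
  finally show ?thesis unfolding H_def by simp
qed

end


section \<open>The exit probability\<close>

text \<open>
  Collects the relative losses: \<open>\<epsilon>\<close> from the choice \<open>\<theta> = 1 - \<epsilon>\<close>, \<open>u\<close> from the nonlinear term and \<open>w\<close> from the
  variation of \<open>Z\<close> on one piece.
\<close>

lemma exponent_bound:
  fixes \<epsilon> u w :: real
  assumes "0 \<le> \<epsilon>" "\<epsilon> \<le> 1" "0 \<le> u" "u \<le> 1" "0 \<le> w"
  shows "1 - 2 * \<epsilon> - 2 * u - w \<le> (1 - \<epsilon>)\<^sup>2 * (1 - u)\<^sup>2 * exp (- w)"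
proof -
  have prod: "1 - (x + y) \<le> a * b" if "1 - x \<le> a" "1 - y \<le> b" "0 \<le> x" "0 \<le> y" "0 \<le> a" "a \<le> 1" for x y a b :: real
  proof -
    have "a * (1 - y) \<le> a * b" using that by (intro mult_left_mono) auto
    moreover have "a * y \<le> 1 * y" using that by (intro mult_right_mono) auto
    ultimately show ?thesis using that by (simp add: algebra_simps)
  qed
  have sq: "1 - 2 * v \<le> (1 - v)\<^sup>2" for v :: real by (simp add: power2_eq_square algebra_simps)
  have le1: "0 \<le> (1 - v)\<^sup>2" "(1 - v)\<^sup>2 \<le> 1" if "0 \<le> v" "v \<le> 1" for v :: real
    using that by (auto intro: power_le_one)
  have "1 - (2 * \<epsilon> + 2 * u) \<le> (1 - \<epsilon>)\<^sup>2 * (1 - u)\<^sup>2"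
    using assms le1 by (intro prod sq) auto
  moreover have "1 - w \<le> exp (- w)" using exp_ge_add_one_self[of "- w"] by simp
  moreover have "0 \<le> (1 - \<epsilon>)\<^sup>2 * (1 - u)\<^sup>2" "(1 - \<epsilon>)\<^sup>2 * (1 - u)\<^sup>2 \<le> 1"
    using le1[of \<epsilon>] le1[of u] assms by (auto intro: mult_le_one)
  ultimately show ?thesis using prod[of "2 * \<epsilon> + 2 * u" "(1 - \<epsilon>)\<^sup>2 * (1 - u)\<^sup>2" w "exp (- w)"] assms
    by (simp add: algebra_simps)
qed

text \<open>
  The common core of both regimes: \<open>\<phi>\<close> is a lower bound, up to \<open>\<kappa>\<close>, for the contraction rate before time \<open>t\<close>.
  The lower bounds on \<open>K\<close> serve, in this order, the \<open>\<O>(\<epsilon>)\<close> loss, the nonlinear loss, and the requirement that the tube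
  stay inside the strip whenever the asserted bound is not trivial.
\<close>

lemma tube_exit_bound:
  assumes strip: "smooth_strip f d' B" and T: "0 < T" and D: "0 < d' - D" and \<kappa>: "0 < \<kappa>" and \<epsilon>: "0 < \<epsilon>" "\<epsilon> < 1"
    and \<phi>: "0 < \<phi>" "\<phi> \<le> T" and t: "- T \<le> t" "t \<le> T"
    and ode: "ode_solution (\<lambda>x t. f x t / \<epsilon>) (- T) T x0 x"
    and inside: "\<And>s. s \<in> {-T..T} \<Longrightarrow> \<bar>x s\<bar> \<le> D"
    and stable: "\<And>s. s \<in> {-T..t} \<Longrightarrow> a_bar f x s \<le> - (\<kappa> * max \<bar>s\<bar> \<phi>)"
    and sde: "sde_solution M \<F> W (\<lambda>x t. f x t / \<epsilon>) (\<sigma> / sqrt \<epsilon>) (- T) T x0 X"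
    and \<sigma>: "0 < \<sigma>" and h: "0 < h"
    and K: "2 + 32 * B / (\<kappa> * T) \<le> K" "4 * B / (2 * \<kappa> * sqrt (2 * \<kappa>)) \<le> K" "T / (sqrt (2 * \<kappa>) * (d' - D)) \<le> K"
  shows "measure M {\<omega> \<in> space M. exit_time (tube f x \<epsilon> T h) (- T) T (\<lambda>s. X s \<omega>) < ereal t}
    \<le> prefactor f x \<epsilon> T t * exp (- (1/2) * (h\<^sup>2 / \<sigma>\<^sup>2) * (1 - K * \<epsilon> - K * (h / \<phi> powr (3/2))))"
proof -
  interpret smooth_strip f d' B by (rule strip)
  interpret prob_space M using sde by (simp add: sde_solution_def wiener_process_def)
  let ?A = "{\<omega> \<in> space M. exit_time (tube f x \<epsilon> T h) (- T) T (\<lambda>s. X s \<omega>) < ereal t}"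
  define \<rho> where "\<rho> = h / \<phi> powr (3/2)"
  define e where "e = 1 - K * \<epsilon> - K * \<rho>"
  let ?bound = "prefactor f x \<epsilon> T t * exp (- (1/2) * (h\<^sup>2 / \<sigma>\<^sup>2) * e)"
  have pre: "2 \<le> prefactor f x \<epsilon> T t" by (simp add: prefactor_def)
  have \<phi>32: "\<phi> powr (3/2) = \<phi> * sqrt \<phi>"
    using powr_add[of \<phi> 1 "1/2"] \<phi>(1) by (simp add: powr_half_sqrt)
  have h\<rho>: "h = \<rho> * (\<phi> * sqrt \<phi>)" using \<phi>(1) by (simp add: \<rho>_def \<phi>32)
  have \<rho>: "0 < \<rho>" using h \<phi>(1) by (simp add: \<rho>_def)
  have K0: "0 < K"
  proof -
    have "0 < 32 * B / (\<kappa> * T)" using B \<kappa> T by simp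
    then show ?thesis using K(1) by linarith
  qed
  have "measure M ?A \<le> ?bound"
  \<comment> \<open>if the bracket is not positive, the right-hand side is at least 1\<close>
  proof (cases "e \<le> 0")
    case True
    have "0 \<le> h\<^sup>2 / \<sigma>\<^sup>2 * - e" using True by (intro mult_nonneg_nonneg) auto
    then have "1 \<le> exp (- (1/2) * (h\<^sup>2 / \<sigma>\<^sup>2) * e)" by simp
    then have "1 * 1 \<le> ?bound"
      using pre by (intro mult_mono) auto
    then show ?thesis using prob_le_1[of ?A] by linarith
  next
    case False
    have K\<rho>: "K * \<rho> < 1" using False mult_pos_pos[OF K0 \<epsilon>(1)] unfolding e_def by linarith
    show ?thesis
    \<comment> \<open>for \<open>t = - T\<close> the number of pieces would be 0\<close>
    proof (cases "t = - T")
      case True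
      have "?A = {}"
      proof -
        have "ereal (- T) \<le> exit_time (tube f x \<epsilon> T h) (- T) T X'" for X'
          unfolding exit_time_def by (rule Inf_greatest) auto
        then show ?thesis using True by (auto simp: not_less[symmetric])
      qed
      then have "measure M ?A = 0" by (simp only: measure_empty)
      then show ?thesis using pre by simp
    next
      case neq: False
      define m where "m = 1 / (2 * (\<kappa> * \<phi>))"
      interpret lt: linearised_tube f d' B x \<epsilon> T x0 D \<kappa> \<phi> t
      proof
        fix s assume s: "s \<in> {-T..t}"
        have "\<kappa> * \<bar>s\<bar> \<le> \<kappa> * max \<bar>s\<bar> \<phi>" "\<kappa> * \<phi> \<le> \<kappa> * max \<bar>s\<bar> \<phi>"
          using \<kappa> by (intro mult_left_mono; simp)+
        then show "a_bar f x s \<le> - (\<kappa> * \<bar>s\<bar>)" "a_bar f x s \<le> - (\<kappa> * \<phi>)" using stable[OF s] by linarith+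
      qed (use T \<epsilon> t neq ode inside D \<kappa> \<phi> in auto)
      have lm: "lt.m = m" by (simp add: lt.m_def m_def)
      have sm: "sqrt m = 1 / (sqrt (2 * \<kappa>) * sqrt \<phi>)"
        by (simp add: m_def real_sqrt_divide real_sqrt_mult)
      define u where "u = 2 * B * h * (m * sqrt m)"
      \<comment> \<open>the relative loss caused by the nonlinear term\<close>
      have u_eq: "u = 2 * B / (2 * \<kappa> * sqrt (2 * \<kappa>)) * \<rho>"
        unfolding u_def sm using \<phi>(1) \<kappa> by (subst h\<rho>) (simp add: m_def field_simps)
      have "4 * B / (2 * \<kappa> * sqrt (2 * \<kappa>)) * \<rho> \<le> K * \<rho>" using K(2) \<rho> by (intro mult_right_mono) auto
      then have u: "2 * u \<le> K * \<rho>" by (simp add: u_eq)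
      have u0: "0 \<le> u" unfolding u_eq using B \<kappa> \<rho> by (intro mult_nonneg_nonneg divide_nonneg_nonneg) auto
      have room: "D + h * sqrt lt.m < d'"
      proof -
        have "h * sqrt m = \<phi> / sqrt (2 * \<kappa>) * \<rho>"
          unfolding sm using \<phi>(1) \<kappa> by (subst h\<rho>) (simp add: field_simps)
        also have "\<dots> \<le> T / sqrt (2 * \<kappa>) * \<rho>"
          using \<phi>(2) \<rho> \<kappa> by (intro mult_right_mono divide_right_mono) auto
        also have "\<dots> = (T / (sqrt (2 * \<kappa>) * (d' - D)) * \<rho>) * (d' - D)" using D by simp
        also have "\<dots> \<le> (K * \<rho>) * (d' - D)" using K(3) \<rho> D by (intro mult_right_mono) auto
        also have "\<dots> < 1 * (d' - D)" using K\<rho> D by (intro mult_strict_right_mono) auto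
        finally show ?thesis unfolding lm by simp
      qed
      have u1: "u < 1" using u K\<rho> u0 by linarith
      let ?x = "(1 - \<epsilon>)\<^sup>2 * (h * (1 - u))\<^sup>2 * exp (- (32 * B / (\<kappa> * T) * \<epsilon>)) / (2 * \<sigma>\<^sup>2)"
      have p: "measure M ?A \<le> prefactor f x \<epsilon> T t *
        exp (- (?x))"
        unfolding u_def lm[symmetric]
        by (rule lt.tube_exit_probability[OF sde \<sigma> h room]) (use u1 \<epsilon> in \<open>auto simp: u_def lm\<close>)
      have "e \<le> 1 - 2 * \<epsilon> - 2 * u - 32 * B / (\<kappa> * T) * \<epsilon>"
      proof -
        have "(2 + 32 * B / (\<kappa> * T)) * \<epsilon> \<le> K * \<epsilon>" using K(1) \<epsilon>(1) by (intro mult_right_mono) auto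
        then show ?thesis using u unfolding e_def by (simp add: distrib_right)
      qed
      also have "\<dots> \<le> (1 - \<epsilon>)\<^sup>2 * (1 - u)\<^sup>2 * exp (- (32 * B / (\<kappa> * T) * \<epsilon>))"
        using \<epsilon> u0 u1 B \<kappa> T by (intro exponent_bound) auto
      finally have "h\<^sup>2 / (2 * \<sigma>\<^sup>2) * e \<le> h\<^sup>2 / (2 * \<sigma>\<^sup>2) * ((1 - \<epsilon>)\<^sup>2 * (1 - u)\<^sup>2 * exp (- (32 * B / (\<kappa> * T) * \<epsilon>)))"
        by (intro mult_left_mono) auto
      then have "- (?x)
          \<le> - (1/2) * (h\<^sup>2 / \<sigma>\<^sup>2) * e"
        by (simp add: power_mult_distrib mult_ac)
      then have "prefactor f x \<epsilon> T t *
        exp (- (?x))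
          \<le> ?bound"
        using pre by (intro mult_left_mono) (simp_all only: exp_le_cancel_iff)
      then show ?thesis using p by linarith
    qed
  qed
  then show ?thesis by (simp only: e_def \<rho>_def)
qed

theorem theorem2p6:
  fixes F :: "real \<Rightarrow> real \<Rightarrow> real \<Rightarrow> real"
    and amax d T :: real
    and xm xz xp :: "real \<Rightarrow> real \<Rightarrow> real"
  assumes "asymmetric_double_well F amax d T xm xz xp"
  shows "\<exists>h0>0. \<forall>cm>0. \<forall>cp>0. \<exists>K\<ge>0. \<forall>(a0 :: real \<Rightarrow> real) (\<sigma> :: real \<Rightarrow> real).
    (\<forall>\<epsilon>>0. 0 < a0 \<epsilon> \<and> 0 < \<sigma> \<epsilon>) \<and> (a0 \<longlongrightarrow> 0) (at_right 0) \<longrightarrow>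
    (\<forall>\<^sub>F \<epsilon> in at_right 0.
      \<forall>(x_init :: real) (xdet :: real \<Rightarrow> real) (M :: 'w measure) (\<F> :: real \<Rightarrow> 'w measure)
       (W :: real \<Rightarrow> 'w \<Rightarrow> real) (X :: real \<Rightarrow> 'w \<Rightarrow> real).
        cm * \<epsilon> \<le> x_init - xp (a0 \<epsilon>) (-T) \<and> x_init - xp (a0 \<epsilon>) (-T) \<le> cp * \<epsilon> \<and>
        ode_solution (\<lambda>x t. F (a0 \<epsilon>) x t / \<epsilon>) (-T) T x_init xdet \<and>
        sde_solution M \<F> W (\<lambda>x t. F (a0 \<epsilon>) x t / \<epsilon>) (\<sigma> \<epsilon> / sqrt \<epsilon>) (-T) T x_init X \<longrightarrow>
        (\<forall>h>0. \<forall>t.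
          (-T \<le> t \<and> t \<le> - max (sqrt (a0 \<epsilon>)) (sqrt \<epsilon>) \<and> h < h0 * \<bar>t\<bar> powr (3/2) \<longrightarrow>
            measure M {\<omega> \<in> space M.
                exit_time (tube (F (a0 \<epsilon>)) xdet \<epsilon> T h) (-T) T (\<lambda>s. X s \<omega>) < ereal t}
            \<le> prefactor (F (a0 \<epsilon>)) xdet \<epsilon> T t *
               exp (- (1/2) * (h^2 / (\<sigma> \<epsilon>)^2) * (1 - K * \<epsilon> - K * (h / \<bar>t\<bar> powr (3/2))))) \<and>
          (- max (sqrt (a0 \<epsilon>)) (sqrt \<epsilon>) \<le> t \<and> t \<le> T \<and>
             h < h0 * max (a0 \<epsilon> powr (3/4)) (\<epsilon> powr (3/4)) \<longrightarrow>
            measure M {\<omega> \<in> space M.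
                exit_time (tube (F (a0 \<epsilon>)) xdet \<epsilon> T h) (-T) T (\<lambda>s. X s \<omega>) < ereal t}
            \<le> prefactor (F (a0 \<epsilon>)) xdet \<epsilon> T t *
               exp (- (1/2) * (h^2 / (\<sigma> \<epsilon>)^2) *
                 (1 - K * \<epsilon> - K * (h / max (a0 \<epsilon> powr (3/4)) (\<epsilon> powr (3/4))))))))"
  (is "\<exists>h0>0. \<forall>cm>0. \<forall>cp>0. \<exists>K\<ge>0. \<forall>a0 \<sigma>. ?small a0 \<sigma> \<longrightarrow> (\<forall>\<^sub>F \<epsilon> in at_right 0. ?P h0 cm cp K a0 \<sigma> \<epsilon>)")
proof -
  interpret asymmetric_double_well F amax d T xm xz xp by (rule assms)
  obtain d' B \<kappa> where d': "d < d'" and B: "0 < B" and \<kappa>: "0 < \<kappa>"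
    and strip: "\<forall>a\<in>{0<..amax}. smooth_strip (F a) d' B"
    and stab: "\<forall>cp. \<exists>a1>0. \<exists>e1>0. tracks_upper_branch ((d + d') / 2) \<kappa> cp a1 e1"
    using uniform_stability by (elim exE conjE) (rule that)
  define D where "D = (d + d') / 2"
  have D: "0 < d' - D" using d' by (simp add: D_def field_simps)
  define K where "K = max (2 + 32 * B / (\<kappa> * T))
      (max (4 * B / (2 * \<kappa> * sqrt (2 * \<kappa>))) (T / (sqrt (2 * \<kappa>) * (d' - D))))"
  have K: "2 + 32 * B / (\<kappa> * T) \<le> K" "4 * B / (2 * \<kappa> * sqrt (2 * \<kappa>)) \<le> K" "T / (sqrt (2 * \<kappa>) * (d' - D)) \<le> K"
    by (simp_all add: K_def)
  have "0 < 32 * B / (\<kappa> * T)" using B \<kappa> T_pos by simp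
  then have K0: "0 \<le> K" using K(1) by linarith
  have main: "\<forall>\<^sub>F \<epsilon> in at_right 0. ?P 1 cm cp K a0 \<sigma> \<epsilon>"
    if cm: "0 < cm" and a0: "\<forall>\<epsilon>>0. 0 < a0 \<epsilon> \<and> 0 < \<sigma> \<epsilon>" "(a0 \<longlongrightarrow> 0) (at_right 0)" for cm cp a0 \<sigma>
  proof -
    obtain a1 e1 where a1: "0 < a1" and e1: "0 < e1"
      and st: "tracks_upper_branch ((d + d') / 2) \<kappa> cp a1 e1"
      using stab[rule_format, of cp] by (elim exE conjE) (rule that)
    have bpos: "0 < min amax (min a1 (T\<^sup>2))" using amax_pos a1 T_pos by simp
    have "\<forall>\<^sub>F \<epsilon> in at_right 0. a0 \<epsilon> < min amax (min a1 (T\<^sup>2))"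
      by (rule order_tendstoD(2)[OF a0(2) bpos])
    moreover have "0 < min (1 / 2) (min e1 (T\<^sup>2))" using e1 T_pos by simp
    then have "\<forall>\<^sub>F \<epsilon> in at_right 0. \<epsilon> \<in> {0<..<min (1 / 2) (min e1 (T\<^sup>2))}"
      by (rule eventually_at_right_real)
    ultimately show ?thesis
    proof eventually_elim
      case (elim \<epsilon>)
      then have \<epsilon>: "0 < \<epsilon>" "\<epsilon> < 1" "\<epsilon> \<le> e1" "\<epsilon> \<le> T\<^sup>2" and a: "a0 \<epsilon> \<le> amax" "a0 \<epsilon> \<le> a1" "a0 \<epsilon> \<le> T\<^sup>2"
        by auto
      have apos: "0 < a0 \<epsilon>" and \<sigma>: "0 < \<sigma> \<epsilon>" using a0(1) \<epsilon>(1) by auto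
      have aA: "a0 \<epsilon> \<in> {0<..amax}" using apos a by simp
      define w where "w = max (sqrt (a0 \<epsilon>)) (sqrt \<epsilon>)"
      have w: "0 < w" "w \<le> T"
        using \<epsilon> a apos T_pos by (auto simp: w_def less_max_iff_disj intro!: real_le_lsqrt)
      have w32: "max (a0 \<epsilon> powr (3/4)) (\<epsilon> powr (3/4)) = w powr (3/2)"
      proof -
        have s: "sqrt v powr (3/2) = v powr (3/4)" if "0 < v" for v :: real
          using that by (simp add: powr_half_sqrt[symmetric] powr_powr)
        show ?thesis
        proof (cases "a0 \<epsilon> \<le> \<epsilon>")
          case True
          then show ?thesis using s[OF \<epsilon>(1)] apos by (simp add: w_def max_absorb2 powr_mono2)
        next
          case False
          then show ?thesis using s[OF apos] \<epsilon>(1) by (simp add: w_def max_absorb1 powr_mono2)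
        qed
      qed
      show ?case
      proof (intro allI impI)
        fix x_init xdet M \<F> W X h t
        assume H: "cm * \<epsilon> \<le> x_init - xp (a0 \<epsilon>) (-T) \<and> x_init - xp (a0 \<epsilon>) (-T) \<le> cp * \<epsilon> \<and>
          ode_solution (\<lambda>x t. F (a0 \<epsilon>) x t / \<epsilon>) (-T) T x_init xdet \<and>
          sde_solution M \<F> W (\<lambda>x t. F (a0 \<epsilon>) x t / \<epsilon>) (\<sigma> \<epsilon> / sqrt \<epsilon>) (-T) T x_init X"
          and h: "(0 :: real) < h"
        then have ode: "ode_solution (\<lambda>x t. F (a0 \<epsilon>) x t / \<epsilon>) (-T) T x_init xdet"
          and sde: "sde_solution M \<F> W (\<lambda>x t. F (a0 \<epsilon>) x t / \<epsilon>) (\<sigma> \<epsilon> / sqrt \<epsilon>) (-T) T x_init X" by auto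
        have "0 < cm * \<epsilon>" using cm \<epsilon>(1) by simp
        then have "\<bar>xdet (- T) - xp (a0 \<epsilon>) (- T)\<bar> \<le> cp * \<epsilon>"
          using H ode unfolding ode_solution_def by linarith
        then have S: "\<forall>t\<in>{-T..T}. \<bar>xdet t\<bar> < (d + d') / 2 \<and>
            dx (F (a0 \<epsilon>)) (xdet t) t \<le> - (\<kappa> * max \<bar>t\<bar> (max (sqrt (a0 \<epsilon>)) (sqrt \<epsilon>)))"
          using st[unfolded tracks_upper_branch_def] aA a(2) \<epsilon>(1,3) ode unfolding ode_solution_def by blast
        have inside: "\<bar>xdet s\<bar> \<le> D" if "s \<in> {-T..T}" for s using S that by (auto simp: D_def less_imp_le)
        have ab: "a_bar (F (a0 \<epsilon>)) xdet s \<le> - (\<kappa> * max \<bar>s\<bar> w)" if "s \<in> {-T..T}" for s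
          using S that unfolding a_bar_def w_def by blast
        note bound = tube_exit_bound[OF strip[rule_format, OF aA] T_pos D \<kappa> \<epsilon>(1,2) _ _ _ _ ode inside _ sde \<sigma> h K]
        let ?p = "measure M {\<omega> \<in> space M.
          exit_time (tube (F (a0 \<epsilon>)) xdet \<epsilon> T h) (-T) T (\<lambda>s. X s \<omega>) < ereal t}"
        let ?b = "\<lambda>v. prefactor (F (a0 \<epsilon>)) xdet \<epsilon> T t *
          exp (- (1/2) * (h^2 / (\<sigma> \<epsilon>)^2) * (1 - K * \<epsilon> - K * (h / v)))"
        show "(-T \<le> t \<and> t \<le> - max (sqrt (a0 \<epsilon>)) (sqrt \<epsilon>) \<and> h < 1 * \<bar>t\<bar> powr (3/2) \<longrightarrow>
            ?p \<le> ?b (\<bar>t\<bar> powr (3/2))) \<and>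
          (- max (sqrt (a0 \<epsilon>)) (sqrt \<epsilon>) \<le> t \<and> t \<le> T \<and>
             h < 1 * max (a0 \<epsilon> powr (3/4)) (\<epsilon> powr (3/4)) \<longrightarrow>
            ?p \<le> ?b (max (a0 \<epsilon> powr (3/4)) (\<epsilon> powr (3/4))))"
        proof (intro conjI impI)
          assume t: "-T \<le> t \<and> t \<le> - max (sqrt (a0 \<epsilon>)) (sqrt \<epsilon>) \<and> h < 1 * \<bar>t\<bar> powr (3/2)"
          then have tw: "t \<le> - w" by (simp add: w_def)
          show "?p \<le> ?b (\<bar>t\<bar> powr (3/2))"
          proof (rule bound)
            fix s assume s: "s \<in> {-T..t}"
            have "max \<bar>s\<bar> \<bar>t\<bar> \<le> max \<bar>s\<bar> w" using s tw w by auto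
            then have "\<kappa> * max \<bar>s\<bar> \<bar>t\<bar> \<le> \<kappa> * max \<bar>s\<bar> w" using \<kappa> by (intro mult_left_mono) auto
            then show "a_bar (F (a0 \<epsilon>)) xdet s \<le> - (\<kappa> * max \<bar>s\<bar> \<bar>t\<bar>)"
              using ab[of s] s tw w by auto
          qed (use t tw w in auto)
        next
          assume t: "- max (sqrt (a0 \<epsilon>)) (sqrt \<epsilon>) \<le> t \<and> t \<le> T \<and>
             h < 1 * max (a0 \<epsilon> powr (3/4)) (\<epsilon> powr (3/4))"
          then have tw: "- w \<le> t" "t \<le> T" by (auto simp: w_def)
          show "?p \<le> ?b (max (a0 \<epsilon> powr (3/4)) (\<epsilon> powr (3/4)))"
            unfolding w32 by (rule bound) (use tw w ab in auto)
        qed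
      qed
    qed
  qed
  show ?thesis
    by (rule exI[of _ 1], rule conjI[OF zero_less_one], intro allI impI, rule exI[of _ K], rule conjI[OF K0],
        intro allI impI, rule main) auto
qed

end
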